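(* Let $M=\{M_i\}_{1\le i\le m}$ be a family of germs of real analytic totally real $n$-dimensional submanifolds of $\mathbb C^n$ passing through the origin, with anti-holomorphic involutions $\rho_i(z)=B_i\bar z+R_i(\bar z)$ and $G$ the group generated by $F_{i,j}=\rho_i\circ\rho_j$, $1\le i,j\le m$. Assume that $G$ is abelian and that the linear parts $D_{i,j}=\mathrm{diag}(\mu_{i,j,1},\dots,\mu_{i,j,n})$ of the $F_{i,j}$ at $0$ are diagonal; put $D=\{D_{i,j}\}$. Assume that the family $M$ is non-resonant, that $G$ is formally linearizable and that $D$ is diophantine. Then, in a good holomorphic coordinate system at the origin, $M$ is composed of linear totally real subspaces $$\bigcup_i\{z\in\mathbb C^n: B_i\bar z=z\},$$ i.e. each $M_i$ is $\{z: B_i\bar z=z\}$ in these coordinates.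
   Context: Each $M_i$ is locally the fixed point set of a germ of anti-holomorphic involution $\rho_i(z)=B_i\bar z+R_i(\bar z)$, with $R_i$ a germ of holomorphic map, $R_i(0)=0$, $DR_i(0)=0$, $B_i$ invertible, $B_i\bar B_i=\mathrm{Id}$. The tangent spaces $\{z=B_i\bar z\}$ at $0$ are pairwise distinct. $F_{i,j}$ is a germ of holomorphic diffeomorphism with linear part $D_{i,j}=B_i\bar B_j$. For $Q\in\mathbb N^n$: $|Q|=\sum q_k$, $\mu_{i,j}^Q=\prod_k\mu_{i,j,k}^{q_k}$. $M$ is non-resonant if for all $1\le i\le m$, $1\le k\le n$ and all $Q\in\mathbb N^n$ with $|Q|\ge2$, there is $1\le j\le m$ with $\bar\mu_{i,j}^Q\ne\mu_{i,j,k}^{-1}$. $G$ is formally linearizable if there is a formal diffeomorphism $\hat\Phi$ of $(\mathbb C^n,0)$, tangent to the identity at $0$, such that $\hat\Phi^{-1}\circ F_{i,j}\circ\hat\Phi(x)=D_{i,j}x$ for all $i,j$. $D$ is diophantine if $-\sum_{k\ge1}2^{-k}\ln\omega_k(D)<+\infty$, where $\omega_k(D)=\inf\{\max_{i,j}|\mu_{i,j}^Q-\mu_{i,j,k'}|\ne0: 2\le|Q|\le2^k,\ 1\le k'\le n\}$ (only nonzero values of the maximum are considered). *)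

theory Defs
  imports "HOL-Analysis.Analysis" "HOL-Algebra.Elementary_Groups"
begin

section \<open>Multi-indices and formal power series in several variables\<close>

text \<open>
  The coordinates of \<open>\<complex>\<^sup>n\<close> are indexed by a finite type \<open>'n\<close>; a multi-index is a function
  \<open>'n \<Rightarrow> nat\<close>.
\<close>

definition mdeg :: "('n::finite \<Rightarrow> nat) \<Rightarrow> nat"
  where "mdeg Q = (\<Sum>k\<in>UNIV. Q k)"

definition mpow :: "('n::finite \<Rightarrow> 'a::comm_monoid_mult) \<Rightarrow> ('n \<Rightarrow> nat) \<Rightarrow> 'a"
  where "mpow x Q = (\<Prod>k\<in>UNIV. x k ^ Q k)"

definition munit :: "'n \<Rightarrow> 'n \<Rightarrow> nat"
  where "munit k = (\<lambda>l. if l = k then 1 else 0)"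

typedef 'n mfps = "UNIV :: (('n::finite \<Rightarrow> nat) \<Rightarrow> complex) set"
  morphisms mfps_nth Abs_mfps ..

lemmas mfps_nth_Abs [simp] = Abs_mfps_inverse [OF UNIV_I]

lemma mfps_eqI: "(\<And>\<alpha>. mfps_nth f \<alpha> = mfps_nth g \<alpha>) \<Longrightarrow> f = g"
  by (metis ext mfps_nth_inverse)

lemma finite_multiindex_le [simp]: "finite {\<beta>::'n::finite \<Rightarrow> nat. \<beta> \<le> \<alpha>}"
proof (rule finite_subset)
  show "{\<beta>. \<beta> \<le> \<alpha>} \<subseteq> (\<Pi>\<^sub>E k\<in>UNIV. {..\<alpha> k})"
    by (auto simp: le_fun_def)
  show "finite (\<Pi>\<^sub>E k\<in>UNIV. {..\<alpha> k})"
    by (intro finite_PiE) auto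
qed

instantiation mfps :: (finite) comm_ring_1
begin

definition "0 = Abs_mfps (\<lambda>_. 0)"
definition "1 = Abs_mfps (\<lambda>\<alpha>. if \<alpha> = (\<lambda>_. 0) then 1 else 0)"
definition "f + g = Abs_mfps (\<lambda>\<alpha>. mfps_nth f \<alpha> + mfps_nth g \<alpha>)"
definition "f - g = Abs_mfps (\<lambda>\<alpha>. mfps_nth f \<alpha> - mfps_nth g \<alpha>)"
definition "- f = Abs_mfps (\<lambda>\<alpha>. - mfps_nth f \<alpha>)"
definition "f * g =
  Abs_mfps (\<lambda>\<alpha>. \<Sum>\<beta> | \<beta> \<le> \<alpha>. mfps_nth f \<beta> * mfps_nth g (\<lambda>k. \<alpha> k - \<beta> k))"

instance
proof
  fix f g h :: "'a mfps"
  show "f * g = g * f"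
  proof (rule mfps_eqI)
    fix \<alpha> :: "'a \<Rightarrow> nat"
    show "mfps_nth (f * g) \<alpha> = mfps_nth (g * f) \<alpha>"
      unfolding times_mfps_def mfps_nth_Abs
      by (rule sum.reindex_bij_witness [where i = "\<lambda>\<beta> k. \<alpha> k - \<beta> k" and j = "\<lambda>\<beta> k. \<alpha> k - \<beta> k"])
         (auto simp: le_fun_def)
  qed
  show "f * g * h = f * (g * h)"
  proof (rule mfps_eqI)
    fix \<alpha> :: "'a \<Rightarrow> nat"
    have "mfps_nth (f * g * h) \<alpha> =
      (\<Sum>(\<beta>,\<gamma>) \<in> (SIGMA \<beta>:{\<beta>. \<beta> \<le> \<alpha>}. {\<gamma>. \<gamma> \<le> \<beta>}).
         mfps_nth f \<gamma> * mfps_nth g (\<lambda>k. \<beta> k - \<gamma> k) * mfps_nth h (\<lambda>k. \<alpha> k - \<beta> k))"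
      unfolding times_mfps_def mfps_nth_Abs sum_distrib_right by (rule sum.Sigma) auto
    also have "\<dots> =
      (\<Sum>(\<gamma>,\<delta>) \<in> (SIGMA \<gamma>:{\<gamma>. \<gamma> \<le> \<alpha>}. {\<delta>. \<delta> \<le> (\<lambda>k. \<alpha> k - \<gamma> k)}).
         mfps_nth f \<gamma> * (mfps_nth g \<delta> * mfps_nth h (\<lambda>k. \<alpha> k - \<gamma> k - \<delta> k)))"
    proof (rule sum.reindex_bij_witness [where i = "\<lambda>(\<gamma>,\<delta>). (\<lambda>k. \<gamma> k + \<delta> k, \<gamma>)"
            and j = "\<lambda>(\<beta>,\<gamma>). (\<gamma>, \<lambda>k. \<beta> k - \<gamma> k)"], goal_cases)
      case (2 x)
      obtain \<beta> \<gamma> where x: "x = (\<beta>, \<gamma>)" by (cases x)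
      with 2 have "\<gamma> k \<le> \<beta> k \<and> \<beta> k \<le> \<alpha> k" for k by (simp add: le_fun_def)
      then show ?case
        unfolding x by (simp add: le_fun_def) (meson diff_le_mono order_trans)
    next
      case (4 x)
      obtain \<gamma> \<delta> where x: "x = (\<gamma>, \<delta>)" by (cases x)
      with 4 have *: "\<gamma> k \<le> \<alpha> k \<and> \<delta> k \<le> \<alpha> k - \<gamma> k" for k by (simp add: le_fun_def)
      have "\<gamma> k + \<delta> k \<le> \<alpha> k" for k using * [of k] by linarith
      then show ?case
        unfolding x by (simp add: le_fun_def)
    next
      case (5 x)
      obtain \<beta> \<gamma> where x: "x = (\<beta>, \<gamma>)" by (cases x)
      with 5 have *: "\<gamma> k \<le> \<beta> k \<and> \<beta> k \<le> \<alpha> k" for k by (simp add: le_fun_def)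
      have "(\<lambda>k. \<alpha> k - \<gamma> k - (\<beta> k - \<gamma> k)) = (\<lambda>k. \<alpha> k - \<beta> k)"
        using * by (auto simp: fun_eq_iff)
      then show ?case
        unfolding x by (simp add: mult.assoc)
    qed (auto simp: le_fun_def)
    also have "\<dots> = mfps_nth (f * (g * h)) \<alpha>"
      unfolding times_mfps_def mfps_nth_Abs sum_distrib_left by (rule sum.Sigma [symmetric]) auto
    finally show "mfps_nth (f * g * h) \<alpha> = mfps_nth (f * (g * h)) \<alpha>" .
  qed
  show "1 * f = f"
  proof (rule mfps_eqI)
    fix \<alpha> :: "'a \<Rightarrow> nat"
    have "mfps_nth (1 * f) \<alpha> = (\<Sum>\<beta> | \<beta> \<le> \<alpha>. if \<beta> = (\<lambda>_. 0) then mfps_nth f \<alpha> else 0)"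
      unfolding times_mfps_def one_mfps_def mfps_nth_Abs by (intro sum.cong) auto
    also have "\<dots> = mfps_nth f \<alpha>"
      by (subst sum.delta [OF finite_multiindex_le]) (auto simp: le_fun_def)
    finally show "mfps_nth (1 * f) \<alpha> = mfps_nth f \<alpha>" .
  qed
  show "(f + g) * h = f * h + g * h"
    by (rule mfps_eqI) (simp add: times_mfps_def plus_mfps_def ring_distribs sum.distrib)
  show "(0::'a mfps) \<noteq> 1"
  proof
    assume "(0::'a mfps) = 1"
    then have "mfps_nth (0::'a mfps) (\<lambda>_. 0) = mfps_nth (1::'a mfps) (\<lambda>_. 0)" by simp
    then show False by (simp add: zero_mfps_def one_mfps_def)
  qed
qed (rule mfps_eqI, simp add: plus_mfps_def minus_mfps_def uminus_mfps_def zero_mfps_def)+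

end

text \<open>
  A formal map of \<open>(\<complex>\<^sup>n, 0)\<close> is a vector of series. If \<open>G\<close> has no constant term, the coefficient of
  degree \<open>\<beta>\<close> of the power \<open>G\<^sup>\<alpha>\<close> vanishes for \<open>|\<alpha>| > |\<beta>|\<close>, so the finite sum below is the usual
  substitution; for other \<open>G\<close> it is meaningless.
\<close>

definition mfps_compose :: "'n::finite mfps \<Rightarrow> 'n mfps ^ 'n \<Rightarrow> 'n mfps"
  where "mfps_compose f G =
    Abs_mfps (\<lambda>\<beta>. \<Sum>\<alpha> | mdeg \<alpha> \<le> mdeg \<beta>. mfps_nth f \<alpha> * mfps_nth (mpow (\<lambda>k. G $ k) \<alpha>) \<beta>)"

definition fmap_compose :: "'n::finite mfps ^ 'n \<Rightarrow> 'n mfps ^ 'n \<Rightarrow> 'n mfps ^ 'n"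
  where "fmap_compose F G = (\<chi> l. mfps_compose (F $ l) G)"

definition fmap_linear :: "complex ^ 'n ^ 'n \<Rightarrow> 'n::finite mfps ^ 'n"
  where "fmap_linear A = (\<chi> l. Abs_mfps (\<lambda>\<alpha>. \<Sum>k | \<alpha> = munit k. A $ l $ k))"

abbreviation fmap_id :: "'n::finite mfps ^ 'n"
  where "fmap_id \<equiv> fmap_linear (mat 1)"

definition fmap_tangent_id :: "'n::finite mfps ^ 'n \<Rightarrow> bool"
  where "fmap_tangent_id \<Phi> \<longleftrightarrow>
    (\<forall>l \<alpha>. mdeg \<alpha> \<le> 1 \<longrightarrow> mfps_nth (\<Phi> $ l) \<alpha> = mfps_nth (fmap_id $ l) \<alpha>)"

definition fmap_inverse_pair :: "'n::finite mfps ^ 'n \<Rightarrow> 'n mfps ^ 'n \<Rightarrow> bool"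
  where "fmap_inverse_pair \<Phi> \<Psi> \<longleftrightarrow>
    (\<forall>l. mfps_nth (\<Phi> $ l) (\<lambda>_. 0) = 0) \<and> (\<forall>l. mfps_nth (\<Psi> $ l) (\<lambda>_. 0) = 0) \<and>
    fmap_compose \<Phi> \<Psi> = fmap_id \<and> fmap_compose \<Psi> \<Phi> = fmap_id"

text \<open>The Taylor expansion at the origin of a map of \<open>\<complex>\<^sup>n\<close>, converging on a polydisc.\<close>

definition has_mfps_expansion :: "(complex ^ 'n \<Rightarrow> complex ^ 'n) \<Rightarrow> 'n::finite mfps ^ 'n \<Rightarrow> bool"
  where "has_mfps_expansion f T \<longleftrightarrow>
    (\<exists>r>0. \<forall>z. (\<forall>k. cmod (z $ k) < r) \<longrightarrow>
      (\<forall>l. ((\<lambda>\<alpha>. mfps_nth (T $ l) \<alpha> * mpow (\<lambda>k. z $ k) \<alpha>) has_sum f z $ l) UNIV))"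

definition real_analytic_at :: "(real ^ 'n \<Rightarrow> complex ^ 'n) \<Rightarrow> real ^ 'n::finite \<Rightarrow> bool"
  where "real_analytic_at f a \<longleftrightarrow>
    (\<exists>T :: 'n mfps ^ 'n. \<exists>r>0. \<forall>x. (\<forall>k. \<bar>x $ k - a $ k\<bar> < r) \<longrightarrow>
      (\<forall>l. ((\<lambda>\<alpha>. mfps_nth (T $ l) \<alpha> * of_real (mpow (\<lambda>k. x $ k - a $ k) \<alpha>)) has_sum f x $ l) UNIV))"

section \<open>Germs of holomorphic maps at the origin\<close>

text \<open>Germs at \<open>0\<close> of sets and maps are represented by arbitrary representatives; only their
  restriction to neighbourhoods of \<open>0\<close> is ever constrained.\<close>

definition holomorphic_germ :: "(complex ^ 'n \<Rightarrow> complex ^ 'n::finite) \<Rightarrow> bool"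
  where "holomorphic_germ f \<longleftrightarrow>
    (\<forall>\<^sub>F z in nhds 0. \<exists>A :: complex ^ 'n ^ 'n. (f has_derivative (\<lambda>h. A *v h)) (at z))"

definition biholomorphic_germ :: "(complex ^ 'n \<Rightarrow> complex ^ 'n::finite) \<Rightarrow> bool"
  where "biholomorphic_germ f \<longleftrightarrow> holomorphic_germ f \<and> f 0 = 0 \<and>
    (\<exists>g. holomorphic_germ g \<and> g 0 = 0 \<and>
      (\<forall>\<^sub>F z in nhds 0. g (f z) = z) \<and> (\<forall>\<^sub>F z in nhds 0. f (g z) = z))"

definition germ :: "(complex ^ 'n \<Rightarrow> complex ^ 'n) \<Rightarrow> (complex ^ 'n \<Rightarrow> complex ^ 'n::finite) set"
  where "germ f = {g. \<forall>\<^sub>F z in nhds 0. g z = f z}"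

definition biholomorphic_germs :: "(complex ^ 'n \<Rightarrow> complex ^ 'n::finite) set monoid"
  where "biholomorphic_germs =
    \<lparr>carrier = germ ` Collect biholomorphic_germ,
     mult = (\<lambda>X Y. {h. \<exists>f\<in>X. \<exists>g\<in>Y. \<forall>\<^sub>F z in nhds 0. h z = f (g z)}),
     one = germ id\<rparr>"

lemma holomorphic_germ_tendsto:
  assumes "holomorphic_germ f" "f 0 = 0"
  shows "filterlim f (nhds 0) (nhds 0)"
proof -
  obtain A :: "complex ^ 'a ^ 'a" where "(f has_derivative (\<lambda>h. A *v h)) (at 0)"
    using eventually_nhds_x_imp_x [OF assms(1) [unfolded holomorphic_germ_def]] by auto
  then have "isCont f 0"
    by (rule has_derivative_continuous)
  then show ?thesis
    using assms(2) by (metis isCont_def tendsto_at_iff_tendsto_nhds)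
qed

lemma holomorphic_germ_compose:
  assumes f: "holomorphic_germ f" and g: "holomorphic_germ g" "g 0 = 0"
  shows "holomorphic_germ (\<lambda>z. f (g z))"
proof -
  have "\<forall>\<^sub>F z in nhds 0. \<exists>A :: complex ^ 'a ^ 'a. (f has_derivative (\<lambda>h. A *v h)) (at (g z))"
    using f holomorphic_germ_tendsto [OF g] unfolding holomorphic_germ_def filterlim_iff by auto
  then show ?thesis
    using g(1) unfolding holomorphic_germ_def
  proof eventually_elim
    case (elim z)
    then obtain A C :: "complex ^ 'a ^ 'a" where "(f has_derivative (\<lambda>h. A *v h)) (at (g z))"
      and "(g has_derivative (\<lambda>h. C *v h)) (at z)" by auto
    then have "((\<lambda>z. f (g z)) has_derivative (\<lambda>h. A *v (C *v h))) (at z)"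
      by (rule has_derivative_compose [rotated])
    then show ?case
      by (auto simp: matrix_vector_mul_assoc)
  qed
qed

lemma germ_eq_iff: "germ f = germ g \<longleftrightarrow> (\<forall>\<^sub>F z in nhds 0. f z = g z)"
proof
  assume "germ f = germ g"
  then have "f \<in> germ g" by (auto simp: germ_def)
  then show "\<forall>\<^sub>F z in nhds 0. f z = g z" by (simp add: germ_def)
next
  assume fg: "\<forall>\<^sub>F z in nhds 0. f z = g z"
  show "germ f = germ g"
  proof (rule Set.set_eqI)
    fix h
    show "h \<in> germ f \<longleftrightarrow> h \<in> germ g"
      unfolding germ_def mem_Collect_eq
      by (rule eventually_cong [OF fg]) simp
  qed
qed

lemma mult_germ:
  assumes "biholomorphic_germ g"
  shows "germ f \<otimes>\<^bsub>biholomorphic_germs\<^esub> germ g = germ (f \<circ> g)"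
proof -
  have "\<forall>\<^sub>F z in nhds 0. f' (g' z) = f (g z)" if "f' \<in> germ f" "g' \<in> germ g" for f' g'
  proof -
    have "\<forall>\<^sub>F z in nhds 0. f' (g z) = f (g z)"
      using that(1) holomorphic_germ_tendsto [of g] assms
      unfolding germ_def biholomorphic_germ_def filterlim_iff by auto
    moreover have "\<forall>\<^sub>F z in nhds 0. g' z = g z"
      using that(2) by (simp add: germ_def)
    ultimately show ?thesis by eventually_elim simp
  qed
  note * = this
  have "h \<in> germ f \<otimes>\<^bsub>biholomorphic_germs\<^esub> germ g \<longleftrightarrow> h \<in> germ (f \<circ> g)" for h
  proof
    assume "h \<in> germ f \<otimes>\<^bsub>biholomorphic_germs\<^esub> germ g"
    then obtain f' g' where fg': "f' \<in> germ f" "g' \<in> germ g" "\<forall>\<^sub>F z in nhds 0. h z = f' (g' z)"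
      by (auto simp: biholomorphic_germs_def)
    have "\<forall>\<^sub>F z in nhds 0. h z = f (g z)"
      using * [OF fg'(1,2)] fg'(3) by eventually_elim simp
    then show "h \<in> germ (f \<circ> g)"
      by (simp add: germ_def)
  next
    assume "h \<in> germ (f \<circ> g)"
    then have "\<forall>\<^sub>F z in nhds 0. h z = f (g z)"
      by (simp add: germ_def)
    moreover have "f \<in> germ f" "g \<in> germ g"
      by (auto simp: germ_def)
    ultimately show "h \<in> germ f \<otimes>\<^bsub>biholomorphic_germs\<^esub> germ g"
      unfolding biholomorphic_germs_def by auto
  qed
  then show ?thesis
    by blast
qed

lemma biholomorphic_germ_compose:
  assumes f: "biholomorphic_germ f" and g: "biholomorphic_germ g"
  shows "biholomorphic_germ (f \<circ> g)"
proof -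
  obtain f' where f': "holomorphic_germ f'" "f' 0 = 0"
    "\<forall>\<^sub>F z in nhds 0. f' (f z) = z" "\<forall>\<^sub>F z in nhds 0. f (f' z) = z"
    using f by (auto simp: biholomorphic_germ_def)
  obtain g' where g': "holomorphic_germ g'" "g' 0 = 0"
    "\<forall>\<^sub>F z in nhds 0. g' (g z) = z" "\<forall>\<^sub>F z in nhds 0. g (g' z) = z"
    using g by (auto simp: biholomorphic_germ_def)
  have fg: "holomorphic_germ f" "f 0 = 0" "holomorphic_germ g" "g 0 = 0"
    using f g by (auto simp: biholomorphic_germ_def)
  have "\<forall>\<^sub>F z in nhds 0. f' (f (g z)) = g z"
    using f'(3) holomorphic_germ_tendsto [OF fg(3,4)] by (auto simp: filterlim_iff)
  then have 1: "\<forall>\<^sub>F z in nhds 0. g' (f' (f (g z))) = z"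
    using g'(3) by eventually_elim simp
  have "\<forall>\<^sub>F z in nhds 0. g (g' (f' z)) = f' z"
    using g'(4) holomorphic_germ_tendsto [OF f'(1,2)] by (auto simp: filterlim_iff)
  then have 2: "\<forall>\<^sub>F z in nhds 0. f (g (g' (f' z))) = z"
    using f'(4) by eventually_elim simp
  show ?thesis
    unfolding biholomorphic_germ_def o_def
    using 1 2 fg f'(2) g'(2) holomorphic_germ_compose [OF fg(1,3,4)]
      holomorphic_germ_compose [OF g'(1) f'(1,2)]
    by (intro conjI exI [of _ "\<lambda>z. g' (f' z)"]) simp_all
qed

lemma biholomorphic_germ_id: "biholomorphic_germ id"
proof -
  have "holomorphic_germ (id :: complex ^ 'a \<Rightarrow> complex ^ 'a)"
    unfolding holomorphic_germ_def
  proof (intro always_eventually allI exI [of _ "mat 1"])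
    show "(id has_derivative (\<lambda>h. mat 1 *v h)) (at z)" for z :: "complex ^ 'a"
      unfolding matrix_vector_mul_lid id_def by (rule has_derivative_ident)
  qed
  then show ?thesis
    unfolding biholomorphic_germ_def by (intro conjI exI [of _ id]) simp_all
qed

lemma group_biholomorphic_germs:
  "group (biholomorphic_germs :: (complex ^ 'n \<Rightarrow> complex ^ 'n::finite) set monoid)"
proof (rule groupI)
  let ?K = "biholomorphic_germs :: (complex ^ 'n \<Rightarrow> complex ^ 'n::finite) set monoid"
  have carrier: "carrier ?K = germ ` Collect biholomorphic_germ" "\<one>\<^bsub>?K\<^esub> = germ id"
    by (simp_all add: biholomorphic_germs_def)
  show "\<one>\<^bsub>?K\<^esub> \<in> carrier ?K"
    using biholomorphic_germ_id by (auto simp: carrier)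
  fix X assume "X \<in> carrier ?K"
  then obtain f where f: "X = germ f" "biholomorphic_germ f" by (auto simp: carrier)
  show "\<one>\<^bsub>?K\<^esub> \<otimes>\<^bsub>?K\<^esub> X = X"
    by (simp add: carrier f mult_germ)
  obtain g where g: "holomorphic_germ g" "g 0 = 0"
    "\<forall>\<^sub>F z in nhds 0. g (f z) = z" "\<forall>\<^sub>F z in nhds 0. f (g z) = z"
    using f(2) by (auto simp: biholomorphic_germ_def)
  have "biholomorphic_germ g"
    using f(2) g by (auto simp: biholomorphic_germ_def)
  moreover have "germ g \<otimes>\<^bsub>?K\<^esub> X = \<one>\<^bsub>?K\<^esub>"
    using g(3) by (simp add: carrier f mult_germ germ_eq_iff)
  ultimately show "\<exists>Y\<in>carrier ?K. Y \<otimes>\<^bsub>?K\<^esub> X = \<one>\<^bsub>?K\<^esub>"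
    by (auto simp: carrier)
  fix Y assume "Y \<in> carrier ?K"
  then obtain h where h: "Y = germ h" "biholomorphic_germ h" by (auto simp: carrier)
  show "X \<otimes>\<^bsub>?K\<^esub> Y \<in> carrier ?K"
    using f h by (auto simp: carrier mult_germ biholomorphic_germ_compose)
  fix Z assume "Z \<in> carrier ?K"
  then obtain k where k: "Z = germ k" "biholomorphic_germ k" by (auto simp: carrier)
  show "X \<otimes>\<^bsub>?K\<^esub> Y \<otimes>\<^bsub>?K\<^esub> Z = X \<otimes>\<^bsub>?K\<^esub> (Y \<otimes>\<^bsub>?K\<^esub> Z)"
    using f h k by (simp add: mult_germ biholomorphic_germ_compose o_assoc)
qed

section \<open>Families of totally real submanifolds\<close>

definition vcnj :: "complex ^ 'n \<Rightarrow> complex ^ 'n::finite"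
  where "vcnj z = (\<chi> k. cnj (z $ k))"

definition diag_matrix :: "('n \<Rightarrow> complex) \<Rightarrow> complex ^ 'n ^ 'n::finite"
  where "diag_matrix d = (\<chi> k l. if k = l then d k else 0)"

text \<open>
  Near \<open>0\<close>, \<open>M\<close> is an embedded real analytic submanifold of real dimension \<open>n\<close>, given by a
  parametrization \<open>\<gamma>\<close>, whose tangent spaces \<open>T\<close> satisfy \<open>T \<inter> \<i>T = {0}\<close>.
\<close>

definition totally_real_analytic_germ :: "(complex ^ 'n::finite) set \<Rightarrow> bool"
  where "totally_real_analytic_germ M \<longleftrightarrow>
    (\<exists>(U :: (real ^ 'n) set) W \<gamma> \<gamma>' d. open U \<and> 0 \<in> U \<and> open W \<and> 0 \<in> W \<and>
      homeomorphism U (M \<inter> W) \<gamma> \<gamma>' \<and> \<gamma> 0 = 0 \<and>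
      (\<forall>x\<in>U. real_analytic_at \<gamma> x \<and> (\<gamma> has_derivative d x) (at x) \<and> inj (d x) \<and>
        range (d x) \<inter> (\<lambda>v. \<i> *s v) ` range (d x) = {0}))"

text \<open>\<open>\<mu> i j k\<close> is the \<open>k\<close>-th eigenvalue of the linear part \<open>D\<^sub>i\<^sub>j\<close> of \<open>\<rho>\<^sub>i \<circ> \<rho>\<^sub>j\<close>.\<close>

definition nonresonant :: "('m::finite \<Rightarrow> 'm \<Rightarrow> 'n::finite \<Rightarrow> complex) \<Rightarrow> bool"
  where "nonresonant \<mu> \<longleftrightarrow>
    (\<forall>i k Q. mdeg Q \<ge> 2 \<longrightarrow> (\<exists>j. mpow (\<lambda>l. cnj (\<mu> i j l)) Q \<noteq> inverse (\<mu> i j k)))"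

definition formally_linearizable ::
  "('m::finite \<Rightarrow> 'm \<Rightarrow> complex ^ 'n \<Rightarrow> complex ^ 'n) \<Rightarrow>
   ('m \<Rightarrow> 'm \<Rightarrow> complex ^ 'n ^ 'n::finite) \<Rightarrow> bool"
  where "formally_linearizable F D \<longleftrightarrow>
    (\<exists>T \<Phi> \<Psi>. (\<forall>i j. has_mfps_expansion (F i j) (T i j)) \<and>
      fmap_tangent_id \<Phi> \<and> fmap_inverse_pair \<Phi> \<Psi> \<and>
      (\<forall>i j. fmap_compose \<Psi> (fmap_compose (T i j) \<Phi>) = fmap_linear (D i j)))"

definition small_divisor :: "('m::finite \<Rightarrow> 'm \<Rightarrow> 'n::finite \<Rightarrow> complex) \<Rightarrow> ('n \<Rightarrow> nat) \<Rightarrow> 'n \<Rightarrow> real"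
  where "small_divisor \<mu> Q k = Max (range (\<lambda>(i, j). cmod (mpow (\<mu> i j) Q - \<mu> i j k)))"

definition omega :: "('m::finite \<Rightarrow> 'm \<Rightarrow> 'n::finite \<Rightarrow> complex) \<Rightarrow> nat \<Rightarrow> real"
  where "omega \<mu> p = Inf {small_divisor \<mu> Q k | Q k.
    2 \<le> mdeg Q \<and> mdeg Q \<le> 2 ^ p \<and> small_divisor \<mu> Q k \<noteq> 0}"

text \<open>
  The sum starts at \<open>p = 1\<close>. As \<open>omega \<mu>\<close> is nonincreasing, the terms are bounded below by those of
  a convergent series, so finiteness of the sum in \<open>(-\<infinity>, +\<infinity>]\<close> is summability. For nonzero \<open>\<mu>\<close>
  the set in \<open>omega \<mu> p\<close> with \<open>p \<ge> 1\<close> is empty only if all \<open>\<mu>\<^sub>i\<^sub>j\<^sub>k = 1\<close>; it is then empty for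
  every \<open>p\<close>, the terms are constant up to the factor \<open>2\<^sup>-\<^sup>p\<close>, and the condition holds, as
  with \<open>inf \<emptyset> = +\<infinity>\<close>.
\<close>

definition diophantine :: "('m::finite \<Rightarrow> 'm \<Rightarrow> 'n::finite \<Rightarrow> complex) \<Rightarrow> bool"
  where "diophantine \<mu> \<longleftrightarrow> summable (\<lambda>p. - ln (omega \<mu> (Suc p)) / 2 ^ Suc p)"

end

theory Submission
  imports Defs "HOL-Library.Function_Algebras" "HOL-Complex_Analysis.Cauchy_Integral_Formula"
begin

text \<open>
  Comparing linear parts gives \<open>D\<^sub>i\<^sub>j = B\<^sub>i (cnj B\<^sub>j)\<close>, hence \<open>D\<^sub>i\<^sub>j B\<^sub>i (cnj D\<^sub>i\<^sub>j) = B\<^sub>i\<close>: for every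
  index \<open>k\<close> there is an index \<open>l\<close> with \<open>cnj \<mu>\<^sub>i\<^sub>j\<^sub>k = 1 / \<mu>\<^sub>i\<^sub>j\<^sub>l\<close> for all \<open>j\<close>. So non-resonance of the
  family of submanifolds says that no small divisor \<open>max |\<mu>\<^sub>i\<^sub>j\<^sup>Q - \<mu>\<^sub>i\<^sub>j\<^sub>k|\<close> vanishes.

  The coefficients of the formal linearization \<open>\<Phi>\<close> satisfy
  \<open>(\<mu>\<^sub>i\<^sub>j\<^sup>Q - \<mu>\<^sub>i\<^sub>j\<^sub>k) \<Phi>\<^sub>k\<^sub>Q = [F\<^sub>i\<^sub>j\<^sub>k \<circ> \<Phi>]\<^sub>Q\<close> up to linear terms. Choosing \<open>(i, j)\<close> separately for every
  \<open>(Q, k)\<close> so as to maximize the divisor reduces the convergence of \<open>\<Phi>\<close> to the argument of Siegel and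
  Brjuno for one germ. Once the \<open>F\<^sub>i\<^sub>j\<close> are linear, \<open>\<rho>\<^sub>i z = H (cnj z)\<close> with \<open>H\<close> holomorphic and
  \<open>D\<^sub>i\<^sub>j H (cnj D\<^sub>i\<^sub>j z) = H z\<close>, and non-resonance kills all Taylor coefficients of \<open>H\<close> of order at
  least 2.
\<close>

text \<open>Unfolding the recursion for \<Phi> multiplies one divisor per node of a tree of
  splittings, and bounding each of them by the smallest one loses convergence. Two comparable
  multi-indices that are both bad at level p differ in degree by at least 2^p, so at most 2|Q|/2^p
  nodes of a tree are bad at that level. This gap rests on the divisor being a maximum over (i, j):
  smallness then holds for all pairs at once, in particular for the pair that attains the divisor of
  the difference. The worst total over all trees becomes the exponent of a weight on multi-indices.
  The weighted l1 norm of truncated series is submultiplicative and absorbs one divisor per product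
  of series without constant term, so that convergence reduces to a quadratic estimate in which no
  divisor is left.\<close>

section \<open>Counting small divisors\<close>

text \<open>The induction methods eta-expand multi-indices; the pointwise rules would unfold them.\<close>
declare plus_fun_apply [simp del] zero_fun_apply [simp del]
lemmas pointwise = plus_fun_apply zero_fun_apply fun_diff_def

section \<open>Arithmetic of multi-indices\<close>

lemma mdeg_0 [simp]: "mdeg 0 = 0"
  by (simp add: mdeg_def pointwise)

lemma mdeg_add [simp]: "mdeg (P + Q) = mdeg P + mdeg Q"
  by (simp add: mdeg_def sum.distrib pointwise)

lemma mdeg_eq_0_iff [simp]: "mdeg Q = 0 \<longleftrightarrow> Q = 0"
  by (auto simp: mdeg_def fun_eq_iff pointwise)

lemma mdeg_munit [simp]: "mdeg (munit k) = 1"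
  by (simp add: mdeg_def munit_def)

lemma mdeg_mono: "P \<le> Q \<Longrightarrow> mdeg P \<le> mdeg Q"
  by (auto simp: mdeg_def le_fun_def intro: sum_mono)

lemma le_mdeg: "Q k \<le> mdeg Q"
  unfolding mdeg_def by (rule member_le_sum) auto

lemma multiindex_diff_add: "P \<le> (Q :: 'n \<Rightarrow> nat) \<Longrightarrow> Q - P + P = Q"
  by (auto simp: fun_eq_iff le_fun_def pointwise)

lemma mdeg_diff: "P \<le> Q \<Longrightarrow> mdeg (Q - P) = mdeg Q - mdeg P"
  by (metis add_diff_cancel_right' mdeg_add multiindex_diff_add)

lemma multiindex_neq_0D: "Q \<noteq> 0 \<Longrightarrow> \<exists>k. munit k \<le> (Q :: 'n \<Rightarrow> nat)"
proof -
  assume "Q \<noteq> 0"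
  then obtain k where "Q k \<noteq> 0" by (auto simp: fun_eq_iff pointwise)
  then show ?thesis
    by (intro exI[of _ k]) (auto simp: le_fun_def munit_def)
qed

lemma mdeg_eq_1_iff: "mdeg Q = 1 \<longleftrightarrow> (\<exists>k. Q = munit k)"
proof
  assume Q: "mdeg Q = 1"
  then obtain k where k: "munit k \<le> Q"
    using multiindex_neq_0D[of Q] by fastforce
  then have "mdeg (Q - munit k) = 0"
    using Q by (simp add: mdeg_diff)
  then show "\<exists>k. Q = munit k"
    using multiindex_diff_add[OF k] by auto
qed auto

lemma finite_mdeg_le [simp]: "finite {Q :: 'n::finite \<Rightarrow> nat. mdeg Q \<le> N}"
proof (rule finite_subset)
  show "{Q :: 'n \<Rightarrow> nat. mdeg Q \<le> N} \<subseteq> {Q. Q \<le> (\<lambda>_. N)}"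
    using le_mdeg order_trans by (fastforce simp: le_fun_def)
qed simp

lemma mpow_add: "mpow x (P + Q) = mpow x P * mpow x Q"
  by (simp add: mpow_def power_add prod.distrib pointwise)

lemma mpow_0 [simp]: "mpow x 0 = 1"
  by (simp add: mpow_def pointwise)

lemma mpow_munit [simp]: "mpow x (munit k) = x k"
  unfolding mpow_def munit_def
  by (subst prod.remove[of _ k]) auto

text \<open>\<open>bad_count bad Q a\<close>: some way of splitting \<open>Q\<close> repeatedly into two nonzero summands meets \<open>a\<close> bad
  multi-indices. Binary splittings dominate the products with several factors in the majorant series.\<close>

inductive bad_count :: "(('n \<Rightarrow> nat) \<Rightarrow> bool) \<Rightarrow> ('n \<Rightarrow> nat) \<Rightarrow> nat \<Rightarrow> bool"
  for bad where
  leaf: "bad_count bad Q 0"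
| node: "bad_count bad P a \<Longrightarrow> bad_count bad Q b \<Longrightarrow> P \<noteq> 0 \<Longrightarrow> Q \<noteq> 0 \<Longrightarrow>
    bad_count bad (P + Q) (a + b + of_bool (bad (P + Q)))"

text \<open>The bound for a bad \<open>R\<close> strictly above \<open>Q\<close> is sharper by \<open>q\<close>; it pays for a bad node only one of
  whose children contains further bad nodes.\<close>

lemma bad_count_aux:
  fixes q :: nat
  assumes "bad_count bad Q a"
    and large: "\<And>Q. bad Q \<Longrightarrow> q \<le> mdeg Q"
    and gap: "\<And>P Q. bad P \<Longrightarrow> bad Q \<Longrightarrow> P \<le> Q \<Longrightarrow> P \<noteq> Q \<Longrightarrow> mdeg P + q \<le> mdeg Q"
  shows "(a = 0 \<or> q * a + q \<le> 2 * mdeg Q) \<and>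
    (\<forall>R. bad R \<longrightarrow> Q \<le> R \<longrightarrow> Q \<noteq> R \<longrightarrow> a = 0 \<or> q * a + 2 * q \<le> 2 * mdeg R)"
  using assms(1)
proof induction
  case (leaf Q)
  show ?case by simp
next
  case (node P a Q b)
  have PQ: "P \<le> P + Q" "Q \<le> P + Q" "P \<noteq> P + Q" "Q \<noteq> P + Q"
    using node.hyps(3,4) by (auto simp: le_fun_def fun_eq_iff pointwise)
  have R: "P \<le> R \<and> Q \<le> R \<and> P \<noteq> R \<and> Q \<noteq> R \<and> mdeg P + mdeg Q \<le> mdeg R"
    if "P + Q \<le> R" for R
    using that PQ mdeg_mono[OF that] by (metis antisym_conv mdeg_add order_trans)
  \<comment> \<open>A bad \<open>R\<close> above \<open>P + Q\<close> lies strictly above both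
    summands, so the second half of the induction hypothesis applies. The case
    \<open>R = P + Q\<close> is included.\<close>
  have aux: "a = 0 \<or> q * a + 2 * q \<le> 2 * mdeg R" "b = 0 \<or> q * b + 2 * q \<le> 2 * mdeg R"
    if "bad R" "P + Q \<le> R" for R
    using node.IH that R by blast+
  show ?case
  proof (cases "bad (P + Q)")
    case True
    \<comment> \<open>If both children contain bad nodes, their two slacks \<open>q\<close> add up.
      If only one does, the sharper bound with \<open>R = P + Q\<close> supplies
      \<open>2 * q\<close>. If none does, the left side is 0 and truncated subtraction is
      harmless.\<close>
    have 1: "q * (a + b) \<le> 2 * (mdeg P + mdeg Q) - 2 * q"
      using node.IH aux[OF True order_refl] by (auto simp: algebra_simps)
    have 2: "q \<le> mdeg P + mdeg Q"
      using large[OF True] by simp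
    have main: "q * (a + b + 1) + q \<le> 2 * (mdeg P + mdeg Q)"
      using 1 2 unfolding distrib_left mult_1_right by linarith
    have "q * (a + b + 1) + 2 * q \<le> 2 * mdeg R" if "bad R" "P + Q \<le> R" "P + Q \<noteq> R" for R
    proof -
      have "q * (a + b + 1) + 2 * q \<le> (q * (a + b + 1) + q) + 2 * q" by simp
      also have "\<dots> \<le> 2 * (mdeg P + mdeg Q) + 2 * q"
        using main by (rule add_right_mono)
      finally show ?thesis
        using gap[OF True that] by simp
    qed
    moreover have one: "of_bool (bad (P + Q)) = (1::nat)"
      using True by simp
    ultimately show ?thesis
      unfolding mdeg_add one using main by blast
  next
    case False
    have "a = 0 \<and> b = 0 \<or> q * (a + b) + q \<le> 2 * (mdeg P + mdeg Q)"
      using node.IH by (auto simp: algebra_simps)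
    moreover have "a = 0 \<and> b = 0 \<or> q * (a + b) + 2 * q \<le> 2 * mdeg R"
      if "bad R" "P + Q \<le> R" for R
      using node.IH aux[OF that] R[OF that(2)] by (auto simp: algebra_simps)
    moreover have zero: "of_bool (bad (P + Q)) = (0::nat)"
      using False by simp
    ultimately show ?thesis
      unfolding mdeg_add zero add_0_right add_eq_0_iff_both_eq_0 by blast
  qed
qed

lemma bad_count_le:
  fixes q :: nat
  assumes "bad_count bad Q a"
    and "\<And>Q. bad Q \<Longrightarrow> q \<le> mdeg Q"
    and "\<And>P Q. bad P \<Longrightarrow> bad Q \<Longrightarrow> P \<le> Q \<Longrightarrow> P \<noteq> Q \<Longrightarrow> mdeg P + q \<le> mdeg Q"
  shows "q * a \<le> 2 * mdeg Q"
  using bad_count_aux[OF assms] by auto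

text \<open>A nonzero count forces \<open>2 * q \<le> 2 * mdeg Q\<close>, thanks to the extra
  summand \<open>q\<close> in \<open>bad_count_aux\<close> that \<open>bad_count_le\<close>
  drops.\<close>

lemma bad_count_eq_0:
  fixes q :: nat
  assumes "bad_count bad Q a" "mdeg Q < q"
    and "\<And>Q. bad Q \<Longrightarrow> q \<le> mdeg Q"
    and "\<And>P Q. bad P \<Longrightarrow> bad Q \<Longrightarrow> P \<le> Q \<Longrightarrow> P \<noteq> Q \<Longrightarrow> mdeg P + q \<le> mdeg Q"
  shows "a = 0"
proof (rule ccontr)
  assume "a \<noteq> 0"
  then have "q * a + q \<le> 2 * mdeg Q"
    using bad_count_aux[OF assms(1,3,4)] by auto
  moreover have "q \<le> q * a"
    using \<open>a \<noteq> 0\<close> by simp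
  ultimately show False
    using assms(2) by linarith
qed

section \<open>Thresholds and counts for a diophantine family of eigenvalues\<close>

locale diophantine_family =
  fixes \<mu> :: "'m::finite \<Rightarrow> 'm \<Rightarrow> 'n::finite \<Rightarrow> complex"
  assumes \<mu>_nonzero: "\<mu> i j k \<noteq> 0"
    and divisor_nonzero: "2 \<le> mdeg Q \<Longrightarrow> small_divisor \<mu> Q k \<noteq> 0"
    and diophantine: "diophantine \<mu>"
begin

definition "lo = Min (insert 1 (range (\<lambda>(i, j, k). cmod (\<mu> i j k))))"
definition "hi = Max (insert 1 (range (\<lambda>(i, j, k). cmod (\<mu> i j k))))"

lemma lo_le: "lo \<le> cmod (\<mu> i j k)"
  unfolding lo_def by (rule Min_le) (auto intro: image_eqI[of _ _ "(i, j, k)"])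

lemma hi_ge: "cmod (\<mu> i j k) \<le> hi"
  unfolding hi_def by (rule Max_ge) (auto intro: image_eqI[of _ _ "(i, j, k)"])

lemma lo_hi: "0 < lo" "lo \<le> 1" "1 \<le> hi"
  using \<mu>_nonzero by (auto simp: lo_def hi_def)

lemma divisor_ge: "cmod (mpow (\<mu> i j) Q - \<mu> i j k) \<le> small_divisor \<mu> Q k"
  unfolding small_divisor_def by (rule Max_ge) (auto intro: image_eqI[of _ _ "(i, j)"])

lemma divisor_attained: "\<exists>i j. small_divisor \<mu> Q k = cmod (mpow (\<mu> i j) Q - \<mu> i j k)"
proof -
  have "small_divisor \<mu> Q k \<in> range (\<lambda>(i, j). cmod (mpow (\<mu> i j) Q - \<mu> i j k))"
    unfolding small_divisor_def by (rule Max_in) auto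
  then show ?thesis by auto
qed

lemma divisor_pos: "2 \<le> mdeg Q \<Longrightarrow> 0 < small_divisor \<mu> Q k"
  using divisor_attained[of Q k] divisor_nonzero[of Q k] by auto

text \<open>The bound on the degree leaves finitely many candidates, so the infimum
  \<open>omega\<close> is a minimum and hence positive. For \<open>p = 0\<close> no degree fits,
  which is why the levels start at 1.\<close>

lemma omega_set:
  fixes p :: nat
  defines "S \<equiv> {small_divisor \<mu> Q k | Q k. 2 \<le> mdeg Q \<and> mdeg Q \<le> 2 ^ p \<and> small_divisor \<mu> Q k \<noteq> 0}"
  shows "finite S" and "p \<ge> 1 \<Longrightarrow> S \<noteq> {}"
proof -
  have "S \<subseteq> (\<lambda>(Q, k). small_divisor \<mu> Q k) ` ({Q. mdeg Q \<le> 2 ^ p} \<times> UNIV)"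
    by (auto simp: S_def)
  then show "finite S"
    by (rule finite_subset) auto
  assume "p \<ge> 1"
  fix k
  have "(2::nat) ^ 1 \<le> 2 ^ p"
    using \<open>p \<ge> 1\<close> by (intro power_increasing) auto
  then have "small_divisor \<mu> (munit k + munit k) k \<in> S"
    using divisor_nonzero[of "munit k + munit k" k] by (force simp: S_def)
  then show "S \<noteq> {}" by auto
qed

lemma omega_le:
  assumes "2 \<le> mdeg Q" "mdeg Q \<le> 2 ^ p"
  shows "omega \<mu> p \<le> small_divisor \<mu> Q k"
  unfolding omega_def
  by (rule cInf_lower) (use assms divisor_nonzero[of Q k] omega_set(1)[of p] in auto)

lemma omega_attained:
  assumes "p \<ge> 1"
  shows "\<exists>Q k. 2 \<le> mdeg Q \<and> mdeg Q \<le> 2 ^ p \<and> omega \<mu> p = small_divisor \<mu> Q k"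
proof -
  have "omega \<mu> p \<in> {small_divisor \<mu> Q k | Q k. 2 \<le> mdeg Q \<and> mdeg Q \<le> 2 ^ p \<and> small_divisor \<mu> Q k \<noteq> 0}"
    unfolding omega_def using omega_set[of p] assms
    by (subst cInf_eq_Min) (auto intro!: Min_in simp del: mem_Collect_eq)
  then show ?thesis by auto
qed

lemma omega_pos: "p \<ge> 1 \<Longrightarrow> 0 < omega \<mu> p"
  using omega_attained[of p] divisor_pos by auto

lemma omega_le_omega_1: "p \<ge> 1 \<Longrightarrow> omega \<mu> p \<le> omega \<mu> 1"
proof -
  assume "p \<ge> 1"
  then have "(2::nat) ^ 1 \<le> 2 ^ p"
    by (intro power_increasing) auto
  then show ?thesis
    using omega_attained[of 1] omega_le[of _ p] by (metis order.trans order_refl)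
qed

text \<open>The threshold for a small divisor at level \<open>p\<close>. The factor
  \<open>lo / (4 * hi)\<close> pays for the constants lost in \<open>bad_gap\<close>. Dividing by
  \<open>max 1 (omega \<mu> 1)\<close> makes the last factor at most 1, because \<open>omega\<close>
  is nonincreasing, and so keeps \<open>\<eta> p\<close> below \<open>lo / 4\<close>.\<close>

definition "\<eta> p = lo / (4 * hi) * (omega \<mu> p / max 1 (omega \<mu> 1))"

lemma \<eta>_bounds:
  assumes "p \<ge> 1"
  shows "0 < \<eta> p" "\<eta> p \<le> lo / 4" "4 * hi / lo * \<eta> p \<le> omega \<mu> p"
proof -
  let ?x = "omega \<mu> p / max 1 (omega \<mu> 1)"
  have x: "0 < ?x" "?x \<le> 1" "?x \<le> omega \<mu> p"
    using omega_pos[OF assms] omega_le_omega_1[OF assms] by (auto simp: divide_simps max_def)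
  show "0 < \<eta> p"
    unfolding \<eta>_def using x lo_hi by simp
  have "lo / (4 * hi) * ?x \<le> lo / 4 * 1"
    using x lo_hi by (intro mult_mono divide_left_mono) auto
  then show "\<eta> p \<le> lo / 4"
    by (simp add: \<eta>_def)
  have "4 * hi / lo * \<eta> p = ?x"
    using lo_hi by (simp add: \<eta>_def)
  then show "4 * hi / lo * \<eta> p \<le> omega \<mu> p"
    using x by simp
qed

definition "bad p Q \<longleftrightarrow> 2 \<le> mdeg Q \<and> (\<exists>k. small_divisor \<mu> Q k < \<eta> p)"

lemma \<eta>_le_omega: "p \<ge> 1 \<Longrightarrow> \<eta> p \<le> omega \<mu> p"
proof -
  assume "p \<ge> 1"
  moreover have "1 \<le> 4 * hi / lo"
    using lo_hi by (simp add: field_simps)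
  then have "1 * \<eta> p \<le> 4 * hi / lo * \<eta> p"
    using \<eta>_bounds(1)[OF \<open>p \<ge> 1\<close>] by (intro mult_right_mono) auto
  ultimately show ?thesis
    using \<eta>_bounds(3) by force
qed

lemma bad_large:
  assumes "p \<ge> 1" "bad p Q"
  shows "2 ^ p \<le> mdeg Q"
proof (rule ccontr)
  assume "\<not> 2 ^ p \<le> mdeg Q"
  with assms obtain k where "small_divisor \<mu> Q k < \<eta> p" "omega \<mu> p \<le> small_divisor \<mu> Q k"
    using omega_le[of Q p] unfolding bad_def by auto
  then show False
    using \<eta>_le_omega[OF assms(1)] by simp
qed

text \<open>If the divisors at \<open>(P, l)\<close> and \<open>(Q, k)\<close> are both small, so is the one at \<open>(Q - P + munit l, k)\<close>.\<close>

lemma bad_gap: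
  assumes p: "p \<ge> 1" and "bad p P" "bad p Q" and PQ: "P \<le> Q" "P \<noteq> Q"
  shows "mdeg P + 2 ^ p \<le> mdeg Q"
proof (rule ccontr)
  assume neg: "\<not> mdeg P + 2 ^ p \<le> mdeg Q"
  obtain k l where k: "small_divisor \<mu> Q k < \<eta> p" and l: "small_divisor \<mu> P l < \<eta> p"
    using assms(2,3) by (auto simp: bad_def)
  \<comment> \<open>The degree of \<open>R\<close> is the degree gap plus 1, hence at most
    \<open>2 ^ p\<close> under the negated claim, so its divisors are bounded below by
    \<open>omega \<mu> p\<close>.\<close>
  define R where "R = Q - P + munit l"
  have "mdeg P \<le> mdeg Q" "Q - P \<noteq> 0"
    using PQ mdeg_mono multiindex_diff_add[OF PQ(1)] by auto
  then have "mdeg (Q - P) \<noteq> 0" by simp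
  then have R: "2 \<le> mdeg R" "mdeg R \<le> 2 ^ p"
    using neg \<open>mdeg P \<le> mdeg Q\<close> by (auto simp: R_def mdeg_diff[OF PQ(1)] simp del: mdeg_eq_0_iff)
  \<comment> \<open>The pair is chosen for \<open>R\<close>. It also serves \<open>P\<close> and
    \<open>Q\<close>, whose divisors are small for every pair.\<close>
  obtain i j where ij: "small_divisor \<mu> R k = cmod (mpow (\<mu> i j) R - \<mu> i j k)"
    using divisor_attained by blast
  let ?\<mu> = "\<mu> i j"
  have Qk: "cmod (mpow ?\<mu> Q - ?\<mu> k) < \<eta> p" and Pl: "cmod (mpow ?\<mu> P - ?\<mu> l) < \<eta> p"
    using divisor_ge k l by (metis order_le_less_trans)+
  have "cmod (?\<mu> l) - cmod (mpow ?\<mu> P) < \<eta> p"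
    using Pl norm_triangle_ineq2[of "?\<mu> l" "mpow ?\<mu> P"] by (simp add: norm_minus_commute)
  then have P: "lo / 2 < cmod (mpow ?\<mu> P)"
    using lo_le[of i j l] \<eta>_bounds(2)[OF p] lo_hi(1) by simp
  have "mpow ?\<mu> Q = mpow ?\<mu> (Q - P) * mpow ?\<mu> P"
    by (metis PQ(1) mpow_add multiindex_diff_add)
  then have "mpow ?\<mu> P * (mpow ?\<mu> R - ?\<mu> k) = (mpow ?\<mu> Q - ?\<mu> k) * ?\<mu> l + ?\<mu> k * (?\<mu> l - mpow ?\<mu> P)"
    by (simp add: R_def mpow_add algebra_simps)
  then have "cmod (mpow ?\<mu> P) * small_divisor \<mu> R k \<le>
      cmod (mpow ?\<mu> Q - ?\<mu> k) * cmod (?\<mu> l) + cmod (?\<mu> k) * cmod (mpow ?\<mu> P - ?\<mu> l)"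
    unfolding ij norm_mult[symmetric]
    by (metis norm_minus_commute norm_mult norm_triangle_ineq)
  also have "\<dots> \<le> \<eta> p * hi + hi * \<eta> p"
    using Qk Pl hi_ge lo_hi \<eta>_bounds(1)[OF p] by (intro add_mono mult_mono) auto
  finally have "cmod (mpow ?\<mu> P) * small_divisor \<mu> R k \<le> 2 * hi * \<eta> p" by simp
  moreover have "lo / 2 * small_divisor \<mu> R k < cmod (mpow ?\<mu> P) * small_divisor \<mu> R k"
    using P divisor_pos[OF R(1)] by simp
  moreover have "2 * hi * \<eta> p \<le> lo / 2 * omega \<mu> p"
    using mult_left_mono[OF \<eta>_bounds(3)[OF p], of "lo / 2"] lo_hi by simp
  ultimately have "lo / 2 * small_divisor \<mu> R k < lo / 2 * omega \<mu> p"
    by linarith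
  then show False
    using omega_le[OF R, of k] lo_hi by (simp add: mult_less_cancel_left)
qed

text \<open>Taking the worst splitting makes the value depend on \<open>Q\<close> alone and
  superadditive in \<open>Q\<close>.\<close>

definition "badness p Q = Max {a. bad_count (bad p) Q a}"

lemma badness_set:
  assumes "p \<ge> 1"
  shows "finite {a. bad_count (bad p) Q a}" "{a. bad_count (bad p) Q a} \<noteq> {}"
proof -
  have "a \<le> 2 * mdeg Q" if "bad_count (bad p) Q a" for a
  proof -
    have "2 ^ p * a \<le> 2 * mdeg Q"
      using bad_count_le[OF that bad_large[OF assms] bad_gap[OF assms]] by auto
    moreover have "1 * a \<le> 2 ^ p * a"
      by (intro mult_right_mono) auto
    ultimately show ?thesis by linarith
  qed
  then show "finite {a. bad_count (bad p) Q a}"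
    by (intro finite_subset[OF _ finite_atMost[of "2 * mdeg Q"]]) auto
  show "{a. bad_count (bad p) Q a} \<noteq> {}"
    using bad_count.leaf by auto
qed

lemma bad_count_badness: "p \<ge> 1 \<Longrightarrow> bad_count (bad p) Q (badness p Q)"
  using Max_in[OF badness_set] by (simp add: badness_def)

lemma badness_le: "p \<ge> 1 \<Longrightarrow> 2 ^ p * badness p Q \<le> 2 * mdeg Q"
  using bad_count_le[OF bad_count_badness bad_large bad_gap] by auto

lemma badness_eq_0: "p \<ge> 1 \<Longrightarrow> mdeg Q < 2 ^ p \<Longrightarrow> badness p Q = 0"
  using bad_count_eq_0[OF bad_count_badness _ bad_large bad_gap] by auto

text \<open>Worst splittings of \<open>P\<close> and \<open>Q\<close>, joined by one more node, form
  a splitting of \<open>P + Q\<close>.\<close>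

lemma badness_add:
  assumes "p \<ge> 1" "P \<noteq> 0" "Q \<noteq> 0"
  shows "badness p P + badness p Q + of_bool (bad p (P + Q)) \<le> badness p (P + Q)"
proof -
  have "bad_count (bad p) (P + Q) (badness p P + badness p Q + of_bool (bad p (P + Q)))"
    using assms bad_count_badness by (intro bad_count.node) auto
  then show ?thesis
    using badness_set[OF assms(1)] by (auto simp: badness_def[of p "P + Q"] intro!: Max_ge)
qed

definition "level_cost p = - ln (\<eta> (Suc p))"

lemma level_cost_nonneg: "0 \<le> level_cost p"
  using \<eta>_bounds(1,2)[of "Suc p"] lo_hi(2) by (simp add: level_cost_def)

lemma summable_level_cost: "summable (\<lambda>p. level_cost p / 2 ^ p)"
proof -
  define K where "K = - ln (lo / (4 * hi) / max 1 (omega \<mu> 1))"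
  have "level_cost p = K - ln (omega \<mu> (Suc p))" for p
    unfolding level_cost_def \<eta>_def K_def
    using omega_pos[of "Suc p"] lo_hi by (simp add: ln_mult ln_div)
  \<comment> \<open>The factor 2 compensates for the denominator \<open>2 ^ Suc p\<close> in the
    diophantine condition; the constant part gives a geometric series.\<close>
  then have "(\<lambda>p. level_cost p / 2 ^ p) = (\<lambda>p. K * (1/2) ^ p + 2 * (- ln (omega \<mu> (Suc p)) / 2 ^ Suc p))"
    by (simp add: fun_eq_iff diff_divide_distrib power_one_over)
  moreover have "summable \<dots>"
    using diophantine unfolding diophantine_def
    by (intro summable_add summable_mult) (auto simp: summable_geometric)
  ultimately show ?thesis by simp
qed

text \<open>For \<open>Q = 0\<close> the truncated subtraction makes the first summand \<open>0\<close>, so that \<open>exp (- loss Q)\<close> is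
  submultiplicative. A divisor between \<open>\<eta> (Suc p)\<close> and \<open>\<eta> p\<close> is charged to level \<open>p\<close>.\<close>

definition "loss Q = level_cost 0 * real (mdeg Q - 1) + (\<Sum>p=1..mdeg Q. level_cost p * real (badness p Q))"

lemma loss_eq:
  assumes "mdeg Q \<le> N"
  shows "loss Q = level_cost 0 * real (mdeg Q - 1) + (\<Sum>p=1..N. level_cost p * real (badness p Q))"
proof -
  have "(\<Sum>p=1..mdeg Q. level_cost p * real (badness p Q)) = (\<Sum>p=1..N. level_cost p * real (badness p Q))"
  proof (rule sum.mono_neutral_left)
    show "\<forall>p\<in>{1..N} - {1..mdeg Q}. level_cost p * real (badness p Q) = 0"
    proof
      fix p assume "p \<in> {1..N} - {1..mdeg Q}"
      then have "p \<ge> 1" "mdeg Q < p" by auto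
      then have "mdeg Q < 2 ^ p" using less_exp[of p] by linarith
      then show "level_cost p * real (badness p Q) = 0"
        using badness_eq_0[OF \<open>p \<ge> 1\<close>] by simp
    qed
  qed (use assms in auto)
  then show ?thesis by (simp add: loss_def)
qed

lemma loss_le_1: "mdeg Q \<le> 1 \<Longrightarrow> loss Q = 0"
  using badness_eq_0[of 1 Q] by (simp add: loss_eq[of Q 1])

text \<open>Level \<open>p\<close> is charged at most \<open>2 * mdeg Q / 2 ^ p\<close> times, and
  the series of \<open>level_cost p / 2 ^ p\<close> converges. Linear growth of the loss costs only
  a constant factor in the radius of convergence.\<close>

lemma loss_linear: "\<exists>C. \<forall>Q. loss Q \<le> C * real (mdeg Q)"
proof (intro exI allI)
  fix Q :: "'n \<Rightarrow> nat"
  have "level_cost p * real (badness p Q) \<le> 2 * real (mdeg Q) * (level_cost p / 2 ^ p)" if "p \<ge> 1" for p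
  proof -
    have "real (2 ^ p * badness p Q) \<le> real (2 * mdeg Q)"
      using badness_le[OF that] of_nat_le_iff by blast
    then have "real (badness p Q) \<le> 2 * real (mdeg Q) / 2 ^ p"
      by (simp add: field_simps)
    from mult_left_mono[OF this level_cost_nonneg[of p]] show ?thesis by (simp add: field_simps)
  qed
  then have "(\<Sum>p=1..mdeg Q. level_cost p * real (badness p Q)) \<le>
      (\<Sum>p=1..mdeg Q. 2 * real (mdeg Q) * (level_cost p / 2 ^ p))"
    by (intro sum_mono) auto
  also have "\<dots> = 2 * real (mdeg Q) * (\<Sum>p=1..mdeg Q. level_cost p / 2 ^ p)"
    by (simp add: sum_distrib_left)
  also have "\<dots> \<le> 2 * real (mdeg Q) * (\<Sum>p. level_cost p / 2 ^ p)"
    using summable_level_cost level_cost_nonneg by (intro mult_left_mono sum_le_suminf) auto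
  finally have "(\<Sum>p=1..mdeg Q. level_cost p * real (badness p Q)) \<le>
      2 * (\<Sum>p. level_cost p / 2 ^ p) * real (mdeg Q)" by (simp add: mult_ac)
  moreover have "level_cost 0 * real (mdeg Q - 1) \<le> level_cost 0 * real (mdeg Q)"
    using level_cost_nonneg by (intro mult_left_mono) auto
  ultimately show "loss Q \<le> (level_cost 0 + 2 * (\<Sum>p. level_cost p / 2 ^ p)) * real (mdeg Q)"
    by (simp add: loss_def algebra_simps)
qed

text \<open>The node \<open>P + Q\<close> pays for its own divisor: a divisor charged to a level
  \<open>p \<ge> 1\<close> makes \<open>P + Q\<close> bad there and raises the count of that level
  by one; a larger divisor is paid by the linear term. The maximum with 0 makes the loss
  superadditive also when the divisor exceeds 1.\<close>

lemma loss_add_divisor: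
  assumes P: "P \<noteq> 0" and Q: "Q \<noteq> 0"
  shows "loss P + loss Q + max 0 (- ln (small_divisor \<mu> (P + Q) k)) \<le> loss (P + Q)"
proof -
  define N where "N = mdeg (P + Q)"
  define \<epsilon> where "\<epsilon> = small_divisor \<mu> (P + Q) k"
  have deg: "1 \<le> mdeg P" "1 \<le> mdeg Q"
    using P Q by (metis mdeg_eq_0_iff less_one not_le)+
  then have \<epsilon>: "0 < \<epsilon>"
    unfolding \<epsilon>_def by (intro divisor_pos) auto
  have eq: "loss R = level_cost 0 * real (mdeg R - 1) + (\<Sum>p=1..N. level_cost p * real (badness p R))"
    if "R \<in> {P, Q, P + Q}" for R
    using that by (intro loss_eq) (auto simp: N_def)
  \<comment> \<open>A binary tree with \<open>mdeg Q\<close> leaves has \<open>mdeg Q - 1\<close>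
    inner nodes, so every node receives one \<open>level_cost 0\<close>.\<close>
  have split: "real (mdeg (P + Q) - 1) = 1 + real (mdeg P - 1) + real (mdeg Q - 1)"
    using deg by (simp add: of_nat_diff)
  have "(\<Sum>p=1..N. level_cost p * real (badness p P)) + (\<Sum>p=1..N. level_cost p * real (badness p Q))
      + (\<Sum>p=1..N. level_cost p * of_bool (bad p (P + Q)))
    = (\<Sum>p=1..N. level_cost p * real (badness p P + badness p Q + of_bool (bad p (P + Q))))"
    unfolding sum.distrib[symmetric] by (intro sum.cong refl) (simp only: of_nat_add of_nat_of_bool distrib_left)
  also have "\<dots> \<le> (\<Sum>p=1..N. level_cost p * real (badness p (P + Q)))"
    using badness_add[OF _ P Q] level_cost_nonneg by (intro sum_mono mult_left_mono) (auto simp del: of_nat_add)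
  finally have main: "loss P + loss Q + (level_cost 0 + (\<Sum>p=1..N. level_cost p * of_bool (bad p (P + Q))))
      \<le> loss (P + Q)"
    using eq[of P] eq[of Q] eq[of "P + Q"] unfolding split by (simp add: algebra_simps)
  have sum0: "0 \<le> (\<Sum>p=1..N. level_cost p * of_bool (bad p (P + Q)))"
    using level_cost_nonneg by (intro sum_nonneg) auto
  have "max 0 (- ln \<epsilon>) \<le> level_cost 0 + (\<Sum>p=1..N. level_cost p * of_bool (bad p (P + Q)))"
  proof (cases "\<eta> 1 \<le> \<epsilon>")
    case True
    then have "ln (\<eta> 1) \<le> ln \<epsilon>"
      using \<eta>_bounds(1)[of 1] by simp
    then have "- ln \<epsilon> \<le> level_cost 0"
      by (simp add: level_cost_def)
    with sum0 level_cost_nonneg[of 0] show ?thesis by simp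
  next
    case False
    \<comment> \<open>The levels at which the divisor counts as small. There are finitely many,
      since badness at level \<open>p\<close> forces \<open>2 ^ p \<le> N\<close>; the largest one
      is charged.\<close>
    define X where "X = {p. 1 \<le> p \<and> \<epsilon> < \<eta> p}"
    have bad: "bad p (P + Q)" if "p \<in> X" for p
      using that deg by (auto simp: X_def bad_def \<epsilon>_def)
    have sub: "X \<subseteq> {1..N}"
    proof
      fix p assume p: "p \<in> X"
      then have "2 ^ p \<le> N"
        using bad[OF p] bad_large[of p "P + Q"] by (simp add: X_def N_def)
      then show "p \<in> {1..N}"
        using p less_le_trans[OF less_exp, of p N] by (auto simp: X_def)
    qed
    then have fin: "finite X" by (rule finite_subset) simp
    have "1 \<in> X" using False by (simp add: X_def)
    define p where "p = Max X"
    have p: "p \<in> X" using Max_in[OF fin] \<open>1 \<in> X\<close> by (auto simp: p_def)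
    have "Suc p \<notin> X"
    proof
      assume "Suc p \<in> X"
      from Max_ge[OF fin this] show False by (simp add: p_def)
    qed
    then have "\<eta> (Suc p) \<le> \<epsilon>" by (simp add: X_def)
    then have "ln (\<eta> (Suc p)) \<le> ln \<epsilon>"
      using \<eta>_bounds(1)[of "Suc p"] by simp
    then have "- ln \<epsilon> \<le> level_cost p * of_bool (bad p (P + Q))"
      using bad[OF p] by (simp add: level_cost_def)
    also have "\<dots> \<le> (\<Sum>p=1..N. level_cost p * of_bool (bad p (P + Q)))"
      using p sub level_cost_nonneg by (intro member_le_sum) auto
    finally show ?thesis
      using sum0 level_cost_nonneg[of 0] by simp
  qed
  with main show ?thesis unfolding \<epsilon>_def by linarith
qed

end

section \<open>Substitution of formal power series\<close>

lemma multiindex_induct [case_names zero add]: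
  fixes Q :: "'n::finite \<Rightarrow> nat"
  assumes "P 0" "\<And>Q k. P Q \<Longrightarrow> P (Q + munit k)"
  shows "P Q"
proof (induction "mdeg Q" arbitrary: Q)
  case 0
  then show ?case using assms(1) by (metis mdeg_eq_0_iff)
next
  case (Suc d)
  then have "Q \<noteq> 0" by (metis mdeg_0 Zero_not_Suc)
  then obtain k where k: "munit k \<le> Q"
    using multiindex_neq_0D by blast
  have "mdeg (Q - munit k) = d"
    using Suc(2) by (simp add: mdeg_diff[OF k])
  then have "P (Q - munit k + munit k)"
    using Suc(1) assms(2) by blast
  then show ?case by (simp only: multiindex_diff_add[OF k])
qed

section \<open>Coefficients of products and of substituted series\<close>

lemma mfps_nth_1: "mfps_nth 1 \<alpha> = of_bool (\<alpha> = 0)"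
  by (simp add: one_mfps_def zero_fun_def)

lemma mfps_nth_mult: "mfps_nth (f * g) \<alpha> = (\<Sum>\<beta> | \<beta> \<le> \<alpha>. mfps_nth f \<beta> * mfps_nth g (\<alpha> - \<beta>))"
  by (simp add: times_mfps_def fun_diff_def)

lemma sum_multiindex_pairs:
  fixes h :: "('n::finite \<Rightarrow> nat) \<Rightarrow> ('n \<Rightarrow> nat) \<Rightarrow> 'a::comm_monoid_add"
  shows "(\<Sum>\<alpha> | mdeg \<alpha> \<le> N. \<Sum>\<beta> | \<beta> \<le> \<alpha>. h \<beta> (\<alpha> - \<beta>)) =
    (\<Sum>(\<beta>, \<gamma>) | mdeg \<beta> + mdeg \<gamma> \<le> N. h \<beta> \<gamma>)"
proof -
  have "(\<Sum>\<alpha> | mdeg \<alpha> \<le> N. \<Sum>\<beta> | \<beta> \<le> \<alpha>. h \<beta> (\<alpha> - \<beta>)) =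
      (\<Sum>(\<alpha>, \<beta>) \<in> (SIGMA \<alpha>:{\<alpha>. mdeg \<alpha> \<le> N}. {\<beta>. \<beta> \<le> \<alpha>}). h \<beta> (\<alpha> - \<beta>))"
    by (rule sum.Sigma) auto
  also have "\<dots> = (\<Sum>(\<beta>, \<gamma>) | mdeg \<beta> + mdeg \<gamma> \<le> N. h \<beta> \<gamma>)"
    by (rule sum.reindex_bij_witness[where i = "\<lambda>(\<beta>, \<gamma>). (\<beta> + \<gamma>, \<beta>)" and j = "\<lambda>(\<alpha>, \<beta>). (\<beta>, \<alpha> - \<beta>)"])
       (auto simp: fun_eq_iff le_fun_def mdeg_def sum.distrib[symmetric] pointwise)
  finally show ?thesis .
qed

lemma finite_mdeg_pairs [simp]:
  "finite {(\<beta>, \<gamma> :: 'n::finite \<Rightarrow> nat). mdeg \<beta> + mdeg \<gamma> \<le> N}" (is "finite ?S")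
proof (rule finite_subset)
  show "?S \<subseteq> {\<beta>. mdeg \<beta> \<le> N} \<times> {\<gamma>. mdeg \<gamma> \<le> N}" by auto
qed simp

definition mfps_order_ge :: "nat \<Rightarrow> 'n::finite mfps \<Rightarrow> bool"
  where "mfps_order_ge d f \<longleftrightarrow> (\<forall>\<alpha>. mdeg \<alpha> < d \<longrightarrow> mfps_nth f \<alpha> = 0)"

lemma mfps_order_ge_mult:
  assumes "mfps_order_ge d f" "mfps_order_ge e g"
  shows "mfps_order_ge (d + e) (f * g)"
  unfolding mfps_order_ge_def mfps_nth_mult
proof (intro allI impI sum.neutral ballI)
  fix \<alpha> \<beta> :: "'a \<Rightarrow> nat"
  assume "mdeg \<alpha> < d + e" and \<beta>: "\<beta> \<in> {\<beta>. \<beta> \<le> \<alpha>}"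
  then have "mdeg \<beta> < d \<or> mdeg (\<alpha> - \<beta>) < e"
    using mdeg_mono[of \<beta> \<alpha>] by (auto simp: mdeg_diff)
  then show "mfps_nth f \<beta> * mfps_nth g (\<alpha> - \<beta>) = 0"
    using assms by (auto simp: mfps_order_ge_def)
qed

definition no_constant :: "'n::finite mfps ^ 'n \<Rightarrow> bool"
  where "no_constant G \<longleftrightarrow> (\<forall>k. mfps_nth (G $ k) 0 = 0)"

lemma mfps_order_ge_mpow:
  assumes "no_constant G"
  shows "mfps_order_ge (mdeg \<alpha>) (mpow (\<lambda>k. G $ k) \<alpha>)"
proof (induction \<alpha> rule: multiindex_induct)
  case (add Q k)
  have "mfps_order_ge 1 (G $ k)"
    using assms by (simp add: mfps_order_ge_def no_constant_def)
  from mfps_order_ge_mult[OF add this] show ?case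
    by (simp add: mpow_add)
qed (simp add: mfps_order_ge_def)

lemma mfps_nth_mpow_eq_0: "no_constant G \<Longrightarrow> mdeg \<beta> < mdeg \<alpha> \<Longrightarrow> mfps_nth (mpow (\<lambda>k. G $ k) \<alpha>) \<beta> = 0"
  using mfps_order_ge_mpow[of G \<alpha>] by (simp add: mfps_order_ge_def)

text \<open>Powers of degree above \<open>mdeg \<beta>\<close> contribute nothing, so one truncation
  \<open>N\<close> can serve all the coefficients of a computation.\<close>

lemma mfps_nth_compose:
  assumes "no_constant G" "mdeg \<beta> \<le> N"
  shows "mfps_nth (mfps_compose f G) \<beta> =
    (\<Sum>\<alpha> | mdeg \<alpha> \<le> N. mfps_nth f \<alpha> * mfps_nth (mpow (\<lambda>k. G $ k) \<alpha>) \<beta>)"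
  unfolding mfps_compose_def mfps_nth_Abs
  using assms(2) mfps_nth_mpow_eq_0[OF assms(1), of \<beta>] by (intro sum.mono_neutral_left) (auto simp: not_le)

lemma mfps_nth_compose_0 [simp]: "mfps_nth (mfps_compose f G) 0 = mfps_nth f 0"
  by (simp add: mfps_compose_def mfps_nth_1)

lemma mfps_compose_1: "mfps_compose 1 G = 1"
proof (rule mfps_eqI)
  fix \<beta> :: "'a \<Rightarrow> nat"
  have "(\<Sum>\<alpha> | mdeg \<alpha> \<le> mdeg \<beta>. mfps_nth 1 \<alpha> * mfps_nth (mpow (\<lambda>k. G $ k) \<alpha>) \<beta>) =
      (\<Sum>\<alpha>\<in>{0}. mfps_nth 1 \<alpha> * mfps_nth (mpow (\<lambda>k. G $ k) \<alpha>) \<beta>)"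
    by (rule sum.mono_neutral_right) (auto simp: mfps_nth_1)
  then show "mfps_nth (mfps_compose 1 G) \<beta> = mfps_nth 1 \<beta>"
    by (simp add: mfps_compose_def mfps_nth_1)
qed

lemma mfps_compose_mult:
  assumes G: "no_constant G"
  shows "mfps_compose (f * g) G = mfps_compose f G * mfps_compose g G"
proof (rule mfps_eqI)
  fix \<beta> :: "'a \<Rightarrow> nat"
  define N where "N = mdeg \<beta>"
  let ?G = "\<lambda>\<alpha>. mpow (\<lambda>k. G $ k) \<alpha>"
  let ?t = "\<lambda>\<gamma> \<delta>. mfps_nth f \<gamma> * mfps_nth g \<delta> * mfps_nth (?G \<gamma> * ?G \<delta>) \<beta>"
  have "mfps_nth (mfps_compose (f * g) G) \<beta> =
      (\<Sum>\<alpha> | mdeg \<alpha> \<le> N. \<Sum>\<gamma> | \<gamma> \<le> \<alpha>. mfps_nth f \<gamma> * mfps_nth g (\<alpha> - \<gamma>) * mfps_nth (?G \<alpha>) \<beta>)"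
    by (simp add: mfps_nth_compose[OF G, of \<beta> N] N_def mfps_nth_mult sum_distrib_right)
  also have "\<dots> = (\<Sum>\<alpha> | mdeg \<alpha> \<le> N. \<Sum>\<gamma> | \<gamma> \<le> \<alpha>. ?t \<gamma> (\<alpha> - \<gamma>))"
    by (intro sum.cong refl) (metis mem_Collect_eq mpow_add mult.commute multiindex_diff_add)
  also have "\<dots> = (\<Sum>(\<gamma>, \<delta>) | mdeg \<gamma> + mdeg \<delta> \<le> N. ?t \<gamma> \<delta>)"
    by (rule sum_multiindex_pairs)
  \<comment> \<open>Enlarging the triangle to a square adds only products of order above
    \<open>N\<close>, which have no coefficient at \<beta>. Over the square the sum factors.\<close>
  also have "\<dots> = (\<Sum>(\<gamma>, \<delta>) \<in> {\<gamma>. mdeg \<gamma> \<le> N} \<times> {\<delta>. mdeg \<delta> \<le> N}. ?t \<gamma> \<delta>)"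
  proof (rule sum.mono_neutral_left)
    have "mfps_nth (?G \<gamma> * ?G \<delta>) \<beta> = 0" if "\<not> mdeg \<gamma> + mdeg \<delta> \<le> N" for \<gamma> \<delta>
      using that mfps_nth_mpow_eq_0[OF G, of \<beta> "\<gamma> + \<delta>"] unfolding N_def mpow_add mdeg_add by simp
    then show "\<forall>x\<in>{\<gamma>. mdeg \<gamma> \<le> N} \<times> {\<delta>. mdeg \<delta> \<le> N} - {(\<gamma>, \<delta>). mdeg \<gamma> + mdeg \<delta> \<le> N}.
        (case x of (\<gamma>, \<delta>) \<Rightarrow> ?t \<gamma> \<delta>) = 0" by (fastforce simp del: mult_eq_0_iff)
  qed auto
  also have "\<dots> = (\<Sum>\<gamma> | mdeg \<gamma> \<le> N. \<Sum>\<delta> | mdeg \<delta> \<le> N. ?t \<gamma> \<delta>)"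
    by (simp add: sum.cartesian_product)
  also have "\<dots> = (\<Sum>\<gamma> | mdeg \<gamma> \<le> N. \<Sum>\<delta> | mdeg \<delta> \<le> N. \<Sum>\<epsilon> | \<epsilon> \<le> \<beta>.
      (mfps_nth f \<gamma> * mfps_nth (?G \<gamma>) \<epsilon>) * (mfps_nth g \<delta> * mfps_nth (?G \<delta>) (\<beta> - \<epsilon>)))"
    by (simp add: mfps_nth_mult sum_distrib_left mult_ac)
  also have "\<dots> = (\<Sum>\<epsilon> | \<epsilon> \<le> \<beta>. \<Sum>\<gamma> | mdeg \<gamma> \<le> N. \<Sum>\<delta> | mdeg \<delta> \<le> N.
      (mfps_nth f \<gamma> * mfps_nth (?G \<gamma>) \<epsilon>) * (mfps_nth g \<delta> * mfps_nth (?G \<delta>) (\<beta> - \<epsilon>)))"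
    by (subst (2) sum.swap, subst sum.swap) (rule refl)
  also have "\<dots> = (\<Sum>\<epsilon> | \<epsilon> \<le> \<beta>. mfps_nth (mfps_compose f G) \<epsilon> * mfps_nth (mfps_compose g G) (\<beta> - \<epsilon>))"
  proof (intro sum.cong refl)
    fix \<epsilon> assume "\<epsilon> \<in> {\<epsilon>. \<epsilon> \<le> \<beta>}"
    then have "mdeg \<epsilon> \<le> N" "mdeg (\<beta> - \<epsilon>) \<le> N"
      using mdeg_mono[of \<epsilon> \<beta>] by (auto simp: N_def mdeg_diff)
    then show "(\<Sum>\<gamma> | mdeg \<gamma> \<le> N. \<Sum>\<delta> | mdeg \<delta> \<le> N.
        (mfps_nth f \<gamma> * mfps_nth (?G \<gamma>) \<epsilon>) * (mfps_nth g \<delta> * mfps_nth (?G \<delta>) (\<beta> - \<epsilon>))) =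
        mfps_nth (mfps_compose f G) \<epsilon> * mfps_nth (mfps_compose g G) (\<beta> - \<epsilon>)"
      by (simp add: mfps_nth_compose[OF G, of _ N] sum_product)
  qed
  finally show "mfps_nth (mfps_compose (f * g) G) \<beta> = mfps_nth (mfps_compose f G * mfps_compose g G) \<beta>"
    by (simp add: mfps_nth_mult)
qed

lemma fmap_compose_nth [simp]: "fmap_compose F G $ l = mfps_compose (F $ l) G"
  by (simp add: fmap_compose_def)

lemma mpow_fmap_compose:
  assumes "no_constant H"
  shows "mpow (\<lambda>k. fmap_compose G H $ k) \<alpha> = mfps_compose (mpow (\<lambda>k. G $ k) \<alpha>) H"
proof (induction \<alpha> rule: multiindex_induct)
  case zero
  then show ?case by (simp add: mfps_compose_1)
next
  case (add Q k)
  then show ?case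
    by (simp add: mpow_add mfps_compose_mult[OF assms])
qed

lemma no_constant_fmap_compose: "no_constant (fmap_compose G H) \<longleftrightarrow> no_constant G"
  by (simp add: no_constant_def fmap_compose_def)

lemma mfps_compose_assoc:
  assumes G: "no_constant G" and H: "no_constant H"
  shows "mfps_compose f (fmap_compose G H) = mfps_compose (mfps_compose f G) H"
proof (rule mfps_eqI)
  fix \<beta> :: "'a \<Rightarrow> nat"
  define N where "N = mdeg \<beta>"
  let ?G = "\<lambda>\<alpha>. mpow (\<lambda>k. G $ k) \<alpha>" and ?H = "\<lambda>\<alpha>. mpow (\<lambda>k. H $ k) \<alpha>"
  have "mfps_nth (mfps_compose f (fmap_compose G H)) \<beta> =
      (\<Sum>\<alpha> | mdeg \<alpha> \<le> N. \<Sum>\<gamma> | mdeg \<gamma> \<le> N. mfps_nth f \<alpha> * (mfps_nth (?G \<alpha>) \<gamma> * mfps_nth (?H \<gamma>) \<beta>))"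
    by (simp del: fmap_compose_nth add: mfps_nth_compose[of _ \<beta> N] G H N_def no_constant_fmap_compose mpow_fmap_compose[OF H]
        sum_distrib_left)
  also have "\<dots> = (\<Sum>\<gamma> | mdeg \<gamma> \<le> N. \<Sum>\<alpha> | mdeg \<alpha> \<le> N. mfps_nth f \<alpha> * (mfps_nth (?G \<alpha>) \<gamma> * mfps_nth (?H \<gamma>) \<beta>))"
    by (rule sum.swap)
  also have "\<dots> = (\<Sum>\<gamma> | mdeg \<gamma> \<le> N. mfps_nth (mfps_compose f G) \<gamma> * mfps_nth (?H \<gamma>) \<beta>)"
    by (intro sum.cong refl) (simp add: mfps_nth_compose[OF G, of _ N] sum_distrib_right mult.assoc)
  also have "\<dots> = mfps_nth (mfps_compose (mfps_compose f G) H) \<beta>"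
    by (simp add: mfps_nth_compose[OF H, of \<beta> N] N_def)
  finally show "mfps_nth (mfps_compose f (fmap_compose G H)) \<beta> = mfps_nth (mfps_compose (mfps_compose f G) H) \<beta>" .
qed

lemma fmap_compose_assoc:
  "no_constant G \<Longrightarrow> no_constant H \<Longrightarrow> fmap_compose F (fmap_compose G H) = fmap_compose (fmap_compose F G) H"
  by (simp add: vec_eq_iff mfps_compose_assoc)

section \<open>Monomials and substitution of diagonal linear maps\<close>

definition mfps_monom :: "complex \<Rightarrow> ('n::finite \<Rightarrow> nat) \<Rightarrow> 'n mfps"
  where "mfps_monom c \<alpha> = Abs_mfps (\<lambda>\<beta>. if \<beta> = \<alpha> then c else 0)"

lemma mfps_monom_mult: "mfps_monom a \<alpha> * mfps_monom b \<beta> = mfps_monom (a * b) (\<alpha> + \<beta>)"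
proof (rule mfps_eqI)
  fix \<gamma> :: "'a \<Rightarrow> nat"
  have "mfps_nth (mfps_monom a \<alpha> * mfps_monom b \<beta>) \<gamma> =
      (\<Sum>\<delta> | \<delta> \<le> \<gamma>. if \<delta> = \<alpha> then (if \<gamma> - \<alpha> = \<beta> then a * b else 0) else 0)"
    unfolding mfps_nth_mult mfps_monom_def mfps_nth_Abs by (intro sum.cong) auto
  also have "\<dots> = (if \<alpha> \<le> \<gamma> \<and> \<gamma> - \<alpha> = \<beta> then a * b else 0)"
    by (subst sum.delta) auto
  also have "\<alpha> \<le> \<gamma> \<and> \<gamma> - \<alpha> = \<beta> \<longleftrightarrow> \<gamma> = \<alpha> + \<beta>"
    by (auto simp: fun_eq_iff le_fun_def pointwise) (metis le_add_diff_inverse)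
  finally show "mfps_nth (mfps_monom a \<alpha> * mfps_monom b \<beta>) \<gamma> = mfps_nth (mfps_monom (a * b) (\<alpha> + \<beta>)) \<gamma>"
    by (simp add: mfps_monom_def)
qed

lemma munit_inj [simp]: "munit k = munit l \<longleftrightarrow> k = l"
  by (auto simp: munit_def fun_eq_iff split: if_splits)

lemma fmap_linear_diag: "fmap_linear (diag_matrix d) $ k = mfps_monom (d k) (munit k)"
proof (rule mfps_eqI)
  fix \<alpha> :: "'a \<Rightarrow> nat"
  have "(\<Sum>l | \<alpha> = munit l. diag_matrix d $ k $ l) = (if \<alpha> = munit k then d k else 0)"
  proof (cases "\<exists>l. \<alpha> = munit l")
    case True
    then obtain l where l: "\<alpha> = munit l" by auto
    have "{l'. \<alpha> = munit l'} = {l}" by (auto simp: l)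
    then show ?thesis by (auto simp: l diag_matrix_def)
  qed auto
  then show "mfps_nth (fmap_linear (diag_matrix d) $ k) \<alpha> = mfps_nth (mfps_monom (d k) (munit k)) \<alpha>"
    by (simp add: fmap_linear_def mfps_monom_def)
qed

lemma mpow_fmap_linear_diag:
  "mpow (\<lambda>k. fmap_linear (diag_matrix d) $ k) \<alpha> = mfps_monom (mpow d \<alpha>) \<alpha>"
proof (induction \<alpha> rule: multiindex_induct)
  case zero
  show ?case by (rule mfps_eqI) (simp add: mfps_nth_1 mfps_monom_def)
next
  case (add Q k)
  then show ?case
    by (simp only: mpow_add mpow_munit fmap_linear_diag mfps_monom_mult)
qed

lemma mfps_nth_compose_diag:
  "mfps_nth (mfps_compose f (fmap_linear (diag_matrix d))) \<beta> = mfps_nth f \<beta> * mpow d \<beta>"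
proof -
  have "(\<Sum>\<alpha> | mdeg \<alpha> \<le> mdeg \<beta>. mfps_nth f \<alpha> * mfps_nth (mfps_monom (mpow d \<alpha>) \<alpha>) \<beta>) =
      (\<Sum>\<alpha> | mdeg \<alpha> \<le> mdeg \<beta>. if \<alpha> = \<beta> then mfps_nth f \<beta> * mpow d \<beta> else 0)"
    by (intro sum.cong) (auto simp: mfps_monom_def)
  then show ?thesis
    unfolding mfps_compose_def mpow_fmap_linear_diag mfps_nth_Abs by simp
qed

lemma mat_1_eq_diag: "mat 1 = diag_matrix (\<lambda>_. 1)"
  by (simp add: mat_def diag_matrix_def)

lemma fmap_compose_id_left:
  assumes "no_constant G"
  shows "fmap_compose fmap_id G = G"
proof -
  have "mfps_compose (fmap_id $ l) G = G $ l" for l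
  proof (rule mfps_eqI)
    fix \<beta> :: "'a \<Rightarrow> nat"
    \<comment> \<open>Truncating at \<open>Suc (mdeg \<beta>)\<close> keeps \<open>munit l\<close>
      in the range even for \<open>\<beta> = 0\<close>.\<close>
    have "mfps_nth (mfps_compose (fmap_id $ l) G) \<beta> =
        (\<Sum>\<alpha> | mdeg \<alpha> \<le> Suc (mdeg \<beta>). if \<alpha> = munit l then mfps_nth (mpow (\<lambda>k. G $ k) (munit l)) \<beta> else 0)"
      unfolding mat_1_eq_diag fmap_linear_diag
      by (subst mfps_nth_compose[OF assms le_SucI[OF order_refl]], intro sum.cong) (auto simp: mfps_monom_def)
    then show "mfps_nth (mfps_compose (fmap_id $ l) G) \<beta> = mfps_nth (G $ l) \<beta>"
      by simp
  qed
  then show ?thesis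
    by (simp add: fmap_compose_def vec_eq_iff)
qed

text \<open>Composing with \<Phi> on the left removes \<Psi> and leaves an identity between the
  composition of \<open>T\<close> with \<Phi> and that of \<Phi> with the diagonal map. Substituting
  a diagonal map multiplies the coefficient at \<beta> by \<open>mpow d \<beta>\<close>.\<close>

lemma formal_conjugacy:
  assumes inv: "fmap_inverse_pair \<Phi> \<Psi>" and T: "no_constant T"
    and conj: "fmap_compose \<Psi> (fmap_compose T \<Phi>) = fmap_linear (diag_matrix d)"
  shows "mfps_nth (mfps_compose (T $ l) \<Phi>) \<beta> = mfps_nth (\<Phi> $ l) \<beta> * mpow d \<beta>"
proof -
  have \<Phi>\<Psi>: "no_constant \<Psi>" "fmap_compose \<Phi> \<Psi> = fmap_id"
    using inv by (auto simp: fmap_inverse_pair_def no_constant_def zero_fun_def)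
  have T\<Phi>: "no_constant (fmap_compose T \<Phi>)"
    using T by (simp add: no_constant_fmap_compose)
  have "fmap_compose T \<Phi> = fmap_compose (fmap_compose \<Phi> \<Psi>) (fmap_compose T \<Phi>)"
    by (simp add: \<Phi>\<Psi> fmap_compose_id_left[OF T\<Phi>])
  also have "\<dots> = fmap_compose \<Phi> (fmap_linear (diag_matrix d))"
    by (simp add: fmap_compose_assoc[OF \<Phi>\<Psi>(1) T\<Phi>, symmetric] conj)
  finally have "fmap_compose T \<Phi> $ l = fmap_compose \<Phi> (fmap_linear (diag_matrix d)) $ l"
    by simp
  then show ?thesis
    by (simp add: fmap_compose_def mfps_nth_compose_diag)
qed

section \<open>Convergence of the formal linearization\<close>

lemma mpow_const: "mpow (\<lambda>_. a) \<alpha> = a ^ mdeg \<alpha>"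
  by (simp add: mpow_def mdeg_def power_sum)

lemma mpow_mono:
  fixes x y :: "'n::finite \<Rightarrow> real"
  assumes "\<And>k. 0 \<le> x k" "\<And>k. x k \<le> y k"
  shows "mpow x \<alpha> \<le> mpow y \<alpha>"
  unfolding mpow_def by (intro prod_mono) (auto intro: power_mono zero_le_power assms)

lemma norm_mpow: "norm (mpow x \<alpha>) = mpow (\<lambda>k. norm (x k)) \<alpha>" for x :: "_ \<Rightarrow> complex"
  by (simp add: mpow_def prod_norm[symmetric] norm_power)

text \<open>From degree 2 on, \<open>y ^ mdeg \<alpha>\<close> is at most
  \<open>(2 * y)\<^sup>2 * (1/2) ^ mdeg \<alpha>\<close>. The sum of the powers of 1/2 over a box is
  a product of geometric sums, each at most 2.\<close>

lemma sum_geometric_multiindex: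
  fixes y :: real
  assumes "0 \<le> y" "y \<le> 1/2"
  shows "(\<Sum>\<alpha> :: 'n::finite \<Rightarrow> nat | 2 \<le> mdeg \<alpha> \<and> mdeg \<alpha> \<le> N. y ^ mdeg \<alpha>) \<le> 4 * 2 ^ CARD('n) * y\<^sup>2"
proof -
  have half: "(\<Sum>i\<le>N. (1/2) ^ i) \<le> (2::real)"
    using sum_le_suminf[of "\<lambda>i. (1/2::real) ^ i" "{..N}"] by (simp add: suminf_geometric)
  have "(\<Sum>\<alpha> :: 'n \<Rightarrow> nat | 2 \<le> mdeg \<alpha> \<and> mdeg \<alpha> \<le> N. y ^ mdeg \<alpha>) \<le>
      (\<Sum>\<alpha> :: 'n \<Rightarrow> nat | 2 \<le> mdeg \<alpha> \<and> mdeg \<alpha> \<le> N. (2 * y)\<^sup>2 * (1/2) ^ mdeg \<alpha>)"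
  proof (rule sum_mono)
    fix \<alpha> :: "'n \<Rightarrow> nat" assume "\<alpha> \<in> {\<alpha>. 2 \<le> mdeg \<alpha> \<and> mdeg \<alpha> \<le> N}"
    then have "2 \<le> mdeg \<alpha>" by simp
    then have "(2 * y) ^ mdeg \<alpha> \<le> (2 * y)\<^sup>2"
      by (rule power_decreasing) (use assms in simp_all)
    then have "(2 * y) ^ mdeg \<alpha> * (1/2) ^ mdeg \<alpha> \<le> (2 * y)\<^sup>2 * (1/2) ^ mdeg \<alpha>"
      by (rule mult_right_mono) simp
    moreover have "(2 * y) ^ mdeg \<alpha> * (1/2) ^ mdeg \<alpha> = y ^ mdeg \<alpha>"
      unfolding power_mult_distrib[symmetric] by simp
    ultimately show "y ^ mdeg \<alpha> \<le> (2 * y)\<^sup>2 * (1/2) ^ mdeg \<alpha>"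
      by metis
  qed
  also have "\<dots> = (2 * y)\<^sup>2 * (\<Sum>\<alpha> :: 'n \<Rightarrow> nat | 2 \<le> mdeg \<alpha> \<and> mdeg \<alpha> \<le> N. (1/2) ^ mdeg \<alpha>)"
    by (simp add: sum_distrib_left)
  also have "\<dots> \<le> (2 * y)\<^sup>2 * (\<Sum>\<alpha> \<in> PiE (UNIV :: 'n set) (\<lambda>_. {..N}). (1/2) ^ mdeg \<alpha>)"
  proof (intro mult_left_mono sum_mono2 subsetI)
    fix \<alpha> :: "'n \<Rightarrow> nat" assume "\<alpha> \<in> {\<alpha>. 2 \<le> mdeg \<alpha> \<and> mdeg \<alpha> \<le> N}"
    then show "\<alpha> \<in> PiE UNIV (\<lambda>_. {..N})"
      using le_mdeg[of \<alpha>] order_trans by fastforce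
  qed (auto intro: finite_PiE)
  also have "(\<Sum>\<alpha> \<in> PiE (UNIV :: 'n set) (\<lambda>_. {..N}). (1/2::real) ^ mdeg \<alpha>) =
      (\<Prod>k\<in>(UNIV :: 'n set). \<Sum>i\<le>N. (1/2) ^ i)"
    by (subst prod_sum_PiE) (auto simp: mdeg_def power_sum)
  also have "(2 * y)\<^sup>2 * \<dots> \<le> (2 * y)\<^sup>2 * 2 ^ CARD('n)"
    using half by (intro mult_left_mono) (auto simp: power_mono sum_nonneg)
  finally show ?thesis
    by (simp add: power_mult_distrib mult_ac)
qed

section \<open>Weighted norms of truncated series\<close>

definition trunc_norm :: "(('n::finite \<Rightarrow> nat) \<Rightarrow> real) \<Rightarrow> nat \<Rightarrow> 'n mfps \<Rightarrow> real"
  where "trunc_norm v d f = (\<Sum>\<alpha> | mdeg \<alpha> \<le> d. cmod (mfps_nth f \<alpha>) * v \<alpha>)"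

lemma trunc_norm_nonneg: "(\<And>\<alpha>. 0 \<le> v \<alpha>) \<Longrightarrow> 0 \<le> trunc_norm v d f"
  unfolding trunc_norm_def by (intro sum_nonneg mult_nonneg_nonneg) auto

text \<open>The product may be measured with another weight and another degree than its factors.
  Taking both equal gives submultiplicativity; taking \<open>e = Suc d\<close> and a weight
  \<open>w\<close> with a divisor gives the induction step. Restricting to nonzero coefficients lets
  vanishing constant terms be exploited.\<close>

lemma trunc_norm_mult_le:
  assumes v: "\<And>\<alpha>. 0 \<le> v \<alpha>" and w: "\<And>\<alpha>. 0 \<le> w \<alpha>"
    and *: "\<And>\<alpha> \<beta>. mfps_nth f \<alpha> \<noteq> 0 \<Longrightarrow> mfps_nth g \<beta> \<noteq> 0 \<Longrightarrow> mdeg \<alpha> + mdeg \<beta> \<le> e \<Longrightarrow>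
      mdeg \<alpha> \<le> d \<and> mdeg \<beta> \<le> d \<and> w (\<alpha> + \<beta>) \<le> v \<alpha> * v \<beta>"
  shows "trunc_norm w e (f * g) \<le> trunc_norm v d f * trunc_norm v d g"
proof -
  let ?t = "\<lambda>\<alpha> \<beta>. cmod (mfps_nth f \<alpha>) * cmod (mfps_nth g \<beta>)"
  let ?S = "{(\<alpha>, \<beta>). mdeg \<alpha> + mdeg \<beta> \<le> e \<and> mfps_nth f \<alpha> \<noteq> 0 \<and> mfps_nth g \<beta> \<noteq> 0}"
  have "trunc_norm w e (f * g) \<le> (\<Sum>\<alpha> | mdeg \<alpha> \<le> e. (\<Sum>\<beta> | \<beta> \<le> \<alpha>. ?t \<beta> (\<alpha> - \<beta>)) * w \<alpha>)"
    unfolding trunc_norm_def mfps_nth_mult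
  proof (rule sum_mono, rule mult_right_mono[OF _ w])
    fix \<alpha>
    show "cmod (\<Sum>\<beta> | \<beta> \<le> \<alpha>. mfps_nth f \<beta> * mfps_nth g (\<alpha> - \<beta>)) \<le> (\<Sum>\<beta> | \<beta> \<le> \<alpha>. ?t \<beta> (\<alpha> - \<beta>))"
      by (rule order_trans[OF norm_sum]) (simp add: norm_mult)
  qed
  also have "\<dots> = (\<Sum>\<alpha> | mdeg \<alpha> \<le> e. \<Sum>\<beta> | \<beta> \<le> \<alpha>. ?t \<beta> (\<alpha> - \<beta>) * w (\<beta> + (\<alpha> - \<beta>)))"
    unfolding sum_distrib_right
  proof (intro sum.cong refl)
    fix \<alpha> \<beta> :: "'a \<Rightarrow> nat" assume "\<beta> \<in> {\<beta>. \<beta> \<le> \<alpha>}"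
    then have "\<beta> + (\<alpha> - \<beta>) = \<alpha>"
      using multiindex_diff_add[of \<beta> \<alpha>] by (simp add: add.commute)
    then show "?t \<beta> (\<alpha> - \<beta>) * w \<alpha> = ?t \<beta> (\<alpha> - \<beta>) * w (\<beta> + (\<alpha> - \<beta>))"
      by (simp only:)
  qed
  also have "\<dots> = (\<Sum>(\<alpha>, \<beta>) | mdeg \<alpha> + mdeg \<beta> \<le> e. ?t \<alpha> \<beta> * w (\<alpha> + \<beta>))"
    by (rule sum_multiindex_pairs)
  also have "\<dots> = (\<Sum>(\<alpha>, \<beta>) \<in> ?S. ?t \<alpha> \<beta> * w (\<alpha> + \<beta>))"
  proof (rule sum.mono_neutral_right)
    show "\<forall>x\<in>{(\<alpha>, \<beta>). mdeg \<alpha> + mdeg \<beta> \<le> e} - ?S. (case x of (\<alpha>, \<beta>) \<Rightarrow> ?t \<alpha> \<beta> * w (\<alpha> + \<beta>)) = 0"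
      by auto
  qed auto
  also have "\<dots> \<le> (\<Sum>(\<alpha>, \<beta>) \<in> ?S. ?t \<alpha> \<beta> * (v \<alpha> * v \<beta>))"
  proof (rule sum_mono, clarify)
    fix \<alpha> \<beta> assume "mdeg \<alpha> + mdeg \<beta> \<le> e" "mfps_nth f \<alpha> \<noteq> 0" "mfps_nth g \<beta> \<noteq> 0"
    with * show "?t \<alpha> \<beta> * w (\<alpha> + \<beta>) \<le> ?t \<alpha> \<beta> * (v \<alpha> * v \<beta>)"
      by (intro mult_left_mono) auto
  qed
  also have "\<dots> \<le> (\<Sum>(\<alpha>, \<beta>) \<in> {\<alpha>. mdeg \<alpha> \<le> d} \<times> {\<beta>. mdeg \<beta> \<le> d}. ?t \<alpha> \<beta> * (v \<alpha> * v \<beta>))"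
  proof (rule sum_mono2)
    show "?S \<subseteq> {\<alpha>. mdeg \<alpha> \<le> d} \<times> {\<beta>. mdeg \<beta> \<le> d}"
      using * by blast
  qed (auto intro!: mult_nonneg_nonneg v)
  also have "\<dots> = trunc_norm v d f * trunc_norm v d g"
    unfolding trunc_norm_def sum_product sum.cartesian_product by (simp add: mult_ac)
  finally show ?thesis .
qed

lemma trunc_norm_mpow_le:
  assumes v: "\<And>\<alpha>. 0 \<le> v \<alpha>" "v 0 \<le> 1" and mult: "\<And>\<alpha> \<beta>. v (\<alpha> + \<beta>) \<le> v \<alpha> * v \<beta>"
  shows "trunc_norm v d (mpow (\<lambda>k. G $ k) \<alpha>) \<le> mpow (\<lambda>k. trunc_norm v d (G $ k)) \<alpha>"
proof (induction \<alpha> rule: multiindex_induct)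
  case zero
  have "trunc_norm v d 1 = (\<Sum>\<alpha> \<in> {0}. cmod (mfps_nth 1 \<alpha>) * v \<alpha>)"
    unfolding trunc_norm_def by (rule sum.mono_neutral_right) (auto simp: mfps_nth_1)
  then show ?case
    using v(2) by (simp add: mfps_nth_1)
next
  case (add Q k)
  have "trunc_norm v d (mpow (\<lambda>k. G $ k) Q * G $ k) \<le> trunc_norm v d (mpow (\<lambda>k. G $ k) Q) * trunc_norm v d (G $ k)"
    by (rule trunc_norm_mult_le) (use v mult in auto)
  also have "\<dots> \<le> mpow (\<lambda>k. trunc_norm v d (G $ k)) Q * trunc_norm v d (G $ k)"
    using add by (intro mult_right_mono trunc_norm_nonneg v)
  finally show ?case
    by (simp add: mpow_add)
qed

text \<open>A product of at least two series without constant term has, in degree at most \<open>d + 1\<close>, only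
  contributions of coefficients of degree at most \<open>d\<close>; this drives the induction on \<open>d\<close>.\<close>

lemma trunc_norm_Suc_mpow_le:
  assumes G: "no_constant G"
    and v: "\<And>\<alpha>. 0 \<le> v \<alpha>" "v 0 \<le> 1" and mult: "\<And>\<alpha> \<beta>. v (\<alpha> + \<beta>) \<le> v \<alpha> * v \<beta>"
    and w: "\<And>\<alpha>. 0 \<le> w \<alpha>" "\<And>\<alpha> \<beta>. \<alpha> \<noteq> 0 \<Longrightarrow> \<beta> \<noteq> 0 \<Longrightarrow> w (\<alpha> + \<beta>) \<le> v \<alpha> * v \<beta>"
    and \<alpha>: "2 \<le> mdeg \<alpha>"
  shows "trunc_norm w (Suc d) (mpow (\<lambda>k. G $ k) \<alpha>) \<le> mpow (\<lambda>k. trunc_norm v d (G $ k)) \<alpha>"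
proof -
  have "\<alpha> \<noteq> 0" using \<alpha> by auto
  then obtain k where k: "munit k \<le> \<alpha>"
    using multiindex_neq_0D by blast
  define \<gamma> where "\<gamma> = \<alpha> - munit k"
  have \<alpha>_eq: "\<alpha> = \<gamma> + munit k" and "mdeg \<gamma> \<noteq> 0"
    using multiindex_diff_add[OF k] mdeg_diff[OF k] \<alpha> by (auto simp: \<gamma>_def simp del: mdeg_eq_0_iff)
  then have 0: "mfps_nth (mpow (\<lambda>k. G $ k) \<gamma>) 0 = 0" "mfps_nth (G $ k) 0 = 0"
    using mfps_nth_mpow_eq_0[OF G, of 0 \<gamma>] G by (auto simp: no_constant_def simp del: mdeg_eq_0_iff)
  \<comment> \<open>Only this last multiplication is measured with \<open>w\<close>; the remaining
    factors use \<open>v\<close>. A divisor contained in \<open>w\<close> is thus paid for once, and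
    not once per factor.\<close>
  have "trunc_norm w (Suc d) (mpow (\<lambda>k. G $ k) \<gamma> * G $ k) \<le>
      trunc_norm v d (mpow (\<lambda>k. G $ k) \<gamma>) * trunc_norm v d (G $ k)"
  proof (rule trunc_norm_mult_le)
    fix \<beta> \<delta>
    assume "mfps_nth (mpow (\<lambda>k. G $ k) \<gamma>) \<beta> \<noteq> 0" "mfps_nth (G $ k) \<delta> \<noteq> 0"
      and deg: "mdeg \<beta> + mdeg \<delta> \<le> Suc d"
    with 0 have "\<beta> \<noteq> 0" "\<delta> \<noteq> 0" by metis+
    moreover from this have "mdeg \<beta> \<noteq> 0" "mdeg \<delta> \<noteq> 0" by auto
    ultimately show "mdeg \<beta> \<le> d \<and> mdeg \<delta> \<le> d \<and> w (\<beta> + \<delta>) \<le> v \<beta> * v \<delta>"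
      using deg w(2) by (simp del: mdeg_eq_0_iff)
  qed (use v w in auto)
  also have "\<dots> \<le> mpow (\<lambda>k. trunc_norm v d (G $ k)) \<gamma> * trunc_norm v d (G $ k)"
    by (intro mult_right_mono trunc_norm_mpow_le trunc_norm_nonneg v mult)
  finally show ?thesis
    by (simp add: \<alpha>_eq mpow_add)
qed

section \<open>The conjugacy equation in coefficients\<close>

lemma fmap_tangent_id_nth:
  assumes "fmap_tangent_id \<Phi>" "mdeg \<alpha> \<le> 1"
  shows "mfps_nth (\<Phi> $ l) \<alpha> = of_bool (\<alpha> = munit l)"
  using assms unfolding fmap_tangent_id_def mat_1_eq_diag fmap_linear_diag
  by (simp add: mfps_monom_def)

lemma no_constant_tangent_id: "fmap_tangent_id \<Phi> \<Longrightarrow> no_constant \<Phi>"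
  unfolding no_constant_def
  by (metis fmap_tangent_id_nth mdeg_0 mdeg_munit of_bool_eq(1) zero_le_one zero_neq_one)

lemma multiindex_le_1_split:
  "{\<alpha> :: 'n::finite \<Rightarrow> nat. mdeg \<alpha> \<le> N} =
    {\<alpha>. mdeg \<alpha> \<le> min 1 N} \<union> {\<alpha>. 2 \<le> mdeg \<alpha> \<and> mdeg \<alpha> \<le> N}"
  by auto

lemma conjugacy_linear_part:
  assumes \<Phi>: "fmap_tangent_id \<Phi>"
    and conj: "\<And>\<beta>. mfps_nth (mfps_compose f \<Phi>) \<beta> = mfps_nth (\<Phi> $ l) \<beta> * mpow d \<beta>"
  shows "mfps_nth f (munit k) = of_bool (k = l) * d k"
proof -
  have "mfps_nth (mfps_compose f \<Phi>) (munit k) =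
      (\<Sum>\<alpha> | mdeg \<alpha> \<le> 1. if \<alpha> = munit k then mfps_nth f (munit k) else 0)"
    unfolding mfps_compose_def mfps_nth_Abs mdeg_munit
  proof (intro sum.cong refl)
    fix \<alpha> :: "'a \<Rightarrow> nat" assume "\<alpha> \<in> {\<alpha>. mdeg \<alpha> \<le> 1}"
    then consider "mdeg \<alpha> = 0" | "mdeg \<alpha> = 1" by (force simp del: mdeg_eq_0_iff simp: le_Suc_eq)
    then show "mfps_nth f \<alpha> * mfps_nth (mpow (($) \<Phi>) \<alpha>) (munit k) =
        (if \<alpha> = munit k then mfps_nth f (munit k) else 0)"
    proof cases
      case 1
      have "munit k \<noteq> 0" by (metis mdeg_0 mdeg_munit zero_neq_one)
      with 1 show ?thesis by (simp add: mfps_nth_1)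
    next
      case 2
      then obtain m where "\<alpha> = munit m" using mdeg_eq_1_iff by blast
      then show ?thesis using fmap_tangent_id_nth[OF \<Phi>, of "munit k" m] by simp
    qed
  qed
  then have "mfps_nth f (munit k) = mfps_nth (\<Phi> $ l) (munit k) * mpow d (munit k)"
    using conj[of "munit k"] by simp
  then show ?thesis
    using fmap_tangent_id_nth[OF \<Phi>, of "munit k" l] by simp
qed

text \<open>The linear part of \<open>f\<close> is diagonal by \<open>conjugacy_linear_part\<close>,
  so its contribution moves to the left and forms the divisor. The powers left on the right involve
  only coefficients of \<Phi> of degree less than that of \<beta>.\<close>

lemma conjugacy_divisor:
  assumes \<Phi>: "fmap_tangent_id \<Phi>"
    and conj: "\<And>\<beta>. mfps_nth (mfps_compose f \<Phi>) \<beta> = mfps_nth (\<Phi> $ l) \<beta> * mpow d \<beta>"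
    and \<beta>: "2 \<le> mdeg \<beta>" "mdeg \<beta> \<le> N"
  shows "(mpow d \<beta> - d l) * mfps_nth (\<Phi> $ l) \<beta> =
    (\<Sum>\<alpha> | 2 \<le> mdeg \<alpha> \<and> mdeg \<alpha> \<le> N. mfps_nth f \<alpha> * mfps_nth (mpow (\<lambda>k. \<Phi> $ k) \<alpha>) \<beta>)"
proof -
  let ?t = "\<lambda>\<alpha>. mfps_nth f \<alpha> * mfps_nth (mpow (\<lambda>k. \<Phi> $ k) \<alpha>) \<beta>"
  have "mfps_nth (\<Phi> $ l) \<beta> * mpow d \<beta> = (\<Sum>\<alpha> | mdeg \<alpha> \<le> N. ?t \<alpha>)"
    using mfps_nth_compose[OF no_constant_tangent_id[OF \<Phi>] \<beta>(2), of f] conj by simp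
  also have "\<dots> = (\<Sum>\<alpha> | mdeg \<alpha> \<le> min 1 N. ?t \<alpha>) + (\<Sum>\<alpha> | 2 \<le> mdeg \<alpha> \<and> mdeg \<alpha> \<le> N. ?t \<alpha>)"
    unfolding multiindex_le_1_split[of N]
    by (rule sum.union_disjoint) (auto intro: finite_subset[OF _ finite_mdeg_le[of N]])
  also have "(\<Sum>\<alpha> | mdeg \<alpha> \<le> min 1 N. ?t \<alpha>) =
      (\<Sum>\<alpha> | mdeg \<alpha> \<le> min 1 N. if \<alpha> = munit l then d l * mfps_nth (\<Phi> $ l) \<beta> else 0)"
  proof (intro sum.cong refl)
    fix \<alpha> :: "'a \<Rightarrow> nat" assume "\<alpha> \<in> {\<alpha>. mdeg \<alpha> \<le> min 1 N}"
    then consider "mdeg \<alpha> = 0" | "mdeg \<alpha> = 1" by (force simp del: mdeg_eq_0_iff simp: le_Suc_eq)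
    then show "?t \<alpha> = (if \<alpha> = munit l then d l * mfps_nth (\<Phi> $ l) \<beta> else 0)"
    proof cases
      case 1
      have "\<beta> \<noteq> 0" "munit l \<noteq> 0" using \<beta> by (auto, metis mdeg_0 mdeg_munit zero_neq_one)
      with 1 show ?thesis by (simp add: mfps_nth_1)
    next
      case 2
      then obtain m where "\<alpha> = munit m" using mdeg_eq_1_iff by blast
      then show ?thesis using conjugacy_linear_part[OF \<Phi> conj, of m] by simp
    qed
  qed
  also have "\<dots> = d l * mfps_nth (\<Phi> $ l) \<beta>"
    using \<beta> by (simp add: sum.delta')
  finally show ?thesis by (simp add: algebra_simps)
qed

section \<open>The Siegel-Brjuno estimate\<close>

context diophantine_family
begin

definition "brjuno_weight t \<alpha> = t ^ mdeg \<alpha> * exp (- loss \<alpha>)"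
text \<open>Below degree 2 the divisor may vanish, as it does at \<open>munit l\<close>; the weight
  is set to 0 there.\<close>

definition "brjuno_divisor_weight t l \<alpha> = (if 2 \<le> mdeg \<alpha> then brjuno_weight t \<alpha> / small_divisor \<mu> \<alpha> l else 0)"

lemma brjuno_weight_add_divisor:
  assumes "0 < t" "\<alpha> \<noteq> 0" "\<beta> \<noteq> 0"
  shows "brjuno_divisor_weight t l (\<alpha> + \<beta>) \<le> brjuno_weight t \<alpha> * brjuno_weight t \<beta>"
proof -
  have "1 \<le> mdeg \<alpha>" "1 \<le> mdeg \<beta>"
    using assms(2,3) by (metis mdeg_eq_0_iff less_one not_le)+
  then have deg: "2 \<le> mdeg (\<alpha> + \<beta>)" by simp
  have "exp (- loss (\<alpha> + \<beta>)) / small_divisor \<mu> (\<alpha> + \<beta>) l =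
      exp (- loss (\<alpha> + \<beta>) - ln (small_divisor \<mu> (\<alpha> + \<beta>) l))"
    using divisor_pos[OF deg, of l] by (simp add: exp_diff)
  also have "\<dots> \<le> exp (- loss \<alpha> + - loss \<beta>)"
    unfolding exp_le_cancel_iff using loss_add_divisor[OF assms(2,3), of l] by linarith
  finally have "t ^ mdeg (\<alpha> + \<beta>) * (exp (- loss (\<alpha> + \<beta>)) / small_divisor \<mu> (\<alpha> + \<beta>) l) \<le>
      t ^ mdeg (\<alpha> + \<beta>) * (exp (- loss \<alpha>) * exp (- loss \<beta>))"
    using assms(1) by (intro mult_left_mono) (auto simp: mult_exp_exp)
  then show ?thesis
    using deg by (simp add: brjuno_divisor_weight_def brjuno_weight_def power_add mult_ac)
qed

lemma brjuno_weight_add: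
  assumes "0 < t"
  shows "brjuno_weight t (\<alpha> + \<beta>) \<le> brjuno_weight t \<alpha> * brjuno_weight t \<beta>"
proof (cases "\<alpha> = 0 \<or> \<beta> = 0")
  case True
  then show ?thesis using loss_le_1[of 0] by (auto simp: brjuno_weight_def)
next
  case False
  have "exp (- loss (\<alpha> + \<beta>)) \<le> exp (- loss \<alpha> + - loss \<beta>)"
    \<comment> \<open>Any coordinate will do: only the nonnegativity of the divisor term is
      used.\<close>
    unfolding exp_le_cancel_iff using loss_add_divisor[of \<alpha> \<beta> undefined] False by linarith
  then have "t ^ mdeg (\<alpha> + \<beta>) * exp (- loss (\<alpha> + \<beta>)) \<le> t ^ mdeg (\<alpha> + \<beta>) * (exp (- loss \<alpha>) * exp (- loss \<beta>))"
    using assms(1) by (intro mult_left_mono) (auto simp: mult_exp_exp)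
  then show ?thesis
    by (simp add: brjuno_weight_def power_add mult_ac)
qed

lemma brjuno_weight_nonneg: "0 < t \<Longrightarrow> 0 \<le> brjuno_weight t \<alpha>" "0 < t \<Longrightarrow> 0 \<le> brjuno_divisor_weight t l \<alpha>"
  using divisor_pos[of \<alpha> l] by (auto simp: brjuno_weight_def brjuno_divisor_weight_def)

context
  fixes \<Phi> :: "'n mfps ^ 'n" and T :: "'m \<Rightarrow> 'm \<Rightarrow> 'n mfps ^ 'n" and c K :: real
  assumes \<Phi>: "fmap_tangent_id \<Phi>"
    and conj: "\<And>i j l \<beta>. mfps_nth (mfps_compose (T i j $ l) \<Phi>) \<beta> = mfps_nth (\<Phi> $ l) \<beta> * mpow (\<mu> i j) \<beta>"
    and T_le: "\<And>i j l \<alpha>. cmod (mfps_nth (T i j $ l) \<alpha>) \<le> c * K ^ mdeg \<alpha>"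
    and cK: "0 \<le> c" "0 < K"
begin

text \<open>The conjugacy equation holds for every pair, so the one with the largest divisor may be
  used. The choice varies with \<beta> and \<open>l\<close>, but the bound
  \<open>c * K ^ mdeg \<alpha>\<close> on the coefficients of \<open>T i j\<close> is common to all
  pairs.\<close>

lemma coefficient_le:
  assumes "2 \<le> mdeg \<beta>" "mdeg \<beta> \<le> N"
  shows "cmod (mfps_nth (\<Phi> $ l) \<beta>) \<le>
    (\<Sum>\<alpha> | 2 \<le> mdeg \<alpha> \<and> mdeg \<alpha> \<le> N. c * K ^ mdeg \<alpha> * cmod (mfps_nth (mpow (\<lambda>k. \<Phi> $ k) \<alpha>) \<beta>))
      / small_divisor \<mu> \<beta> l"
proof -
  obtain i j where ij: "small_divisor \<mu> \<beta> l = cmod (mpow (\<mu> i j) \<beta> - \<mu> i j l)"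
    using divisor_attained by blast
  have "small_divisor \<mu> \<beta> l * cmod (mfps_nth (\<Phi> $ l) \<beta>) =
      cmod (\<Sum>\<alpha> | 2 \<le> mdeg \<alpha> \<and> mdeg \<alpha> \<le> N. mfps_nth (T i j $ l) \<alpha> * mfps_nth (mpow (\<lambda>k. \<Phi> $ k) \<alpha>) \<beta>)"
    unfolding conjugacy_divisor[OF \<Phi> conj assms, symmetric] norm_mult ij ..
  also have "\<dots> \<le> (\<Sum>\<alpha> | 2 \<le> mdeg \<alpha> \<and> mdeg \<alpha> \<le> N. cmod (mfps_nth (T i j $ l) \<alpha> * mfps_nth (mpow (\<lambda>k. \<Phi> $ k) \<alpha>) \<beta>))"
    by (rule norm_sum)
  also have "\<dots> \<le> (\<Sum>\<alpha> | 2 \<le> mdeg \<alpha> \<and> mdeg \<alpha> \<le> N. c * K ^ mdeg \<alpha> * cmod (mfps_nth (mpow (\<lambda>k. \<Phi> $ k) \<alpha>) \<beta>))"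
    unfolding norm_mult by (intro sum_mono mult_right_mono T_le norm_ge_zero)
  finally show ?thesis
    using divisor_pos[OF assms(1), of l] by (simp only: pos_le_divide_eq mult.commute)
qed

text \<open>The divisor is absorbed by \<open>brjuno_divisor_weight\<close>. What remains is
  \<open>t\<close> from the identity part of \<Phi> and a geometric sum over degrees at least 2,
  which is quadratic in \<open>t\<close>.\<close>

lemma trunc_norm_step:
  assumes t: "0 < t" "2 * t * K \<le> 1/2"
    and IH: "\<And>k. trunc_norm (brjuno_weight t) d (\<Phi> $ k) \<le> 2 * t"
  shows "trunc_norm (brjuno_weight t) (Suc d) (\<Phi> $ l) \<le> t + c * (4 * 2 ^ CARD('n) * (2 * t * K)\<^sup>2)"
proof -
  define N where "N = Suc d"
  define A where "A = {\<alpha> :: 'n \<Rightarrow> nat. 2 \<le> mdeg \<alpha> \<and> mdeg \<alpha> \<le> N}"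
  have fin: "finite A"
    by (rule finite_subset[OF _ finite_mdeg_le[of N]]) (auto simp: A_def)
  let ?\<Phi> = "\<lambda>\<alpha> \<beta>. cmod (mfps_nth (mpow (\<lambda>k. \<Phi> $ k) \<alpha>) \<beta>)"
  have "trunc_norm (brjuno_weight t) N (\<Phi> $ l) =
      (\<Sum>\<alpha> | mdeg \<alpha> \<le> min 1 N. cmod (mfps_nth (\<Phi> $ l) \<alpha>) * brjuno_weight t \<alpha>) +
      (\<Sum>\<alpha>\<in>A. cmod (mfps_nth (\<Phi> $ l) \<alpha>) * brjuno_weight t \<alpha>)"
    unfolding trunc_norm_def multiindex_le_1_split[of N] A_def
    by (rule sum.union_disjoint) (auto intro: finite_subset[OF _ finite_mdeg_le[of N]])
  also have "(\<Sum>\<alpha> | mdeg \<alpha> \<le> min 1 N. cmod (mfps_nth (\<Phi> $ l) \<alpha>) * brjuno_weight t \<alpha>) =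
      (\<Sum>\<alpha> | mdeg \<alpha> \<le> min 1 N. if \<alpha> = munit l then t else 0)"
  proof (intro sum.cong refl)
    fix \<alpha> :: "'n \<Rightarrow> nat" assume "\<alpha> \<in> {\<alpha>. mdeg \<alpha> \<le> min 1 N}"
    then show "cmod (mfps_nth (\<Phi> $ l) \<alpha>) * brjuno_weight t \<alpha> = (if \<alpha> = munit l then t else 0)"
      using fmap_tangent_id_nth[OF \<Phi>, of \<alpha> l] loss_le_1[of "munit l"] by (simp add: brjuno_weight_def)
  qed
  also have "\<dots> = t"
    by (simp add: N_def)
  finally have split: "trunc_norm (brjuno_weight t) N (\<Phi> $ l) = t + (\<Sum>\<alpha>\<in>A. cmod (mfps_nth (\<Phi> $ l) \<alpha>) * brjuno_weight t \<alpha>)" .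
  have "(\<Sum>\<beta>\<in>A. cmod (mfps_nth (\<Phi> $ l) \<beta>) * brjuno_weight t \<beta>) \<le>
      (\<Sum>\<beta>\<in>A. \<Sum>\<alpha>\<in>A. c * K ^ mdeg \<alpha> * (?\<Phi> \<alpha> \<beta> * brjuno_divisor_weight t l \<beta>))"
  proof (rule sum_mono)
    fix \<beta> assume "\<beta> \<in> A"
    then have \<beta>: "2 \<le> mdeg \<beta>" "mdeg \<beta> \<le> N" by (auto simp: A_def)
    have "cmod (mfps_nth (\<Phi> $ l) \<beta>) * brjuno_weight t \<beta> \<le>
        (\<Sum>\<alpha>\<in>A. c * K ^ mdeg \<alpha> * ?\<Phi> \<alpha> \<beta>) / small_divisor \<mu> \<beta> l * brjuno_weight t \<beta>"
      unfolding A_def by (intro mult_right_mono coefficient_le \<beta> brjuno_weight_nonneg t)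
    also have "\<dots> = (\<Sum>\<alpha>\<in>A. c * K ^ mdeg \<alpha> * ?\<Phi> \<alpha> \<beta>) * brjuno_divisor_weight t l \<beta>"
      using \<beta> by (simp add: brjuno_divisor_weight_def)
    finally show "cmod (mfps_nth (\<Phi> $ l) \<beta>) * brjuno_weight t \<beta> \<le>
        (\<Sum>\<alpha>\<in>A. c * K ^ mdeg \<alpha> * (?\<Phi> \<alpha> \<beta> * brjuno_divisor_weight t l \<beta>))"
      by (simp add: sum_distrib_right mult.assoc)
  qed
  also have "\<dots> = (\<Sum>\<alpha>\<in>A. c * K ^ mdeg \<alpha> * (\<Sum>\<beta>\<in>A. ?\<Phi> \<alpha> \<beta> * brjuno_divisor_weight t l \<beta>))"
    by (subst sum.swap) (simp add: sum_distrib_left)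
  also have "\<dots> \<le> (\<Sum>\<alpha>\<in>A. c * K ^ mdeg \<alpha> * (2 * t) ^ mdeg \<alpha>)"
  proof (intro sum_mono mult_left_mono)
    fix \<alpha> assume "\<alpha> \<in> A"
    then have \<alpha>: "2 \<le> mdeg \<alpha>" by (simp add: A_def)
    have "(\<Sum>\<beta>\<in>A. ?\<Phi> \<alpha> \<beta> * brjuno_divisor_weight t l \<beta>) \<le> trunc_norm (brjuno_divisor_weight t l) N (mpow (\<lambda>k. \<Phi> $ k) \<alpha>)"
      unfolding trunc_norm_def A_def using brjuno_weight_nonneg t
      by (intro sum_mono2) (auto intro: finite_subset[OF _ finite_mdeg_le[of N]])
    also have "\<dots> \<le> mpow (\<lambda>k. trunc_norm (brjuno_weight t) d (\<Phi> $ k)) \<alpha>"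
      unfolding N_def
    proof (rule trunc_norm_Suc_mpow_le[OF no_constant_tangent_id[OF \<Phi>] _ _ _ _ _ \<alpha>])
      show "brjuno_weight t 0 \<le> 1" by (simp add: brjuno_weight_def loss_le_1)
    qed (rule brjuno_weight_add[OF t(1)] brjuno_weight_add_divisor[OF t(1)] brjuno_weight_nonneg[OF t(1)]; assumption?)+
    also have "\<dots> \<le> mpow (\<lambda>k. 2 * t) \<alpha>"
      by (intro mpow_mono IH trunc_norm_nonneg brjuno_weight_nonneg t)
    finally show "(\<Sum>\<beta>\<in>A. ?\<Phi> \<alpha> \<beta> * brjuno_divisor_weight t l \<beta>) \<le> (2 * t) ^ mdeg \<alpha>"
      by (simp add: mpow_const)
  qed (use cK in auto)
  also have "\<dots> = c * (\<Sum>\<alpha>\<in>A. (2 * t * K) ^ mdeg \<alpha>)"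
    by (simp add: sum_distrib_left power_mult_distrib mult_ac)
  also have "\<dots> \<le> c * (4 * 2 ^ CARD('n) * (2 * t * K)\<^sup>2)"
    unfolding A_def using t cK by (intro mult_left_mono sum_geometric_multiindex) auto
  finally show ?thesis
    using split unfolding N_def by simp
qed

lemma linearization_converges:
  "\<exists>r>0. \<forall>l. (\<lambda>\<alpha>. cmod (mfps_nth (\<Phi> $ l) \<alpha>) * r ^ mdeg \<alpha>) summable_on UNIV"
proof -
  \<comment> \<open>With this \<open>E\<close> the quadratic term of \<open>trunc_norm_step\<close>
    is exactly \<open>E * t * t\<close>. The choice of \<open>t\<close> ensures both
    \<open>4 * t * K \<le> 1\<close> and \<open>E * t \<le> 1\<close>, so the bound
    \<open>2 * t\<close> reproduces itself.\<close>
  define E where "E = 16 * c * 2 ^ CARD('n) * K\<^sup>2"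
  define t where "t = 1 / (4 * K + E + 1)"
  have E: "0 \<le> E" using cK by (simp add: E_def)
  then have "0 < 4 * K + E + 1" using cK by simp
  then have t: "0 < t" "2 * t * K \<le> 1/2" "E * t \<le> 1"
    unfolding t_def using cK E by (simp_all add: pos_divide_le_eq)
  have bound: "trunc_norm (brjuno_weight t) d (\<Phi> $ l) \<le> 2 * t" for d l
  proof (induction d arbitrary: l)
    case 0
    have "{\<alpha> :: 'n \<Rightarrow> nat. mdeg \<alpha> \<le> 0} = {0}" by auto
    then show ?case
      using no_constant_tangent_id[OF \<Phi>] t by (simp add: trunc_norm_def no_constant_def)
  next
    case (Suc d)
    have "c * (4 * 2 ^ CARD('n) * (2 * t * K)\<^sup>2) = E * t * t"
      by (simp add: E_def power2_eq_square)
    also have "\<dots> \<le> 1 * t"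
      using t by (intro mult_right_mono) auto
    finally show ?case
      using trunc_norm_step[OF t(1,2) Suc.IH, of l] by simp
  qed
  obtain C where C: "\<And>Q. loss Q \<le> C * real (mdeg Q)"
    using loss_linear by blast
  \<comment> \<open>Linear growth of the loss makes \<open>r ^ mdeg \<alpha>\<close> a lower bound
    for the weight.\<close>
  define r where "r = t * exp (- C)"
  have r: "r ^ mdeg \<alpha> \<le> brjuno_weight t \<alpha>" for \<alpha>
  proof -
    have "exp (- C) ^ mdeg \<alpha> \<le> exp (- loss \<alpha>)"
      unfolding exp_of_nat_mult[symmetric] exp_le_cancel_iff using C[of \<alpha>] by (simp add: mult.commute)
    then show ?thesis
      using t unfolding r_def brjuno_weight_def power_mult_distrib by (intro mult_left_mono) auto
  qed
  have r0: "0 < r" using t by (simp add: r_def)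
  have "(\<lambda>\<alpha>. cmod (mfps_nth (\<Phi> $ l) \<alpha>) * r ^ mdeg \<alpha>) summable_on UNIV" for l
  proof (rule nonneg_bdd_above_summable_on)
    show "bdd_above (sum (\<lambda>\<alpha>. cmod (mfps_nth (\<Phi> $ l) \<alpha>) * r ^ mdeg \<alpha>) ` {F. F \<subseteq> UNIV \<and> finite F})"
    proof (rule bdd_aboveI2)
      fix F :: "('n \<Rightarrow> nat) set" assume "F \<in> {F. F \<subseteq> UNIV \<and> finite F}"
      then have "finite F" by simp
      have sub: "F \<subseteq> {\<alpha>. mdeg \<alpha> \<le> Max (mdeg ` F)}"
        using \<open>finite F\<close> by auto
      have "(\<Sum>\<alpha>\<in>F. cmod (mfps_nth (\<Phi> $ l) \<alpha>) * r ^ mdeg \<alpha>) \<le> (\<Sum>\<alpha>\<in>F. cmod (mfps_nth (\<Phi> $ l) \<alpha>) * brjuno_weight t \<alpha>)"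
        by (intro sum_mono mult_left_mono r) auto
      also have "\<dots> \<le> trunc_norm (brjuno_weight t) (Max (mdeg ` F)) (\<Phi> $ l)"
        unfolding trunc_norm_def using sub brjuno_weight_nonneg t by (intro sum_mono2) auto
      finally show "(\<Sum>\<alpha>\<in>F. cmod (mfps_nth (\<Phi> $ l) \<alpha>) * r ^ mdeg \<alpha>) \<le> 2 * t"
        using bound order_trans by blast
    qed
  qed (use r0 in auto)
  with r0 show ?thesis by blast
qed

end

end

section \<open>Evaluation of convergent power series\<close>

text \<open>The double family is absolutely summable, so it may be regrouped by the sum of the two
  indices.\<close>

lemma multiindex_cauchy_product:
  fixes f g :: "('n::finite \<Rightarrow> nat) \<Rightarrow> 'c::{real_normed_field, banach}"
  assumes f: "(\<lambda>\<alpha>. norm (f \<alpha>)) summable_on UNIV" and g: "(\<lambda>\<alpha>. norm (g \<alpha>)) summable_on UNIV"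
  shows "((\<lambda>\<alpha>. \<Sum>\<beta> | \<beta> \<le> \<alpha>. f \<beta> * g (\<alpha> - \<beta>)) has_sum (infsum f UNIV * infsum g UNIV)) UNIV"
proof -
  let ?h = "\<lambda>(\<beta>, \<gamma>). f \<beta> * g \<gamma>"
  have fs: "f summable_on UNIV" and gs: "g summable_on UNIV"
    using f g abs_summable_summable by blast+
  have "(\<lambda>x. norm (?h x)) summable_on (UNIV \<times> UNIV)"
    using f g
    by (intro Infinite_Sum.abs_summable_on_Sigma_iff[THEN iffD2])
       (auto simp: norm_mult infsum_cmult_right' infsum_nonneg intro!: summable_on_cmult_right summable_on_cmult_left)
  then have "?h summable_on (UNIV \<times> UNIV)"
    by (rule abs_summable_summable)
  moreover have "((\<lambda>\<beta>. f \<beta> * infsum g UNIV) has_sum (infsum f UNIV * infsum g UNIV)) UNIV"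
    using fs by (intro has_sum_cmult_left) simp
  moreover have "((\<lambda>\<gamma>. ?h (\<beta>, \<gamma>)) has_sum (f \<beta> * infsum g UNIV)) UNIV" for \<beta>
    using gs by (auto intro!: has_sum_cmult_right)
  ultimately have "(?h has_sum (infsum f UNIV * infsum g UNIV)) (UNIV \<times> UNIV)"
    using has_sum_SigmaI[where f = ?h and A = UNIV and g = "\<lambda>\<beta>. f \<beta> * infsum g UNIV" and B = "\<lambda>_. UNIV"] by auto
  also have "?this \<longleftrightarrow> ((\<lambda>(\<alpha>, \<beta>). f \<beta> * g (\<alpha> - \<beta>)) has_sum (infsum f UNIV * infsum g UNIV)) (SIGMA \<alpha>:UNIV. {\<beta>. \<beta> \<le> \<alpha>})"
    by (rule has_sum_reindex_bij_witness[where j = "\<lambda>(\<beta>, \<gamma>). (\<beta> + \<gamma>, \<beta>)" and i = "\<lambda>(\<alpha>, \<beta>). (\<beta>, \<alpha> - \<beta>)"])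
       (auto simp: fun_eq_iff le_fun_def pointwise)
  finally show ?thesis
    by (rule has_sum_SigmaD) auto
qed

lemma vec_nth_vec_lambda [simp]: "($) (vec_lambda f) = f"
  by (simp add: fun_eq_iff)

section \<open>Norms and values on polydiscs\<close>

definition mfps_summable :: "'n::finite mfps \<Rightarrow> real \<Rightarrow> bool"
  where "mfps_summable f r \<longleftrightarrow> (\<lambda>\<alpha>. cmod (mfps_nth f \<alpha>) * r ^ mdeg \<alpha>) summable_on UNIV"

definition mfps_norm :: "'n::finite mfps \<Rightarrow> real \<Rightarrow> real"
  where "mfps_norm f r = (\<Sum>\<^sub>\<infinity>\<alpha>. cmod (mfps_nth f \<alpha>) * r ^ mdeg \<alpha>)"

definition mfps_eval :: "'n::finite mfps \<Rightarrow> complex ^ 'n \<Rightarrow> complex"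
  where "mfps_eval f z = (\<Sum>\<^sub>\<infinity>\<alpha>. mfps_nth f \<alpha> * mpow (\<lambda>k. z $ k) \<alpha>)"

lemma cmod_mpow_le:
  assumes "\<And>k. cmod (z $ k) \<le> r"
  shows "cmod (mpow (\<lambda>k. z $ k) \<alpha>) \<le> r ^ mdeg \<alpha>"
proof -
  have "mpow (\<lambda>k. cmod (z $ k)) \<alpha> \<le> mpow (\<lambda>_. r) \<alpha>"
    by (rule mpow_mono) (use assms in auto)
  then show ?thesis
    by (simp add: norm_mpow mpow_const)
qed

lemma mfps_eval_abs_summable:
  assumes "mfps_summable f r" "\<And>k. cmod (z $ k) \<le> r"
  shows "(\<lambda>\<alpha>. cmod (mfps_nth f \<alpha> * mpow (\<lambda>k. z $ k) \<alpha>)) summable_on UNIV"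
proof (rule Infinite_Sum.abs_summable_on_comparison_test')
  show "(\<lambda>\<alpha>. cmod (mfps_nth f \<alpha>) * r ^ mdeg \<alpha>) summable_on UNIV"
    using assms(1) by (simp add: mfps_summable_def)
  show "cmod (mfps_nth f \<alpha> * mpow (\<lambda>k. z $ k) \<alpha>) \<le> cmod (mfps_nth f \<alpha>) * r ^ mdeg \<alpha>" for \<alpha>
    unfolding norm_mult by (rule mult_left_mono[OF cmod_mpow_le]) (use assms in auto)
qed

lemma mfps_eval_has_sum:
  assumes "mfps_summable f r" "\<And>k. cmod (z $ k) \<le> r"
  shows "((\<lambda>\<alpha>. mfps_nth f \<alpha> * mpow (\<lambda>k. z $ k) \<alpha>) has_sum mfps_eval f z) UNIV"
  unfolding mfps_eval_def
  using abs_summable_summable[OF mfps_eval_abs_summable[OF assms]] by simp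

lemma mfps_norm_nonneg: "0 \<le> r \<Longrightarrow> 0 \<le> mfps_norm f r"
  unfolding mfps_norm_def by (intro infsum_nonneg) auto

lemma cmod_mfps_eval_le:
  assumes "mfps_summable f r" "\<And>k. cmod (z $ k) \<le> r"
  shows "cmod (mfps_eval f z) \<le> mfps_norm f r"
proof -
  have "cmod (mfps_eval f z) \<le> (\<Sum>\<^sub>\<infinity>\<alpha>. cmod (mfps_nth f \<alpha> * mpow (\<lambda>k. z $ k) \<alpha>))"
    unfolding mfps_eval_def by (rule norm_infsum_bound[OF mfps_eval_abs_summable[OF assms]])
  also have "\<dots> \<le> mfps_norm f r"
    unfolding mfps_norm_def
  proof (rule infsum_mono)
    show "cmod (mfps_nth f \<alpha> * mpow (\<lambda>k. z $ k) \<alpha>) \<le> cmod (mfps_nth f \<alpha>) * r ^ mdeg \<alpha>" for \<alpha>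
      unfolding norm_mult by (rule mult_left_mono[OF cmod_mpow_le]) (use assms in auto)
  qed (use mfps_eval_abs_summable[OF assms] assms(1) in \<open>auto simp: mfps_summable_def\<close>)
  finally show ?thesis .
qed

lemma mfps_summable_mult_aux:
  assumes "mfps_summable f r" "mfps_summable g r" "0 \<le> r"
  shows "((\<lambda>\<alpha>. (\<Sum>\<beta> | \<beta> \<le> \<alpha>. cmod (mfps_nth f \<beta>) * cmod (mfps_nth g (\<alpha> - \<beta>))) * r ^ mdeg \<alpha>)
      has_sum (mfps_norm f r * mfps_norm g r)) UNIV"
proof -
  let ?f = "\<lambda>\<alpha>. cmod (mfps_nth f \<alpha>) * r ^ mdeg \<alpha>" and ?g = "\<lambda>\<alpha>. cmod (mfps_nth g \<alpha>) * r ^ mdeg \<alpha>"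
  have "((\<lambda>\<alpha>. \<Sum>\<beta> | \<beta> \<le> \<alpha>. ?f \<beta> * ?g (\<alpha> - \<beta>)) has_sum (mfps_norm f r * mfps_norm g r)) UNIV"
    unfolding mfps_norm_def
    using assms by (intro multiindex_cauchy_product) (auto simp: mfps_summable_def abs_mult power_abs[symmetric])
  moreover have "(\<Sum>\<beta> | \<beta> \<le> \<alpha>. ?f \<beta> * ?g (\<alpha> - \<beta>)) =
      (\<Sum>\<beta> | \<beta> \<le> \<alpha>. cmod (mfps_nth f \<beta>) * cmod (mfps_nth g (\<alpha> - \<beta>))) * r ^ mdeg \<alpha>" for \<alpha>
    unfolding sum_distrib_right
  proof (intro sum.cong refl)
    fix \<beta> assume "\<beta> \<in> {\<beta>. \<beta> \<le> \<alpha>}"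
    then have "mdeg \<alpha> = mdeg \<beta> + mdeg (\<alpha> - \<beta>)"
      using mdeg_mono[of \<beta> \<alpha>] by (simp add: mdeg_diff)
    then have "r ^ mdeg \<alpha> = r ^ mdeg \<beta> * r ^ mdeg (\<alpha> - \<beta>)"
      by (simp add: power_add)
    then show "?f \<beta> * ?g (\<alpha> - \<beta>) = cmod (mfps_nth f \<beta>) * cmod (mfps_nth g (\<alpha> - \<beta>)) * r ^ mdeg \<alpha>"
      by simp
  qed
  ultimately show ?thesis by simp
qed

lemma mfps_nth_mult_norm_le:
  "cmod (mfps_nth (f * g) \<alpha>) \<le> (\<Sum>\<beta> | \<beta> \<le> \<alpha>. cmod (mfps_nth f \<beta>) * cmod (mfps_nth g (\<alpha> - \<beta>)))"
  unfolding mfps_nth_mult by (rule order_trans[OF norm_sum]) (simp add: norm_mult)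

lemma mfps_summable_mult:
  assumes "mfps_summable f r" "mfps_summable g r" "0 \<le> r"
  shows "mfps_summable (f * g) r" "mfps_norm (f * g) r \<le> mfps_norm f r * mfps_norm g r"
proof -
  note sum = mfps_summable_mult_aux[OF assms]
  have le: "cmod (mfps_nth (f * g) \<alpha>) * r ^ mdeg \<alpha> \<le>
      (\<Sum>\<beta> | \<beta> \<le> \<alpha>. cmod (mfps_nth f \<beta>) * cmod (mfps_nth g (\<alpha> - \<beta>))) * r ^ mdeg \<alpha>" for \<alpha>
    by (rule mult_right_mono[OF mfps_nth_mult_norm_le]) (use assms in auto)
  show *: "mfps_summable (f * g) r"
    unfolding mfps_summable_def
    by (rule summable_on_comparison_test[OF has_sum_imp_summable[OF sum] le]) (use assms in auto)
  show "mfps_norm (f * g) r \<le> mfps_norm f r * mfps_norm g r"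
    unfolding mfps_norm_def[of "f * g"] infsumI[OF sum, symmetric]
    by (rule infsum_mono[OF _ has_sum_imp_summable[OF sum] le]) (use * in \<open>simp add: mfps_summable_def\<close>)
qed

lemma mfps_eval_mult:
  assumes "mfps_summable f r" "mfps_summable g r" "\<And>k. cmod (z $ k) \<le> r"
  shows "mfps_eval (f * g) z = mfps_eval f z * mfps_eval g z"
proof -
  let ?x = "mpow (\<lambda>k. z $ k)"
  have "((\<lambda>\<alpha>. \<Sum>\<beta> | \<beta> \<le> \<alpha>. (mfps_nth f \<beta> * ?x \<beta>) * (mfps_nth g (\<alpha> - \<beta>) * ?x (\<alpha> - \<beta>)))
      has_sum (mfps_eval f z * mfps_eval g z)) UNIV"
    unfolding mfps_eval_def
    by (rule multiindex_cauchy_product) (rule mfps_eval_abs_summable assms; use assms in auto)+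
  moreover have "(\<Sum>\<beta> | \<beta> \<le> \<alpha>. (mfps_nth f \<beta> * ?x \<beta>) * (mfps_nth g (\<alpha> - \<beta>) * ?x (\<alpha> - \<beta>))) =
      mfps_nth (f * g) \<alpha> * ?x \<alpha>" for \<alpha>
    unfolding mfps_nth_mult sum_distrib_right
  proof (intro sum.cong refl)
    fix \<beta> assume "\<beta> \<in> {\<beta>. \<beta> \<le> \<alpha>}"
    then have "?x \<alpha> = ?x (\<alpha> - \<beta>) * ?x \<beta>"
      using multiindex_diff_add[of \<beta> \<alpha>] mpow_add by (metis mem_Collect_eq)
    then show "(mfps_nth f \<beta> * ?x \<beta>) * (mfps_nth g (\<alpha> - \<beta>) * ?x (\<alpha> - \<beta>)) =
        mfps_nth f \<beta> * mfps_nth g (\<alpha> - \<beta>) * ?x \<alpha>"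
      by simp
  qed
  ultimately show ?thesis
    unfolding mfps_eval_def[of "f * g"] by (simp add: infsumI)
qed

text \<open>The map \<open>g\<close> is instantiated with the modulus and with the identity, which
  gives the norm and the value of the constant series.\<close>

lemma mfps_1_has_sum: "((\<lambda>\<alpha>. g (mfps_nth 1 \<alpha>) * h \<alpha>) has_sum (g 1 * h 0)) UNIV"
  if "g 0 = 0" for g :: "complex \<Rightarrow> 'c::{real_normed_algebra, comm_ring}"
proof (rule has_sum_finite_neutralI[of "{0}"])
qed (auto simp: mfps_nth_1 that)

lemma mfps_mpow:
  assumes G: "\<And>k. mfps_summable (G $ k) r" and r: "0 \<le> r"
  shows mfps_summable_mpow: "mfps_summable (mpow (\<lambda>k. G $ k) \<alpha>) r"
    and mfps_norm_mpow: "mfps_norm (mpow (\<lambda>k. G $ k) \<alpha>) r \<le> mpow (\<lambda>k. mfps_norm (G $ k) r) \<alpha>"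
    and mfps_eval_mpow: "(\<And>k. cmod (z $ k) \<le> r) \<Longrightarrow>
      mfps_eval (mpow (\<lambda>k. G $ k) \<alpha>) z = mpow (\<lambda>k. mfps_eval (G $ k) z) \<alpha>"
proof (induction \<alpha> rule: multiindex_induct)
  case zero
  note one = mfps_1_has_sum[of cmod "\<lambda>\<alpha>. r ^ mdeg \<alpha>"] mfps_1_has_sum[of "\<lambda>x. x" "mpow (\<lambda>k. z $ k)"]
  {
    case 1
    then show ?case
      by (simp add: mfps_summable_def has_sum_imp_summable[OF one(1)])
  next
    case 2
    then show ?case by (simp add: mfps_norm_def infsumI[OF one(1)])
  next
    case 3
    then show ?case by (simp add: mfps_eval_def infsumI[OF one(2)])
  }
next
  case (add Q k)
  {
    case 1
    then show ?case
      using mfps_summable_mult(1)[OF add.IH(1) G r] by (simp add: mpow_add)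
  next
    case 2
    have "mfps_norm (mpow (\<lambda>k. G $ k) Q * G $ k) r \<le> mfps_norm (mpow (\<lambda>k. G $ k) Q) r * mfps_norm (G $ k) r"
      by (rule mfps_summable_mult(2)[OF add.IH(1) G r])
    also have "\<dots> \<le> mpow (\<lambda>k. mfps_norm (G $ k) r) Q * mfps_norm (G $ k) r"
      by (rule mult_right_mono[OF add.IH(2) mfps_norm_nonneg[OF r]])
    finally show ?case by (simp add: mpow_add)
  next
    case 3
    then show ?case
      using mfps_eval_mult[OF add.IH(1) G, of z] add.IH(3) by (simp add: mpow_add)
  }
qed

text \<open>Both sides are iterated sums of one double family. The bound \<open>s\<close> on the
  norms of the components of \<open>G\<close> makes this family absolutely summable, so the order of
  summation can be exchanged.\<close>

lemma mfps_eval_compose: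
  assumes f: "mfps_summable f s" and G: "no_constant G" "\<And>k. mfps_summable (G $ k) r"
    and le: "\<And>k. mfps_norm (G $ k) r \<le> s" and z: "\<And>k. cmod (z $ k) \<le> r"
  shows "mfps_eval (mfps_compose f G) z = mfps_eval f (\<chi> k. mfps_eval (G $ k) z)"
proof -
  have r: "0 \<le> r" using z[of undefined] norm_ge_zero order_trans by blast
  let ?G = "\<lambda>\<alpha>. mpow (\<lambda>k. G $ k) \<alpha>" and ?x = "mpow (\<lambda>k. z $ k)"
  define u where "u = (\<lambda>\<alpha> \<beta>. mfps_nth f \<alpha> * (mfps_nth (?G \<alpha>) \<beta> * ?x \<beta>))"
  have sum1: "(\<lambda>\<beta>. cmod (mfps_nth (?G \<alpha>) \<beta> * ?x \<beta>)) summable_on UNIV" for \<alpha>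
    by (rule mfps_eval_abs_summable[OF mfps_summable_mpow[OF G(2) r] z])
  have inner: "(\<Sum>\<^sub>\<infinity>\<beta>. cmod (mfps_nth (?G \<alpha>) \<beta> * ?x \<beta>)) \<le> s ^ mdeg \<alpha>" for \<alpha>
  proof -
    have "(\<Sum>\<^sub>\<infinity>\<beta>. cmod (mfps_nth (?G \<alpha>) \<beta> * ?x \<beta>)) \<le> mfps_norm (?G \<alpha>) r"
      unfolding mfps_norm_def
    proof (rule infsum_mono[OF sum1])
      show "(\<lambda>\<beta>. cmod (mfps_nth (?G \<alpha>) \<beta>) * r ^ mdeg \<beta>) summable_on UNIV"
        using mfps_summable_mpow[OF G(2) r] by (simp add: mfps_summable_def)
      show "cmod (mfps_nth (?G \<alpha>) \<beta> * ?x \<beta>) \<le> cmod (mfps_nth (?G \<alpha>) \<beta>) * r ^ mdeg \<beta>" for \<beta>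
        unfolding norm_mult by (rule mult_left_mono[OF cmod_mpow_le[OF z]]) simp
    qed
    also have "\<dots> \<le> mpow (\<lambda>k. mfps_norm (G $ k) r) \<alpha>"
      by (rule mfps_norm_mpow[OF G(2) r])
    also have "\<dots> \<le> mpow (\<lambda>_. s) \<alpha>"
      by (rule mpow_mono[OF mfps_norm_nonneg[OF r] le])
    finally show ?thesis by (simp add: mpow_const)
  qed
  have "(\<lambda>x. cmod ((\<lambda>(\<alpha>, \<beta>). u \<alpha> \<beta>) x)) summable_on (UNIV \<times> UNIV)"
    unfolding Infinite_Sum.abs_summable_on_Sigma_iff
  proof (intro conjI ballI)
    fix \<alpha>
    show "(\<lambda>\<beta>. cmod ((\<lambda>(\<alpha>, \<beta>). u \<alpha> \<beta>) (\<alpha>, \<beta>))) summable_on UNIV"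
      using summable_on_cmult_right[OF sum1] by (simp add: u_def norm_mult)
  next
    have "norm (\<Sum>\<^sub>\<infinity>\<beta>. cmod (u \<alpha> \<beta>)) \<le> cmod (mfps_nth f \<alpha>) * s ^ mdeg \<alpha>" for \<alpha>
    proof -
      have "(\<Sum>\<^sub>\<infinity>\<beta>. cmod (u \<alpha> \<beta>)) = cmod (mfps_nth f \<alpha>) * (\<Sum>\<^sub>\<infinity>\<beta>. cmod (mfps_nth (?G \<alpha>) \<beta> * ?x \<beta>))"
        unfolding u_def norm_mult[of "mfps_nth f \<alpha>"] by (rule infsum_cmult_right')
      then show ?thesis
        using mult_left_mono[OF inner[of \<alpha>], of "cmod (mfps_nth f \<alpha>)"]
        by (simp add: infsum_nonneg)
    qed
    then show "(\<lambda>\<alpha>. norm (\<Sum>\<^sub>\<infinity>\<beta>. cmod ((\<lambda>(\<alpha>, \<beta>). u \<alpha> \<beta>) (\<alpha>, \<beta>)))) summable_on UNIV"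
      using f unfolding mfps_summable_def
      by (intro Infinite_Sum.abs_summable_on_comparison_test') auto
  qed
  then have "(\<lambda>(\<alpha>, \<beta>). u \<alpha> \<beta>) summable_on (UNIV \<times> UNIV)"
    by (rule abs_summable_summable)
  then have swap: "(\<Sum>\<^sub>\<infinity>\<alpha>. \<Sum>\<^sub>\<infinity>\<beta>. u \<alpha> \<beta>) = (\<Sum>\<^sub>\<infinity>\<beta>. \<Sum>\<^sub>\<infinity>\<alpha>. u \<alpha> \<beta>)"
    by (rule infsum_swap_banach)
  have left: "(\<Sum>\<^sub>\<infinity>\<beta>. u \<alpha> \<beta>) = mfps_nth f \<alpha> * mpow (\<lambda>k. (\<chi> k. mfps_eval (G $ k) z) $ k) \<alpha>" for \<alpha>
    using mfps_eval_mpow[OF G(2) r z, of \<alpha>]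
    by (simp add: u_def infsum_cmult_right' mfps_eval_def)
  have right: "(\<Sum>\<^sub>\<infinity>\<alpha>. u \<alpha> \<beta>) = mfps_nth (mfps_compose f G) \<beta> * ?x \<beta>" for \<beta>
  proof (rule infsumI)
    have "((\<lambda>\<alpha>. u \<alpha> \<beta>) has_sum (\<Sum>\<alpha> | mdeg \<alpha> \<le> mdeg \<beta>. u \<alpha> \<beta>)) UNIV"
      by (rule has_sum_finite_neutralI) (auto simp: u_def mfps_nth_mpow_eq_0[OF G(1)] not_le)
    then show "((\<lambda>\<alpha>. u \<alpha> \<beta>) has_sum (mfps_nth (mfps_compose f G) \<beta> * ?x \<beta>)) UNIV"
      by (simp add: mfps_nth_compose[OF G(1) order_refl] sum_distrib_right u_def mult.assoc)
  qed
  show ?thesis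
    using swap unfolding left right by (simp add: mfps_eval_def)
qed

lemma mfps_summable_mono:
  assumes "mfps_summable f r" "0 \<le> r'" "r' \<le> r"
  shows "mfps_summable f r'"
  unfolding mfps_summable_def
proof (rule summable_on_comparison_test)
  show "(\<lambda>\<alpha>. cmod (mfps_nth f \<alpha>) * r ^ mdeg \<alpha>) summable_on UNIV"
    using assms(1) by (simp add: mfps_summable_def)
  show "cmod (mfps_nth f \<alpha>) * r' ^ mdeg \<alpha> \<le> cmod (mfps_nth f \<alpha>) * r ^ mdeg \<alpha>" for \<alpha>
    by (rule mult_left_mono[OF power_mono]) (use assms in auto)
qed (use assms in auto)

text \<open>Without constant term every monomial contributes at least one factor
  \<open>c\<close>.\<close>

lemma mfps_norm_shrink:
  assumes "mfps_summable f r" "mfps_nth f 0 = 0" "0 \<le> r" "0 \<le> c" "c \<le> 1"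
  shows "mfps_norm f (c * r) \<le> c * mfps_norm f r"
proof -
  have "mfps_norm f (c * r) \<le> (\<Sum>\<^sub>\<infinity>\<alpha>. c * (cmod (mfps_nth f \<alpha>) * r ^ mdeg \<alpha>))"
    unfolding mfps_norm_def
  proof (rule infsum_mono)
    show "(\<lambda>\<alpha>. cmod (mfps_nth f \<alpha>) * (c * r) ^ mdeg \<alpha>) summable_on UNIV"
      using mfps_summable_mono[OF assms(1), of "c * r"] assms mult_left_le_one_le[of r c]
      by (simp add: mfps_summable_def)
    show "(\<lambda>\<alpha>. c * (cmod (mfps_nth f \<alpha>) * r ^ mdeg \<alpha>)) summable_on UNIV"
      using assms(1) by (intro summable_on_cmult_right) (simp add: mfps_summable_def)
    fix \<alpha>
    show "cmod (mfps_nth f \<alpha>) * (c * r) ^ mdeg \<alpha> \<le> c * (cmod (mfps_nth f \<alpha>) * r ^ mdeg \<alpha>)"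
    proof (cases "\<alpha> = 0")
      case False
      then have "1 \<le> mdeg \<alpha>" by (metis mdeg_eq_0_iff less_one not_le)
      then have "c ^ mdeg \<alpha> \<le> c ^ 1"
        by (rule power_decreasing) (use assms in auto)
      then have "c ^ mdeg \<alpha> * (cmod (mfps_nth f \<alpha>) * r ^ mdeg \<alpha>) \<le> c ^ 1 * (cmod (mfps_nth f \<alpha>) * r ^ mdeg \<alpha>)"
        by (rule mult_right_mono) (use assms in auto)
      then show ?thesis by (simp add: power_mult_distrib mult_ac)
    qed (simp add: assms)
  qed
  then show ?thesis
    by (simp add: infsum_cmult_right' mfps_norm_def)
qed

lemma has_mfps_expansionD:
  assumes "has_mfps_expansion F T"
  obtains r where "0 < r" "\<And>l. mfps_summable (T $ l) r"
    "\<And>z l. (\<And>k. cmod (z $ k) \<le> r) \<Longrightarrow> F z $ l = mfps_eval (T $ l) z"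
proof -
  obtain R where R: "R > 0" "\<And>z l. (\<And>k. cmod (z $ k) < R) \<Longrightarrow>
      ((\<lambda>\<alpha>. mfps_nth (T $ l) \<alpha> * mpow (\<lambda>k. z $ k) \<alpha>) has_sum F z $ l) UNIV"
    using assms unfolding has_mfps_expansion_def by blast
  define r where "r = R / 2"
  have r: "0 < r" "r < R" using R(1) by (auto simp: r_def)
  have "mfps_summable (T $ l) r" for l
  proof -
    \<comment> \<open>Convergence at the diagonal point with all coordinates \<open>r\<close>
      suffices, since unordered summability of complex families is absolute.\<close>
    have "(\<lambda>\<alpha>. mfps_nth (T $ l) \<alpha> * mpow (\<lambda>k. (\<chi> k. complex_of_real r) $ k) \<alpha>) summable_on UNIV"
      using R(2)[of "\<chi> k. complex_of_real r" l] r by (auto dest: has_sum_imp_summable)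
    then show ?thesis
      unfolding summable_on_iff_abs_summable_on_complex mfps_summable_def
      using r by (simp add: norm_mult mpow_const norm_power)
  qed
  moreover have "F z $ l = mfps_eval (T $ l) z" if "\<And>k. cmod (z $ k) \<le> r" for z l
    unfolding mfps_eval_def using R(2)[of z l] that r by (metis infsumI order_le_less_trans)
  ultimately show ?thesis using that r(1) by blast
qed

lemma mfps_coeff_le:
  assumes "mfps_summable f r" "0 < r"
  shows "cmod (mfps_nth f \<alpha>) \<le> mfps_norm f r * (1 / r) ^ mdeg \<alpha>"
proof -
  have "(\<Sum>\<alpha>\<in>{\<alpha>}. cmod (mfps_nth f \<alpha>) * r ^ mdeg \<alpha>) \<le> mfps_norm f r"
    unfolding mfps_norm_def
    by (rule finite_sum_le_infsum) (use assms in \<open>auto simp: mfps_summable_def\<close>)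
  then show ?thesis
    using assms(2) by (simp add: power_one_over field_simps)
qed

text \<open>The real derivative is required to be complex linear, so this is holomorphy in all
  variables jointly.\<close>

definition has_gradient :: "(complex ^ 'n \<Rightarrow> complex) \<Rightarrow> complex ^ 'n \<Rightarrow> complex ^ 'n::finite \<Rightarrow> bool"
  where "has_gradient f a z \<longleftrightarrow> (f has_derivative (\<lambda>h. \<Sum>k\<in>UNIV. a $ k * h $ k)) (at z)"

definition multi_holomorphic :: "(complex ^ 'n::finite \<Rightarrow> complex) \<Rightarrow> (complex ^ 'n) set \<Rightarrow> bool"
  where "multi_holomorphic f S \<longleftrightarrow> (\<forall>z\<in>S. \<exists>a. has_gradient f a z)"

lemma vec_eq_sum_axis: "v = (\<Sum>l\<in>UNIV. axis l (v $ l))" for v :: "complex ^ 'n::finite"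
  by (simp add: vec_eq_iff axis_def sum.delta)

lemma bounded_linear_axis: "bounded_linear (axis l :: complex \<Rightarrow> complex ^ 'n::finite)"
  by (rule linear_conv_bounded_linear[THEN iffD1], rule linearI) (auto simp: axis_def vec_eq_iff)

lemma has_derivative_vec_iff:
  fixes F :: "'a::real_normed_vector \<Rightarrow> complex ^ 'n::finite"
  shows "(F has_derivative F') (at z) \<longleftrightarrow> (\<forall>l. ((\<lambda>z. F z $ l) has_derivative (\<lambda>h. F' h $ l)) (at z))"
proof
  assume "(F has_derivative F') (at z)"
  then show "\<forall>l. ((\<lambda>z. F z $ l) has_derivative (\<lambda>h. F' h $ l)) (at z)"
    by (auto intro: bounded_linear.has_derivative[OF bounded_linear_vec_nth])
next
  assume "\<forall>l. ((\<lambda>z. F z $ l) has_derivative (\<lambda>h. F' h $ l)) (at z)"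
  then have "((\<lambda>z. \<Sum>l\<in>UNIV. axis l (F z $ l)) has_derivative (\<lambda>h. \<Sum>l\<in>UNIV. axis l (F' h $ l))) (at z)"
    by (intro has_derivative_sum bounded_linear.has_derivative[OF bounded_linear_axis]) auto
  then show "(F has_derivative F') (at z)"
    by (simp flip: vec_eq_sum_axis)
qed

lemma has_derivative_matrix_iff:
  fixes F :: "complex ^ 'n \<Rightarrow> complex ^ 'n::finite"
  shows "(F has_derivative (\<lambda>h. A *v h)) (at z) \<longleftrightarrow> (\<forall>l. has_gradient (\<lambda>z. F z $ l) (A $ l) z)"
  unfolding has_derivative_vec_iff has_gradient_def by (simp add: matrix_vector_mult_def)

lemma norm_le_sum_cmod: "norm v \<le> (\<Sum>k\<in>UNIV. cmod (v $ k))" for v :: "complex ^ 'n::finite"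
  unfolding norm_vec_def by (rule L2_set_le_sum) auto

lemma cmod_nth_le: "cmod (v $ k) \<le> norm v" for v :: "complex ^ 'n::finite"
  by (rule Finite_Cartesian_Product.norm_nth_le)

lemma mpow_diff_munit:
  assumes "\<alpha> k \<noteq> 0"
  shows "mpow x (\<alpha> - munit k) = x k ^ (\<alpha> k - 1) * (\<Prod>j\<in>UNIV - {k}. x j ^ \<alpha> j)"
proof -
  have "mpow x (\<alpha> - munit k) = x k ^ ((\<alpha> - munit k) k) * (\<Prod>j\<in>UNIV - {k}. x j ^ ((\<alpha> - munit k) j))"
    unfolding mpow_def by (rule prod.remove) auto
  also have "(\<Prod>j\<in>UNIV - {k}. x j ^ ((\<alpha> - munit k) j)) = (\<Prod>j\<in>UNIV - {k}. x j ^ \<alpha> j)"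
    by (intro prod.cong) (auto simp: fun_diff_def munit_def)
  finally show ?thesis by (simp add: fun_diff_def munit_def)
qed

lemma mpow_zero_diff_munit:
  "of_nat (\<alpha> k) * mpow (\<lambda>_. 0 :: complex) (\<alpha> - munit k) = of_bool (\<alpha> = munit k)"
proof (cases "\<alpha> k = 0")
  case True
  then show ?thesis by (auto simp: munit_def)
next
  case False
  then have k: "munit k \<le> \<alpha>" by (auto simp: le_fun_def munit_def)
  show ?thesis
  proof (cases "\<alpha> = munit k")
    case True
    then show ?thesis by (simp add: munit_def mpow_const)
  next
    case ne: False
    then have "\<alpha> - munit k \<noteq> 0"
      using multiindex_diff_add[OF k] by auto
    then have "mdeg (\<alpha> - munit k) \<noteq> 0" by simp
    then show ?thesis
      using ne by (simp add: mpow_const del: mdeg_eq_0_iff)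
  qed
qed

lemma has_gradient_mpow:
  "has_gradient (\<lambda>z. mpow (\<lambda>k. z $ k) \<alpha>) (\<chi> k. of_nat (\<alpha> k) * mpow (\<lambda>k. z $ k) (\<alpha> - munit k)) z"
proof -
  have pw: "((\<lambda>z. (z $ k) ^ \<alpha> k) has_derivative (\<lambda>h. of_nat (\<alpha> k) * h $ k * z $ k ^ (\<alpha> k - 1))) (at z)" for k
    by (auto intro!: derivative_eq_intros bounded_linear.has_derivative[OF bounded_linear_vec_nth])
  have "((\<lambda>z. mpow (\<lambda>k. z $ k) \<alpha>) has_derivative
      (\<lambda>h. \<Sum>k\<in>UNIV. of_nat (\<alpha> k) * h $ k * z $ k ^ (\<alpha> k - 1) * (\<Prod>j\<in>UNIV - {k}. z $ j ^ \<alpha> j))) (at z)"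
    unfolding mpow_def by (rule has_derivative_prod) (rule pw)
  moreover have "of_nat (\<alpha> k) * h $ k * z $ k ^ (\<alpha> k - 1) * (\<Prod>j\<in>UNIV - {k}. z $ j ^ \<alpha> j) =
      (of_nat (\<alpha> k) * mpow (\<lambda>k. z $ k) (\<alpha> - munit k)) * h $ k" for h k
    using mpow_diff_munit[of \<alpha> k "\<lambda>k. z $ k"] by (cases "\<alpha> k = 0") auto
  ultimately show ?thesis
    by (simp only: has_gradient_def vec_lambda_beta)
qed

lemma has_gradient_cmult:
  assumes "has_gradient f a z"
  shows "has_gradient (\<lambda>z. c * f z) (\<chi> k. c * a $ k) z"
  using has_derivative_mult_right[OF assms[unfolded has_gradient_def], of c]
  by (simp add: has_gradient_def sum_distrib_left mult.assoc)

lemma has_gradient_sum: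
  assumes "\<And>i. i \<in> I \<Longrightarrow> has_gradient (f i) (a i) z"
  shows "has_gradient (\<lambda>z. \<Sum>i\<in>I. f i z) (\<Sum>i\<in>I. a i) z"
proof -
  have "((\<lambda>z. \<Sum>i\<in>I. f i z) has_derivative (\<lambda>h. \<Sum>i\<in>I. \<Sum>k\<in>UNIV. a i $ k * h $ k)) (at z)"
    using assms by (intro has_derivative_sum) (auto simp: has_gradient_def)
  moreover have "(\<Sum>i\<in>I. \<Sum>k\<in>UNIV. a i $ k * h $ k) = (\<Sum>k\<in>UNIV. (\<Sum>i\<in>I. a i) $ k * h $ k)" for h
    by (subst sum.swap) (simp add: sum_distrib_right)
  ultimately show ?thesis by (simp add: has_gradient_def)
qed

lemma sums_by_degree:
  fixes g :: "('n::finite \<Rightarrow> nat) \<Rightarrow> 'c::banach"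
  assumes "(g has_sum s) UNIV"
  shows "(\<lambda>n. \<Sum>\<alpha> | mdeg \<alpha> = n. g \<alpha>) sums s"
proof -
  have fin: "finite {\<alpha> :: 'n \<Rightarrow> nat. mdeg \<alpha> = n}" for n
    by (rule finite_subset[OF _ finite_mdeg_le[of n]]) auto
  have "((\<lambda>(n, \<alpha>). g \<alpha>) has_sum s) (SIGMA n:UNIV. {\<alpha>. mdeg \<alpha> = n}) \<longleftrightarrow> (g has_sum s) UNIV"
    by (rule has_sum_reindex_bij_witness[where j = snd and i = "\<lambda>\<alpha>. (mdeg \<alpha>, \<alpha>)"]) auto
  with assms have "((\<lambda>(n, \<alpha>). g \<alpha>) has_sum s) (SIGMA n:UNIV. {\<alpha>. mdeg \<alpha> = n})" by simp
  then have "((\<lambda>n. \<Sum>\<alpha> | mdeg \<alpha> = n. g \<alpha>) has_sum s) UNIV"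
    by (rule has_sum_SigmaD) (simp add: has_sum_finite[OF fin])
  then show ?thesis by (rule has_sum_imp_sums)
qed

text \<open>The series is grouped into homogeneous polynomials and differentiated term by term.
  Halving the radius absorbs the exponent produced by differentiation, because
  \<open>Suc m / 2 ^ m\<close> is at most 2, and the Weierstrass test applies to the
  gradients.\<close>

lemma mfps_eval_has_gradient:
  fixes f :: "'n::finite mfps"
  assumes f: "mfps_summable f r" and r: "0 < r" and z: "\<And>k. cmod (z $ k) < r / 2"
  shows "\<exists>a. has_gradient (mfps_eval f) a z \<and> (z = 0 \<longrightarrow> (\<forall>k. a $ k = mfps_nth f (munit k)))"
proof -
  define S where "S = {z :: complex ^ 'n. \<forall>k. cmod (z $ k) < r / 2}"
  have S: "open S" "convex S"
  proof -
    have eq: "S = (\<Inter>k. (\<lambda>z. z $ k) -` ball 0 (r / 2))"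
      by (auto simp: S_def)
    show "open S"
      unfolding eq by (intro open_INT continuous_open_vimage) (auto intro!: continuous_intros)
    show "convex S"
      unfolding eq by (intro convex_INT ballI convex_linear_vimage) (auto intro: bounded_linear.linear bounded_linear_vec_nth)
  qed
  have fin: "finite {\<alpha> :: 'n \<Rightarrow> nat. mdeg \<alpha> = n}" for n
    by (rule finite_subset[OF _ finite_mdeg_le[of n]]) auto
  define P where "P n z = (\<Sum>\<alpha> | mdeg \<alpha> = n. mfps_nth f \<alpha> * mpow (\<lambda>k. z $ k) \<alpha>)" for n and z :: "complex ^ 'n"
  define D where "D n z = (\<Sum>\<alpha> | mdeg \<alpha> = n. \<chi> k. mfps_nth f \<alpha> * (\<chi> k. of_nat (\<alpha> k) * mpow (\<lambda>k. z $ k) (\<alpha> - munit k)) $ k)"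
    for n and z :: "complex ^ 'n"
  have P: "has_gradient (P n) (D n z) z" for n z
    unfolding P_def D_def by (intro has_gradient_sum has_gradient_cmult has_gradient_mpow)
  define M where "M n = real CARD('n) * (2 / r) * (\<Sum>\<alpha> :: 'n \<Rightarrow> nat | mdeg \<alpha> = n. cmod (mfps_nth f \<alpha>) * r ^ mdeg \<alpha>)" for n
  have "(\<lambda>n. \<Sum>\<alpha> :: 'n \<Rightarrow> nat | mdeg \<alpha> = n. cmod (mfps_nth f \<alpha>) * r ^ mdeg \<alpha>) sums mfps_norm f r"
    using f unfolding mfps_norm_def mfps_summable_def by (intro sums_by_degree) simp
  then have summable: "summable M"
    unfolding M_def by (intro summable_mult) (rule sums_summable)
  have mono: "cmod (of_nat (\<alpha> k) * mpow (\<lambda>k. z $ k) (\<alpha> - munit k)) \<le> 2 / r * r ^ mdeg \<alpha>"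
    if "z \<in> S" for \<alpha> k z
  proof (cases "\<alpha> k = 0")
    case True
    then show ?thesis using r by simp
  next
    case False
    then have k: "munit k \<le> \<alpha>" by (auto simp: le_fun_def munit_def)
    define m where "m = mdeg (\<alpha> - munit k)"
    have m: "mdeg \<alpha> = Suc m"
      using multiindex_diff_add[OF k] unfolding m_def by (metis Suc_eq_plus1 mdeg_add mdeg_munit)
    have "cmod (of_nat (\<alpha> k) * mpow (\<lambda>k. z $ k) (\<alpha> - munit k)) \<le> real (Suc m) * (r / 2) ^ m"
      unfolding norm_mult norm_of_nat m_def
    proof (rule mult_mono)
      show "real (\<alpha> k) \<le> real (Suc (mdeg (\<alpha> - munit k)))"
        using le_mdeg[of \<alpha> k] m by (simp add: m_def)
      show "cmod (mpow (\<lambda>k. z $ k) (\<alpha> - munit k)) \<le> (r / 2) ^ mdeg (\<alpha> - munit k)"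
        using that by (intro cmod_mpow_le) (auto simp: S_def less_imp_le)
    qed (use r in auto)
    also have "\<dots> = real (Suc m) / 2 ^ m * r ^ m"
      by (simp add: power_divide)
    also have "\<dots> \<le> 2 * r ^ m"
    proof (rule mult_right_mono)
      have "Suc m < 2 ^ Suc m" by (rule less_exp)
      then have "real (Suc m) < 2 ^ Suc m" by (metis of_nat_less_iff of_nat_numeral of_nat_power)
      then show "real (Suc m) / 2 ^ m \<le> 2" by (simp add: field_simps)
    qed (use r in auto)
    also have "\<dots> = 2 / r * r ^ mdeg \<alpha>"
      using r by (simp add: m)
    finally show ?thesis .
  qed
  have D_le: "norm (D n z) \<le> M n" if "z \<in> S" for n z
  proof -
    have "cmod (D n z $ k) \<le> 2 / r * (\<Sum>\<alpha> :: 'n \<Rightarrow> nat | mdeg \<alpha> = n. cmod (mfps_nth f \<alpha>) * r ^ mdeg \<alpha>)" for k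
    proof -
      have "cmod (D n z $ k) \<le> (\<Sum>\<alpha> | mdeg \<alpha> = n. cmod (mfps_nth f \<alpha> * (of_nat (\<alpha> k) * mpow (\<lambda>k. z $ k) (\<alpha> - munit k))))"
        unfolding D_def sum_component vec_lambda_beta by (rule norm_sum)
      also have "\<dots> \<le> (\<Sum>\<alpha> | mdeg \<alpha> = n. cmod (mfps_nth f \<alpha>) * (2 / r * r ^ mdeg \<alpha>))"
        unfolding norm_mult[of "mfps_nth f _"] by (rule sum_mono, rule mult_left_mono[OF mono[OF that]]) simp
      finally show ?thesis
        by (simp add: sum_distrib_left mult_ac)
    qed
    then have "(\<Sum>k\<in>UNIV. cmod (D n z $ k)) \<le> (\<Sum>k\<in>(UNIV :: 'n set). 2 / r * (\<Sum>\<alpha> :: 'n \<Rightarrow> nat | mdeg \<alpha> = n. cmod (mfps_nth f \<alpha>) * r ^ mdeg \<alpha>))"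
      by (rule sum_mono)
    then show ?thesis
      using norm_le_sum_cmod[of "D n z"] by (simp add: M_def mult.assoc)
  qed
  have unif: "uniform_limit S (\<lambda>n z. \<Sum>i<n. D i z) (\<lambda>z. \<Sum>i. D i z) sequentially"
    using D_le summable by (rule Weierstrass_m_test)
  have z_in: "z \<in> S" using z by (simp add: S_def)
  have sums: "(\<lambda>n. P n w) sums mfps_eval f w" if "w \<in> S" for w
    unfolding P_def
  proof (intro sums_by_degree mfps_eval_has_sum[OF f])
    fix k
    have "cmod (w $ k) < r / 2" using that by (auto simp: S_def)
    then show "cmod (w $ k) \<le> r" using r by linarith
  qed
  have "\<exists>g. \<forall>w\<in>S. (\<lambda>n. P n w) sums g w \<and>
      (g has_derivative (\<lambda>h. \<Sum>k\<in>UNIV. (\<Sum>i. D i w) $ k * h $ k)) (at w within S)"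
  proof (rule has_derivative_series[where f = P and f' = "\<lambda>n w h. \<Sum>k\<in>UNIV. D n w $ k * h $ k"
        and S = S and x = z and l = "mfps_eval f z", OF S(2) _ _ z_in sums[OF z_in]])
    show "(P n has_derivative (\<lambda>h. \<Sum>k\<in>UNIV. D n w $ k * h $ k)) (at w within S)" for n w
      using P[of n w] unfolding has_gradient_def by (rule has_derivative_at_withinI)
    fix e :: real assume "e > 0"
    \<comment> \<open>The error is a sum of one term per coordinate, each bounded through the norm
      of the gradient error.\<close>
    define e' where "e' = e / real CARD('n)"
    have "e' > 0" using \<open>e > 0\<close> by (simp add: e'_def)
    then have "\<forall>\<^sub>F n in sequentially. \<forall>w\<in>S. dist (\<Sum>i<n. D i w) (\<Sum>i. D i w) < e'"
      using unif by (auto simp: uniform_limit_iff)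
    then show "\<forall>\<^sub>F n in sequentially. \<forall>w\<in>S. \<forall>h.
        norm ((\<Sum>i<n. \<Sum>k\<in>UNIV. D i w $ k * h $ k) - (\<Sum>k\<in>UNIV. (\<Sum>i. D i w) $ k * h $ k)) \<le> e * norm h"
    proof eventually_elim
      case (elim n)
      show ?case
      proof (intro ballI allI)
        fix w h assume "w \<in> S"
        let ?v = "(\<Sum>i<n. D i w) - (\<Sum>i. D i w)"
        have "(\<Sum>i<n. \<Sum>k\<in>UNIV. D i w $ k * h $ k) - (\<Sum>k\<in>UNIV. (\<Sum>i. D i w) $ k * h $ k) = (\<Sum>k\<in>UNIV. ?v $ k * h $ k)"
          by (subst sum.swap) (simp add: sum_distrib_right sum_subtractf left_diff_distrib)
        also have "cmod \<dots> \<le> (\<Sum>k\<in>(UNIV :: 'n set). e' * norm h)"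
        proof (rule sum_norm_le)
          fix k
          have "cmod (?v $ k) \<le> e'"
            using elim \<open>w \<in> S\<close> cmod_nth_le[of ?v k] by (force simp: dist_norm)
          then show "cmod (?v $ k * h $ k) \<le> e' * norm h"
            unfolding norm_mult using \<open>e' > 0\<close> cmod_nth_le by (intro mult_mono) auto
        qed
        also have "\<dots> = e * norm h" by (simp add: e'_def)
        finally show "norm ((\<Sum>i<n. \<Sum>k\<in>UNIV. D i w $ k * h $ k) - (\<Sum>k\<in>UNIV. (\<Sum>i. D i w) $ k * h $ k)) \<le> e * norm h" .
      qed
    qed
  qed
  then obtain g where g: "\<forall>w\<in>S. (\<lambda>n. P n w) sums g w \<and>
      (g has_derivative (\<lambda>h. \<Sum>k\<in>UNIV. (\<Sum>i. D i w) $ k * h $ k)) (at w within S)"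
    by (elim exE)
  have "(g has_derivative (\<lambda>h. \<Sum>k\<in>UNIV. (\<Sum>i. D i z) $ k * h $ k)) (at z)"
    using bspec[OF g z_in] unfolding at_within_open[OF z_in S(1)] by (rule conjunct2)
  then have "(mfps_eval f has_derivative (\<lambda>h. \<Sum>k\<in>UNIV. (\<Sum>i. D i z) $ k * h $ k)) (at z)"
  proof (rule has_derivative_transform_within_open[OF _ S(1) z_in])
    fix w assume "w \<in> S"
    then show "g w = mfps_eval f w"
      using bspec[OF g] sums sums_unique2[of "\<lambda>n. P n w"] by metis
  qed
  then have "has_gradient (mfps_eval f) (\<Sum>i. D i z) z"
    by (simp add: has_gradient_def)
  moreover have "(\<Sum>i. D i z) $ k = mfps_nth f (munit k)" if "z = 0" for k
  proof -
    have D0: "D i z $ k = (if i = 1 then mfps_nth f (munit k) else 0)" for i k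
    proof -
      have "mfps_nth f \<alpha> * (of_nat (\<alpha> k) * mpow (\<lambda>k. z $ k) (\<alpha> - munit k)) =
          (if \<alpha> = munit k then mfps_nth f (munit k) else 0)" for \<alpha>
        using mpow_zero_diff_munit[of \<alpha> k] by (simp add: that)
      then have "D i z $ k = (\<Sum>\<alpha> | mdeg \<alpha> = i. if \<alpha> = munit k then mfps_nth f (munit k) else 0)"
        by (simp add: D_def)
      then show ?thesis
        by (auto simp: sum.delta[OF fin])
    qed
    have "(\<Sum>i. D i z) = (\<Sum>i\<in>{1}. D i z)"
      by (rule suminf_finite) (auto simp: vec_eq_iff D0)
    then show ?thesis by (simp add: D0)
  qed
  ultimately show ?thesis by blast
qed

section \<open>Holomorphic functions of several variables\<close>

definition partial_deriv :: "'n \<Rightarrow> (complex ^ 'n::finite \<Rightarrow> complex) \<Rightarrow> complex ^ 'n \<Rightarrow> complex"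
  where "partial_deriv k f z = deriv (\<lambda>w. f (z + axis k w)) 0"

lemma has_gradient_slice:
  assumes "has_gradient f a (z + axis k w)"
  shows "((\<lambda>w. f (z + axis k w)) has_field_derivative a $ k) (at w)"
proof -
  have "((\<lambda>w. z + axis k w) has_derivative (\<lambda>w. axis k w)) (at w)"
    by (auto intro!: derivative_eq_intros bounded_linear_imp_has_derivative bounded_linear_axis)
  from has_derivative_compose[OF this assms[unfolded has_gradient_def]]
  have "((\<lambda>w. f (z + axis k w)) has_derivative (\<lambda>w. \<Sum>j\<in>UNIV. a $ j * axis k w $ j)) (at w)" .
  moreover have "(\<Sum>j\<in>UNIV. a $ j * axis k w $ j) = a $ k * w" for w
  proof -
    have "(\<Sum>j\<in>UNIV. a $ j * axis k w $ j) = (\<Sum>j\<in>UNIV. if j = k then a $ k * w else 0)"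
      by (intro sum.cong) (auto simp: axis_def)
    then show ?thesis by simp
  qed
  ultimately show ?thesis
    by (simp add: has_field_derivative_def)
qed

lemma axis_0 [simp]: "axis k (0::complex) = 0"
  by (simp add: axis_def vec_eq_iff)

lemma partial_deriv_eq: "has_gradient f a z \<Longrightarrow> partial_deriv k f z = a $ k"
  unfolding partial_deriv_def
  by (rule DERIV_imp_deriv, rule has_gradient_slice) simp

lemma multi_holomorphic_gradient:
  assumes "multi_holomorphic f S" "z \<in> S"
  shows "has_gradient f (\<chi> k. partial_deriv k f z) z"
proof -
  obtain a where a: "has_gradient f a z"
    using assms by (auto simp: multi_holomorphic_def)
  then have "(\<chi> k. partial_deriv k f z) = a"
    by (simp add: vec_eq_iff partial_deriv_eq)
  with a show ?thesis by simp
qed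

lemma multi_holomorphic_continuous_on:
  assumes "multi_holomorphic f S"
  shows "continuous_on S f"
  using assms unfolding multi_holomorphic_def has_gradient_def
  by (meson continuous_at_imp_continuous_on has_derivative_continuous)

lemma norm_axis [simp]: "norm (axis k w :: complex ^ 'n::finite) = cmod w"
proof -
  have "(cmod ((axis k w :: complex ^ 'n) $ i))\<^sup>2 = (if i = k then (cmod w)\<^sup>2 else 0)" for i
    by (auto simp: axis_def)
  then show ?thesis
    by (simp add: norm_vec_def L2_set_def)
qed

definition circ :: "real \<Rightarrow> real \<Rightarrow> complex"
  where "circ \<rho> t = of_real \<rho> * exp (2 * of_real pi * \<i> * of_real t)"

lemma continuous_on_circ [continuous_intros]:
  "continuous_on S g \<Longrightarrow> continuous_on S (\<lambda>x. circ \<rho> (g x))"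
  unfolding circ_def by (intro continuous_intros)

lemma cmod_circ: "0 \<le> \<rho> \<Longrightarrow> cmod (circ \<rho> t) = \<rho>"
  by (simp add: circ_def norm_mult)

lemma circ_neq_0: "0 < \<rho> \<Longrightarrow> circ \<rho> t \<noteq> 0"
  by (simp add: circ_def)

text \<open>Cauchy's formula in a single variable; differentiating under the integral sign then shows that
  partial derivatives are again holomorphic in all variables.\<close>

lemma partial_deriv_integral:
  assumes f: "multi_holomorphic f S" and \<rho>: "0 < \<rho>"
    and sub: "\<And>w. cmod w \<le> \<rho> \<Longrightarrow> z + axis k w \<in> S"
  shows "partial_deriv k f z = integral (cbox 0 1) (\<lambda>t. f (z + axis k (circ \<rho> t)) / circ \<rho> t)"
proof -
  let ?g = "\<lambda>w. f (z + axis k w)"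
  have der: "\<exists>d. (?g has_field_derivative d) (at w)" if "cmod w \<le> \<rho>" for w
    using has_gradient_slice f sub[OF that] unfolding multi_holomorphic_def by blast
  have "continuous_on (cball 0 \<rho>) ?g"
    using der DERIV_isCont by (fastforce intro!: continuous_at_imp_continuous_on)
  moreover have "?g holomorphic_on ball 0 \<rho>"
    using der by (auto simp: holomorphic_on_open intro: less_imp_le)
  ultimately have "(?g has_field_derivative (1 / (2 * of_real pi * \<i>) *
      contour_integral (circlepath 0 \<rho>) (\<lambda>u. ?g u / (u - 0)\<^sup>2))) (at 0)"
    using \<rho> by (intro Cauchy_derivative_integral_circlepath) auto
  then have "partial_deriv k f z = 1 / (2 * of_real pi * \<i>) * contour_integral (circlepath 0 \<rho>) (\<lambda>u. ?g u / (u - 0)\<^sup>2)"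
    unfolding partial_deriv_def by (rule DERIV_imp_deriv)
  also have "\<dots> = 1 / (2 * of_real pi * \<i>) * integral {0..1} (\<lambda>t. (2 * of_real pi * \<i>) * (?g (circ \<rho> t) / circ \<rho> t))"
    unfolding contour_integral_integral
  proof (rule arg_cong[where f = "\<lambda>x. _ * x"], rule integral_cong)
    fix t :: real
    have "circlepath 0 \<rho> t = circ \<rho> t"
      by (simp add: circlepath circ_def)
    moreover have "vector_derivative (circlepath 0 \<rho>) (at t) = 2 * of_real pi * \<i> * circ \<rho> t"
      by (simp add: vector_derivative_circlepath circ_def)
    ultimately show "?g (circlepath 0 \<rho> t) / (circlepath 0 \<rho> t - 0)\<^sup>2 * vector_derivative (circlepath 0 \<rho>) (at t)
        = (2 * of_real pi * \<i>) * (?g (circ \<rho> t) / circ \<rho> t)"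
      using circ_neq_0[OF \<rho>, of t] by (simp add: power2_eq_square)
  qed
  also have "\<dots> = integral {0..1} (\<lambda>t. ?g (circ \<rho> t) / circ \<rho> t)"
    unfolding integral_mult_right by simp
  finally show ?thesis by simp
qed

lemma polydisc_axis_margin:
  assumes "open S" "(z0 :: complex ^ 'n::finite) \<in> S"
  obtains \<rho> where "0 < \<rho>" "\<And>z k w. z \<in> ball z0 \<rho> \<Longrightarrow> cmod w \<le> \<rho> \<Longrightarrow> z + axis k w \<in> S"
proof -
  obtain e where e: "e > 0" "ball z0 e \<subseteq> S"
    using assms open_contains_ball by blast
  have "z + axis k w \<in> S" if "z \<in> ball z0 (e / 2)" "cmod w \<le> e / 2" for z k w
  proof -
    have "dist z0 (z + axis k w) \<le> dist z0 z + dist z (z + axis k w)"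
      by (rule dist_triangle)
    also have "\<dots> < e"
      using that by (simp add: dist_norm)
    finally show ?thesis using e by auto
  qed
  then show ?thesis using that[of "e / 2"] e by auto
qed

lemma continuous_on_shift_circ:
  assumes "continuous_on S f" "0 < \<rho>"
    and sub: "\<And>z w. z \<in> U \<Longrightarrow> cmod w \<le> \<rho> \<Longrightarrow> z + axis k w \<in> S"
  shows "continuous_on (U \<times> T) (\<lambda>(z, t). f (z + axis k (circ \<rho> t)) / circ \<rho> t)"
proof -
  have "continuous_on (U \<times> T) (\<lambda>x. f (fst x + axis k (circ \<rho> (snd x))) / circ \<rho> (snd x))"
    using circ_neq_0[OF assms(2)] sub cmod_circ[of \<rho>] assms(2)
    by (intro continuous_on_divide continuous_on_compose2[OF assms(1)] continuous_intros
        bounded_linear.continuous_on[OF bounded_linear_axis]) auto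
  then show ?thesis by (simp add: case_prod_beta)
qed

lemma continuous_on_Pair_slice:
  assumes "continuous_on (U \<times> T) (\<lambda>(z, t). g z t)" "z \<in> U"
  shows "continuous_on T (g z)"
proof -
  have "continuous_on T (\<lambda>t. (z, t))"
    by (intro continuous_intros)
  then show ?thesis
    using continuous_on_compose2[OF assms(1), of T "\<lambda>t. (z, t)"] assms(2) by auto
qed

lemma partial_deriv_continuous_on:
  assumes f: "multi_holomorphic f S" and S: "open S"
  shows "continuous_on S (partial_deriv k f)"
proof (rule continuous_at_imp_continuous_on, rule ballI)
  fix z0 assume "z0 \<in> S"
  then obtain \<rho> where \<rho>: "0 < \<rho>" "\<And>z k w. z \<in> ball z0 \<rho> \<Longrightarrow> cmod w \<le> \<rho> \<Longrightarrow> z + axis k w \<in> S"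
    using polydisc_axis_margin[OF S] by metis
  have "continuous_on (ball z0 \<rho>) (\<lambda>z. integral (cbox 0 1) (\<lambda>t. f (z + axis k (circ \<rho> t)) / circ \<rho> t))"
    by (rule integral_continuous_on_param,
        rule continuous_on_shift_circ[OF multi_holomorphic_continuous_on[OF f] \<rho>(1)]) (rule \<rho>(2))
  then have "continuous_on (ball z0 \<rho>) (partial_deriv k f)"
    by (rule continuous_on_eq) (simp add: partial_deriv_integral[OF f \<rho>(1) \<rho>(2)])
  then show "isCont (partial_deriv k f) z0"
    using \<rho>(1) by (simp add: continuous_on_eq_continuous_at)
qed

text \<open>The Leibniz rule for parameter integrals expects the derivative as a bounded linear
  function.\<close>

definition gradient_blinfun :: "complex ^ 'n \<Rightarrow> (complex ^ 'n::finite) \<Rightarrow>\<^sub>L complex"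
  where "gradient_blinfun a = Blinfun (\<lambda>h. \<Sum>k\<in>UNIV. a $ k * h $ k)"

lemma gradient_blinfun_apply: "blinfun_apply (gradient_blinfun a) h = (\<Sum>k\<in>UNIV. a $ k * h $ k)"
proof -
  have "bounded_linear (\<lambda>h. \<Sum>k\<in>UNIV. a $ k * h $ k)"
    by (intro bounded_linear_sum bounded_linear_mult_right[THEN bounded_linear_compose] bounded_linear_vec_nth)
  then show ?thesis
    by (simp add: gradient_blinfun_def bounded_linear_Blinfun_apply)
qed

text \<open>In Cauchy's formula the variable \<open>z\<close> enters only through \<open>f\<close>,
  whose gradient is continuous, so the integral can be differentiated in \<open>z\<close>.
  Integrating a complex linear map in \<open>t\<close> keeps it complex linear.\<close>

lemma multi_holomorphic_partial_deriv:
  fixes f :: "complex ^ 'n::finite \<Rightarrow> complex"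
  assumes f: "multi_holomorphic f S" and S: "open S"
  shows "multi_holomorphic (partial_deriv k f) S"
  unfolding multi_holomorphic_def
proof
  fix z0 assume "z0 \<in> S"
  then obtain \<rho> where \<rho>: "0 < \<rho>" "\<And>z k w. z \<in> ball z0 \<rho> \<Longrightarrow> cmod w \<le> \<rho> \<Longrightarrow> z + axis k w \<in> S"
    using polydisc_axis_margin[OF S] by metis
  define U where "U = ball z0 \<rho>"
  have z0: "z0 \<in> U" and U: "open U" "convex U" using \<rho>(1) by (auto simp: U_def)
  define b where "b j z t = partial_deriv j f (z + axis k (circ \<rho> t)) / circ \<rho> t" for j z t
  have b: "continuous_on (U \<times> cbox 0 1) (\<lambda>(z, t). b j z t)" for j
    unfolding b_def
    by (rule continuous_on_shift_circ[OF partial_deriv_continuous_on[OF f S] \<rho>(1)]) (auto simp: U_def intro: \<rho>(2))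
  define B where "B z t = gradient_blinfun (\<chi> j. b j z t)" for z t
  have contB: "continuous_on (U \<times> cbox 0 1) (\<lambda>(z, t). B z t)"
  proof (rule continuous_on_blinfun_componentwise)
    fix i :: "complex ^ 'n"
    show "continuous_on (U \<times> cbox 0 1) (\<lambda>x. blinfun_apply (case x of (z, t) \<Rightarrow> B z t) i)"
      using b unfolding B_def case_prod_beta gradient_blinfun_apply vec_lambda_beta
      by (intro continuous_intros)
  qed
  have "((\<lambda>z. integral (cbox 0 1) (\<lambda>t. f (z + axis k (circ \<rho> t)) / circ \<rho> t))
      has_derivative integral (cbox 0 1) (B z0)) (at z0 within U)"
  proof (rule leibniz_rule[OF _ _ contB z0 U(2)])
    fix z t assume "z \<in> U"
    then have in_S: "z + axis k (circ \<rho> t) \<in> S"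
      using \<rho> by (auto simp: U_def cmod_circ)
    have "((\<lambda>z. z + axis k (circ \<rho> t)) has_derivative (\<lambda>h. h)) (at z)"
      by (auto intro!: derivative_eq_intros)
    from has_derivative_compose[OF this multi_holomorphic_gradient[OF f in_S, unfolded has_gradient_def]]
    have "((\<lambda>z. f (z + axis k (circ \<rho> t)) / circ \<rho> t) has_derivative
        (\<lambda>h. (\<Sum>j\<in>UNIV. (\<chi> j. partial_deriv j f (z + axis k (circ \<rho> t))) $ j * h $ j) / circ \<rho> t)) (at z)"
      by (rule bounded_linear.has_derivative[OF bounded_linear_divide])
    moreover have "(\<lambda>h. (\<Sum>j\<in>UNIV. (\<chi> j. partial_deriv j f (z + axis k (circ \<rho> t))) $ j * h $ j) / circ \<rho> t) =
        blinfun_apply (B z t)"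
      by (rule ext) (simp add: B_def gradient_blinfun_apply b_def sum_divide_distrib)
    ultimately show "((\<lambda>z. f (z + axis k (circ \<rho> t)) / circ \<rho> t) has_derivative blinfun_apply (B z t)) (at z within U)"
      by (simp only: has_derivative_at_withinI)
  next
    fix z assume "z \<in> U"
    have "continuous_on (U \<times> cbox 0 1) (\<lambda>(z, t). f (z + axis k (circ \<rho> t)) / circ \<rho> t)"
      by (rule continuous_on_shift_circ[OF multi_holomorphic_continuous_on[OF f] \<rho>(1)]) (auto simp: U_def intro: \<rho>(2))
    from continuous_on_Pair_slice[OF this \<open>z \<in> U\<close>]
    show "(\<lambda>t. f (z + axis k (circ \<rho> t)) / circ \<rho> t) integrable_on cbox 0 1"
      by (rule integrable_continuous)
  qed
  note der = this[unfolded at_within_open[OF z0 U(1)]]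
  have slice: "continuous_on (cbox 0 1) (B z0)" "continuous_on (cbox 0 1) (b j z0)" for j
    by (rule continuous_on_Pair_slice[OF contB z0], rule continuous_on_Pair_slice[OF b z0])
  have "blinfun_apply (integral (cbox 0 1) (B z0)) h = (\<Sum>j\<in>UNIV. (\<chi> j. integral (cbox 0 1) (b j z0)) $ j * h $ j)" for h
  proof -
    have "blinfun_apply (integral (cbox 0 1) (B z0)) h = integral (cbox 0 1) (\<lambda>t. blinfun_apply (B z0 t) h)"
      using integral_linear[OF integrable_continuous[OF slice(1)] blinfun.bounded_linear_left[of h]] by (simp add: o_def)
    also have "\<dots> = (\<Sum>j\<in>UNIV. integral (cbox 0 1) (\<lambda>t. b j z0 t * h $ j))"
      unfolding B_def gradient_blinfun_apply vec_lambda_beta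
      by (intro integral_sum integrable_continuous continuous_intros slice(2)) auto
    finally show ?thesis by simp
  qed
  then have eq: "blinfun_apply (integral (cbox 0 1) (B z0)) =
      (\<lambda>h. \<Sum>j\<in>UNIV. (\<chi> j. integral (cbox 0 1) (b j z0)) $ j * h $ j)" by (rule ext)
  have "has_gradient (\<lambda>z. integral (cbox 0 1) (\<lambda>t. f (z + axis k (circ \<rho> t)) / circ \<rho> t))
      (\<chi> j. integral (cbox 0 1) (b j z0)) z0"
    using der unfolding has_gradient_def eq .
  then have "has_gradient (partial_deriv k f) (\<chi> j. integral (cbox 0 1) (b j z0)) z0"
    unfolding has_gradient_def
    by (rule has_derivative_transform_within_open[OF _ U(1) z0])
       (use partial_deriv_integral[OF f \<rho>(1) \<rho>(2)] in \<open>auto simp: U_def\<close>)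
  then show "\<exists>a. has_gradient (partial_deriv k f) a z0" by blast
qed

text \<open>Lists in place of multi-indices avoid any appeal to the symmetry of mixed
  derivatives.\<close>

fun partial_derivs :: "'n list \<Rightarrow> (complex ^ 'n::finite \<Rightarrow> complex) \<Rightarrow> complex ^ 'n \<Rightarrow> complex"
  where "partial_derivs [] f = f"
  | "partial_derivs (k # ks) f = partial_deriv k (partial_derivs ks f)"

lemma multi_holomorphic_partial_derivs:
  "multi_holomorphic f S \<Longrightarrow> open S \<Longrightarrow> multi_holomorphic (partial_derivs ks f) S"
  by (induction ks) (auto intro: multi_holomorphic_partial_deriv)

lemma multi_holomorphic_line:
  assumes "multi_holomorphic f S" "t *s z \<in> S"
  shows "((\<lambda>t. f (t *s z)) has_field_derivative (\<Sum>k\<in>UNIV. z $ k * partial_deriv k f (t *s z))) (at t)"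
proof -
  have "((\<lambda>t. t *s z) has_derivative (\<lambda>t. t *s z)) (at t)"
    unfolding has_derivative_vec_iff by (auto intro!: derivative_eq_intros)
  from has_derivative_compose[OF this multi_holomorphic_gradient[OF assms, unfolded has_gradient_def]]
  have "((\<lambda>t. f (t *s z)) has_derivative (\<lambda>s. \<Sum>k\<in>UNIV. (\<chi> k. partial_deriv k f (t *s z)) $ k * (s *s z) $ k)) (at t)" .
  moreover have "(\<lambda>s. \<Sum>k\<in>UNIV. (\<chi> k. partial_deriv k f (t *s z)) $ k * (s *s z) $ k) =
      (*) (\<Sum>k\<in>UNIV. z $ k * partial_deriv k f (t *s z))"
    by (rule ext) (simp add: sum_distrib_left mult_ac)
  ultimately show ?thesis
    by (simp only: has_field_derivative_def)
qed

lemma sum_lists_Suc: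
  fixes h :: "'n::finite list \<Rightarrow> 'a::comm_monoid_add"
  shows "(\<Sum>ks | length ks = Suc m. h ks) = (\<Sum>ks | length ks = m. \<Sum>k\<in>UNIV. h (k # ks))"
proof -
  have "(\<Sum>ks | length ks = Suc m. h ks) = (\<Sum>(ks, k) \<in> {ks. length ks = m} \<times> UNIV. h (k # ks))"
    by (rule sum.reindex_bij_witness[where i = "\<lambda>(ks, k). k # ks" and j = "\<lambda>ks. (tl ks, hd ks)"])
       (auto simp: length_Suc_conv)
  also have "\<dots> = (\<Sum>ks | length ks = m. \<Sum>k\<in>UNIV. h (k # ks))"
    by (rule sum.cartesian_product[symmetric])
  finally show ?thesis .
qed

lemma norm_smult: "norm (c *s z) = cmod c * norm z" for z :: "complex ^ 'n::finite"
  by (simp add: norm_vec_def norm_mult L2_set_right_distrib)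

text \<open>On the complex line through \<open>z\<close> the function depends on one variable, and
  all its derivatives at 0 are combinations of iterated partial derivatives of \<open>f\<close> at
  0. The one-variable identity theorem finishes.\<close>

lemma multi_holomorphic_eq_0:
  fixes f :: "complex ^ 'n::finite \<Rightarrow> complex"
  assumes f: "multi_holomorphic f (ball 0 R)" and 0: "\<And>ks. partial_derivs ks f 0 = 0"
    and z: "z \<in> ball 0 R"
  shows "f z = 0"
proof (cases "z = 0")
  case True
  then show ?thesis using 0[of "[]"] by simp
next
  case False
  \<comment> \<open>The radius of the disc of parameters \<open>t\<close> that stay in the ball; it
    exceeds 1, so \<open>t = 1\<close>, the point \<open>z\<close> itself, is reached.\<close>
  define r where "r = R / norm z"
  have nz: "norm z > 0" using False by simp
  have r: "1 < r" using z nz by (simp add: r_def field_simps)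
  have in_ball: "t *s z \<in> ball 0 R" if "t \<in> ball 0 r" for t
    using that nz by (simp add: norm_smult r_def field_simps)
  define g where "g m t = (\<Sum>ks | length ks = m. prod_list (map (($) z) ks) * partial_derivs ks f (t *s z))" for m t
  have g: "(g m has_field_derivative g (Suc m) t) (at t)" if t: "t \<in> ball 0 r" for m t
  proof -
    have "(g m has_field_derivative (\<Sum>ks | length ks = m. prod_list (map (($) z) ks) *
        (\<Sum>k\<in>UNIV. z $ k * partial_deriv k (partial_derivs ks f) (t *s z)))) (at t)"
      unfolding g_def
      by (intro DERIV_sum DERIV_cmult multi_holomorphic_line[OF multi_holomorphic_partial_derivs[OF f open_ball] in_ball[OF t]])
    moreover have "g (Suc m) t = (\<Sum>ks | length ks = m. prod_list (map (($) z) ks) *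
        (\<Sum>k\<in>UNIV. z $ k * partial_deriv k (partial_derivs ks f) (t *s z)))"
      unfolding g_def sum_lists_Suc by (simp add: sum_distrib_left mult_ac)
    ultimately show ?thesis by simp
  qed
  have hol: "g 0 holomorphic_on ball 0 r"
    unfolding holomorphic_on_open[OF open_ball] using g by blast
  have deriv: "(deriv ^^ m) (g 0) t = g m t" if "t \<in> ball 0 r" for m t
    using that
  proof (induction m arbitrary: t)
    case (Suc m)
    have "\<forall>\<^sub>F s in nhds t. s \<in> ball 0 r"
      using Suc.prems by (intro eventually_nhds_in_open) auto
    then have "\<forall>\<^sub>F s in nhds t. (deriv ^^ m) (g 0) s = g m s"
      by eventually_elim (rule Suc.IH)
    then have "deriv ((deriv ^^ m) (g 0)) t = deriv (g m) t"
      by (rule deriv_cong_ev) simp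
    then show ?case
      using DERIV_imp_deriv[OF g[OF Suc.prems]] by simp
  qed simp
  have "g 0 1 = 0"
  proof (rule holomorphic_fun_eq_0_on_ball[OF hol])
    show "(1::complex) \<in> ball 0 r" using r by (simp add: dist_norm)
    fix m
    have "(deriv ^^ m) (g 0) 0 = g m 0"
      using r by (intro deriv) auto
    then show "(deriv ^^ m) (g 0) 0 = 0"
      by (simp add: g_def 0)
  qed
  then show ?thesis by (simp add: g_def)
qed

definition scale_coords :: "('n \<Rightarrow> complex) \<Rightarrow> complex ^ 'n \<Rightarrow> complex ^ 'n::finite"
  where "scale_coords c z = (\<chi> k. c k * z $ k)"

lemma scale_coords_nth [simp]: "scale_coords c z $ k = c k * z $ k"
  by (simp add: scale_coords_def)

lemma scale_coords_0 [simp]: "scale_coords c 0 = 0"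
  by (simp add: vec_eq_iff)

lemma has_derivative_scale_coords: "(scale_coords c has_derivative scale_coords c) (at z)"
  unfolding has_derivative_vec_iff scale_coords_nth
  by (auto intro!: derivative_eq_intros bounded_linear.has_derivative[OF bounded_linear_vec_nth])

lemma filterlim_scale_coords: "filterlim (scale_coords c) (nhds 0) (nhds 0)"
  using has_derivative_continuous[OF has_derivative_scale_coords[of c 0], unfolded isCont_def tendsto_at_iff_tendsto_nhds]
  unfolding scale_coords_0 .

text \<open>By the chain rule each differentiation in direction \<open>k\<close> multiplies the
  scaling factor by \<open>c k\<close>. Iterated and evaluated at 0, this forces a derivative to
  vanish unless its total factor is 1.\<close>

lemma partial_deriv_scale:
  assumes f: "multi_holomorphic f (ball 0 e)" and e: "0 < e"
    and scale: "\<forall>\<^sub>F z in nhds 0. C * f (scale_coords c z) = f z"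
  shows "\<forall>\<^sub>F z in nhds 0. (C * c k) * partial_deriv k f (scale_coords c z) = partial_deriv k f z"
proof -
  have "\<forall>\<^sub>F z in nhds (0 :: complex ^ 'a). z \<in> ball 0 e"
    using e by (intro eventually_nhds_in_open) auto
  moreover from this have "\<forall>\<^sub>F z in nhds 0. scale_coords c z \<in> ball 0 e"
    by (rule eventually_compose_filterlim[OF _ filterlim_scale_coords])
  ultimately have "\<forall>\<^sub>F z in nhds 0. C * f (scale_coords c z) = f z \<and> z \<in> ball 0 e \<and> scale_coords c z \<in> ball 0 e"
    using scale by eventually_elim simp
  then obtain V where V: "open V" "0 \<in> V"
    "\<And>z. z \<in> V \<Longrightarrow> C * f (scale_coords c z) = f z \<and> z \<in> ball 0 e \<and> scale_coords c z \<in> ball 0 e"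
    unfolding eventually_nhds by blast
  have "(C * c k) * partial_deriv k f (scale_coords c z) = partial_deriv k f z" if z: "z \<in> V" for z
  proof -
    from has_derivative_compose[OF has_derivative_scale_coords multi_holomorphic_gradient[OF f, unfolded has_gradient_def]]
    have "((\<lambda>z. f (scale_coords c z)) has_derivative
        (\<lambda>h. \<Sum>k\<in>UNIV. (\<chi> k. partial_deriv k f (scale_coords c z)) $ k * scale_coords c h $ k)) (at z)"
      using V(3)[OF z] by blast
    from has_derivative_mult_right[OF this, of C]
    have "((\<lambda>z. C * f (scale_coords c z)) has_derivative
        (\<lambda>h. \<Sum>k\<in>UNIV. (\<chi> k. C * c k * partial_deriv k f (scale_coords c z)) $ k * h $ k)) (at z)"
      by (simp add: sum_distrib_left mult_ac)
    then have "has_gradient f (\<chi> k. C * c k * partial_deriv k f (scale_coords c z)) z"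
      unfolding has_gradient_def
      by (rule has_derivative_transform_within_open[OF _ V(1) z]) (use V(3) in blast)
    then show ?thesis
      by (simp add: partial_deriv_eq)
  qed
  then show ?thesis
    unfolding eventually_nhds using V(1,2) by blast
qed

lemma partial_derivs_scale:
  assumes f: "multi_holomorphic f (ball 0 e)" and e: "0 < e"
    and scale: "\<forall>\<^sub>F z in nhds 0. \<nu> * f (scale_coords c z) = f z"
  shows "\<forall>\<^sub>F z in nhds 0. (\<nu> * prod_list (map c ks)) * partial_derivs ks f (scale_coords c z) = partial_derivs ks f z"
proof (induction ks)
  case Nil
  then show ?case using scale by simp
next
  case (Cons k ks)
  from partial_deriv_scale[OF multi_holomorphic_partial_derivs[OF f open_ball] e Cons, of k]
  show ?case by (simp add: mult_ac)
qed

lemma prod_list_eq_mpow: "\<exists>Q. mdeg Q = length ks \<and> (\<forall>c :: 'n::finite \<Rightarrow> complex. prod_list (map c ks) = mpow c Q)"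
proof (induction ks)
  case Nil
  show ?case by (intro exI[of _ 0]) simp
next
  case (Cons k ks)
  then obtain Q where "mdeg Q = length ks" "\<forall>c :: 'n \<Rightarrow> complex. prod_list (map c ks) = mpow c Q"
    by blast
  then show ?case
    by (intro exI[of _ "Q + munit k"]) (simp add: mpow_add)
qed

section \<open>Local inverses of holomorphic maps\<close>

lemma holomorphic_germ_iff:
  "holomorphic_germ F \<longleftrightarrow> (\<exists>e>0. \<forall>l. multi_holomorphic (\<lambda>z. F z $ l) (ball 0 e))"
proof
  assume "holomorphic_germ F"
  then obtain S where S: "open S" "0 \<in> S" "\<And>z. z \<in> S \<Longrightarrow> \<exists>A. (F has_derivative (\<lambda>h. A *v h)) (at z)"
    unfolding holomorphic_germ_def eventually_nhds by blast
  then obtain e where "e > 0" "ball 0 e \<subseteq> S"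
    using open_contains_ball by blast
  then show "\<exists>e>0. \<forall>l. multi_holomorphic (\<lambda>z. F z $ l) (ball 0 e)"
    using S(3) unfolding has_derivative_matrix_iff multi_holomorphic_def by blast
next
  assume "\<exists>e>0. \<forall>l. multi_holomorphic (\<lambda>z. F z $ l) (ball 0 e)"
  then obtain e where e: "e > 0" "\<And>l. multi_holomorphic (\<lambda>z. F z $ l) (ball 0 e)" by blast
  have "\<exists>A. (F has_derivative (\<lambda>h. A *v h)) (at z)" if "z \<in> ball 0 e" for z
    unfolding has_derivative_matrix_iff
    using multi_holomorphic_gradient[OF e(2) that]
    by (intro exI[of _ "\<chi> l. \<chi> k. partial_deriv k (\<lambda>z. F z $ l) z"]) simp
  then show "holomorphic_germ F"
    unfolding holomorphic_germ_def eventually_nhds using e(1)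
    by (intro exI[of _ "ball 0 e"]) auto
qed

text \<open>Needed to see that the inverse map has a complex linear derivative and is therefore
  holomorphic.\<close>

lemma inverse_matrix_linear:
  fixes A :: "complex ^ 'n ^ 'n::finite"
  assumes "bij (\<lambda>h. A *v h)"
  shows "\<exists>A'. inv_into UNIV (\<lambda>h. A *v h) = (\<lambda>h. A' *v h)"
proof -
  obtain A' where A': "A ** A' = mat 1"
    using assms matrix_right_invertible_surjective[of A] by (auto simp: bij_def)
  have "inv_into UNIV (\<lambda>h. A *v h) y = A' *v y" for y
  proof -
    have "A *v (A' *v y) = y"
      by (simp add: matrix_vector_mul_assoc A')
    then show ?thesis
      using assms by (metis bij_inv_eq_iff)
  qed
  then show ?thesis by blast
qed

text \<open>The real inverse function theorem applies because the partial derivatives are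
  continuous. It describes the derivative of the inverse as the inverse of a complex matrix.\<close>

lemma biholomorphic_germ_tangent_id:
  fixes F :: "complex ^ 'n \<Rightarrow> complex ^ 'n::finite"
  assumes F: "holomorphic_germ F" "F 0 = 0" "(F has_derivative (\<lambda>h. h)) (at 0)"
  shows "biholomorphic_germ F"
proof -
  obtain e where e: "e > 0" "\<And>l. multi_holomorphic (\<lambda>z. F z $ l) (ball 0 e)"
    using F(1) unfolding holomorphic_germ_iff by blast
  define A where "A z = (\<chi> l. \<chi> k. partial_deriv k (\<lambda>z. F z $ l) z)" for z
  have der: "(F has_derivative (\<lambda>h. A z *v h)) (at z)" if "z \<in> ball 0 e" for z
    unfolding has_derivative_matrix_iff A_def
    using multi_holomorphic_gradient[OF e(2) that] by simp
  define F' where "F' z = Blinfun (\<lambda>h. A z *v h)" for z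
  have F': "blinfun_apply (F' z) = (\<lambda>h. A z *v h)" if "z \<in> ball 0 e" for z
    unfolding F'_def by (rule bounded_linear_Blinfun_apply[OF has_derivative_bounded_linear[OF der[OF that]]])
  have cont: "continuous_on (ball 0 e) F'"
  proof (rule continuous_on_blinfun_componentwise)
    fix h :: "complex ^ 'n"
    have "continuous_on (ball 0 e) (\<lambda>z. A z *v h)"
      unfolding A_def matrix_vector_mult_def vec_lambda_beta
      by (intro continuous_on_vec_lambda continuous_intros partial_deriv_continuous_on[OF e(2) open_ball])
    then show "continuous_on (ball 0 e) (\<lambda>z. blinfun_apply (F' z) h)"
      by (rule continuous_on_eq) (simp add: F')
  qed
  have "(\<lambda>h. A 0 *v h) = (\<lambda>h. h)"
    using der[of 0] F(3) e(1) by (intro has_derivative_unique) auto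
  then have id: "F' 0 = id_blinfun"
    using F'[of 0] e(1) by (intro blinfun_eqI) simp
  have zero_in: "0 \<in> ball (0 :: complex ^ 'n) e" and comp: "id_blinfun o\<^sub>L F' 0 = id_blinfun"
    using e(1) by (auto simp: id intro: blinfun_eqI)
  have F'_der: "(F has_derivative blinfun_apply (F' z)) (at z)" if "z \<in> ball 0 e" for z
    using der[OF that] F'[OF that] by simp
  obtain U' V g g' where inv: "open U'" "U' \<subseteq> ball 0 e" "0 \<in> U'" "open V" "F 0 \<in> V" "homeomorphism U' V F g"
    "\<And>y. y \<in> V \<Longrightarrow> (g has_derivative (g' y)) (at y)"
    "\<And>y. y \<in> V \<Longrightarrow> g' y = inv_into UNIV (blinfun_apply (F' (g y)))"
    "\<And>y. y \<in> V \<Longrightarrow> bij (blinfun_apply (F' (g y)))"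
    by (rule inverse_function_theorem[OF open_ball F'_der cont zero_in comp]) (assumption | (rule that; assumption))+
  have "0 \<in> V" using inv(5) F(2) by simp
  have g_der: "\<exists>A'. (g has_derivative (\<lambda>h. A' *v h)) (at y)" if "y \<in> V" for y
  proof -
    have "g y \<in> ball 0 e"
      using inv(2,6) that by (auto simp: homeomorphism_def)
    then show ?thesis
      using inv(7-9)[OF that] inverse_matrix_linear[of "A (g y)"] by (simp add: F') metis
  qed
  have "holomorphic_germ g"
    unfolding holomorphic_germ_def
    by (rule eventually_mono[OF eventually_nhds_in_open[OF inv(4) \<open>0 \<in> V\<close>] g_der])
  moreover have "g 0 = 0"
    using inv(3,6) F(2) by (metis homeomorphism_apply1)
  moreover have "\<forall>\<^sub>F z in nhds 0. g (F z) = z"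
    by (rule eventually_mono[OF eventually_nhds_in_open[OF inv(1,3)]]) (rule homeomorphism_apply1[OF inv(6)])
  moreover have "\<forall>\<^sub>F z in nhds 0. F (g z) = z"
    by (rule eventually_mono[OF eventually_nhds_in_open[OF inv(4) \<open>0 \<in> V\<close>]]) (rule homeomorphism_apply2[OF inv(6)])
  ultimately show ?thesis
    unfolding biholomorphic_germ_def using F(1,2) by blast
qed

section \<open>Linearization of anti-holomorphic involutions\<close>

lemma vcnj_nth [simp]: "vcnj z $ k = cnj (z $ k)"
  by (simp add: vcnj_def)

lemma vcnj_vcnj [simp]: "vcnj (vcnj z) = z"
  by (simp add: vec_eq_iff)

lemma vcnj_0 [simp]: "vcnj 0 = 0"
  by (simp add: vec_eq_iff)

lemma has_derivative_vcnj: "(vcnj has_derivative vcnj) (at z)"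
  unfolding has_derivative_vec_iff vcnj_nth
  by (auto intro!: derivative_eq_intros bounded_linear.has_derivative[OF bounded_linear_vec_nth])

lemma filterlim_vcnj: "filterlim vcnj (nhds 0) (nhds 0)"
  using has_derivative_continuous[OF has_derivative_vcnj[of 0], unfolded isCont_def tendsto_at_iff_tendsto_nhds]
  unfolding vcnj_0 .

lemma vcnj_matrix_mult: "vcnj (A *v z) = map_matrix cnj A *v vcnj z"
  by (simp add: vec_eq_iff matrix_vector_mult_def)

lemma vcnj_scale_coords: "vcnj (scale_coords c z) = scale_coords (\<lambda>k. cnj (c k)) (vcnj z)"
  by (simp add: vec_eq_iff)

lemma diag_matrix_mult: "diag_matrix c *v z = scale_coords c z"
proof -
  have "(\<Sum>l\<in>UNIV. (if k = l then c k else 0) * z $ l) = (\<Sum>l\<in>UNIV. if k = l then c k * z $ l else 0)" for k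
    by (intro sum.cong) auto
  then show ?thesis
    by (simp add: vec_eq_iff matrix_vector_mult_def diag_matrix_def)
qed

lemma holomorphic_germ_cong:
  assumes "holomorphic_germ F" "\<forall>\<^sub>F z in nhds 0. F z = G z"
  shows "holomorphic_germ G"
proof -
  have "\<forall>\<^sub>F z in nhds 0. \<forall>\<^sub>F w in nhds z. F w = G w"
    using assms(2) by (simp add: eventually_eventually)
  with assms(1)[unfolded holomorphic_germ_def] show ?thesis
    unfolding holomorphic_germ_def
  proof eventually_elim
    case (elim z)
    then obtain A where A: "(F has_derivative (\<lambda>h. A *v h)) (at z)" by blast
    have "(G has_derivative (\<lambda>h. A *v h)) (at z)"
      by (rule has_derivative_transform_eventually[OF A])
         (use elim(2) in \<open>auto simp: eventually_at_filter elim: eventually_mono dest: eventually_nhds_x_imp_x\<close>)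
    then show ?case by blast
  qed
qed

lemma holomorphic_germ_conj:
  assumes "holomorphic_germ F"
  shows "holomorphic_germ (\<lambda>z. vcnj (F (vcnj z)))"
proof -
  have "\<forall>\<^sub>F z in nhds 0. \<exists>A. (F has_derivative (\<lambda>h. A *v h)) (at (vcnj z))"
    using eventually_compose_filterlim[OF assms[unfolded holomorphic_germ_def] filterlim_vcnj] .
  then show ?thesis
    unfolding holomorphic_germ_def
  proof eventually_elim
    case (elim z)
    then obtain A where A: "(F has_derivative (\<lambda>h. A *v h)) (at (vcnj z))" by blast
    have "((\<lambda>z. vcnj (F (vcnj z))) has_derivative (\<lambda>h. vcnj (A *v vcnj h))) (at z)"
      by (rule has_derivative_compose[OF has_derivative_compose[OF has_derivative_vcnj A] has_derivative_vcnj])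
    then have "((\<lambda>z. vcnj (F (vcnj z))) has_derivative (\<lambda>h. map_matrix cnj A *v h)) (at z)"
      by (simp add: vcnj_matrix_mult)
    then show ?case by blast
  qed
qed

lemma holomorphic_germ_linear: "holomorphic_germ (\<lambda>z. A *v z)"
  unfolding holomorphic_germ_iff multi_holomorphic_def has_gradient_def matrix_vector_mult_def
  by (intro exI[of _ 1] conjI allI ballI exI[of _ "A $ _"])
     (auto intro!: derivative_eq_intros bounded_linear.has_derivative[OF bounded_linear_vec_nth])

lemma holomorphic_germ_add:
  assumes "holomorphic_germ F" "holomorphic_germ G"
  shows "holomorphic_germ (\<lambda>z. F z + G z)"
  using assms unfolding holomorphic_germ_def
proof eventually_elim
  case (elim z)
  then obtain A C where "(F has_derivative (\<lambda>h. A *v h)) (at z)" "(G has_derivative (\<lambda>h. C *v h)) (at z)"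
    by blast
  then have "((\<lambda>z. F z + G z) has_derivative (\<lambda>h. A *v h + C *v h)) (at z)"
    by (rule has_derivative_add)
  then show ?case
    unfolding matrix_vector_mult_add_rdistrib[symmetric] by blast
qed

lemma mfps_eval_0 [simp]: "mfps_eval f 0 = mfps_nth f 0"
proof -
  have "((\<lambda>\<alpha>. mfps_nth f \<alpha> * mpow (\<lambda>_. 0) \<alpha>) has_sum mfps_nth f 0) UNIV"
  proof (rule has_sum_finite_neutralI[of "{0}"])
    fix \<alpha> :: "'a \<Rightarrow> nat" assume "\<alpha> \<in> UNIV - {0}"
    then have "mdeg \<alpha> \<noteq> 0" by simp
    then show "mfps_nth f \<alpha> * mpow (\<lambda>_. 0) \<alpha> = 0"
      by (simp add: mpow_const del: mdeg_eq_0_iff)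
  qed auto
  then show ?thesis
    by (simp add: mfps_eval_def infsumI)
qed

lemma mpow_scale_coords: "mpow (\<lambda>k. scale_coords c z $ k) \<alpha> = mpow c \<alpha> * mpow (\<lambda>k. z $ k) \<alpha>"
  by (simp add: mpow_def power_mult_distrib prod.distrib)

lemma holomorphic_germ_mfps:
  fixes \<Phi> :: "'n::finite mfps ^ 'n"
  assumes r: "0 < r" "\<And>l. mfps_summable (\<Phi> $ l) r" and \<Phi>: "fmap_tangent_id \<Phi>"
  defines "P \<equiv> \<lambda>z. \<chi> l. mfps_eval (\<Phi> $ l) z"
  shows "holomorphic_germ P" "P 0 = 0" "(P has_derivative (\<lambda>h. h)) (at 0)"
proof -
  have grad: "\<exists>a. has_gradient (\<lambda>z. P z $ l) a z \<and> (z = 0 \<longrightarrow> a = axis l 1)" if "z \<in> ball 0 (r / 2)" for z l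
  proof -
    have "cmod (z $ k) < r / 2" for k
      using cmod_nth_le[of z k] that by simp
    from mfps_eval_has_gradient[OF r(2,1) this, of l]
    obtain a where a: "has_gradient (mfps_eval (\<Phi> $ l)) a z"
      "z = 0 \<Longrightarrow> a $ k = mfps_nth (\<Phi> $ l) (munit k)" for k by blast
    then show ?thesis
      by (intro exI[of _ a])
         (auto simp: P_def vec_eq_iff axis_def fmap_tangent_id_nth[OF \<Phi>])
  qed
  show "holomorphic_germ P"
    unfolding holomorphic_germ_iff multi_holomorphic_def using grad r(1)
    by (intro exI[of _ "r / 2"]) fastforce
  show "P 0 = 0"
    using no_constant_tangent_id[OF \<Phi>] by (simp add: P_def vec_eq_iff no_constant_def)
  have "has_gradient (\<lambda>z. P z $ l) (mat 1 $ l) 0" for l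
  proof -
    have "has_gradient (\<lambda>z. P z $ l) (axis l 1) 0"
      using grad[of 0 l] r(1) by auto
    moreover have "axis l 1 = (mat 1 :: complex ^ 'n ^ 'n) $ l"
      by (auto simp: vec_eq_iff mat_def axis_def)
    ultimately show ?thesis by (simp only:)
  qed
  then have "(P has_derivative (\<lambda>h. mat 1 *v h)) (at 0)"
    unfolding has_derivative_matrix_iff by blast
  then show "(P has_derivative (\<lambda>h. h)) (at 0)" by simp
qed

lemma mfps_conjugacy_eval:
  fixes \<Phi> T :: "'n::finite mfps ^ 'n"
  assumes F: "has_mfps_expansion F T"
    and \<Phi>: "0 < r" "\<And>l. mfps_summable (\<Phi> $ l) r" "no_constant \<Phi>"
    and conj: "\<And>l \<beta>. mfps_nth (mfps_compose (T $ l) \<Phi>) \<beta> = mfps_nth (\<Phi> $ l) \<beta> * mpow c \<beta>"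
  shows "\<forall>\<^sub>F z in nhds 0. F (\<chi> l. mfps_eval (\<Phi> $ l) z) = (\<chi> l. mfps_eval (\<Phi> $ l) (scale_coords c z))"
proof -
  obtain s where s: "0 < s" "\<And>l. mfps_summable (T $ l) s"
    "\<And>z l. (\<And>k. cmod (z $ k) \<le> s) \<Longrightarrow> F z $ l = mfps_eval (T $ l) z"
    using has_mfps_expansionD[OF F] by metis
  define N where "N = (\<Sum>k\<in>UNIV. mfps_norm (\<Phi> $ k) r)"
  have N: "mfps_norm (\<Phi> $ k) r \<le> N" "0 \<le> N" for k
    unfolding N_def using \<Phi>(1) by (auto intro!: member_le_sum sum_nonneg mfps_norm_nonneg)
  \<comment> \<open>Shrinking the radius by \<open>a\<close> brings the norms of the components of
    \<Phi> below \<open>s\<close>, so that \<Phi> maps the smaller polydisc into the one where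
    \<open>T\<close> converges.\<close>
  define a where "a = s / (s + N)"
  have a: "0 < a" "a \<le> 1" "a * N \<le> s"
    using s(1) N(2) by (auto simp: a_def field_simps)
  have ar: "0 < a * r" "a * r \<le> r"
    using a \<Phi>(1) by auto
  have norm_le: "mfps_norm (\<Phi> $ k) (a * r) \<le> s" for k
  proof -
    have "mfps_norm (\<Phi> $ k) (a * r) \<le> a * mfps_norm (\<Phi> $ k) r"
      using \<Phi> a by (intro mfps_norm_shrink) (auto simp: no_constant_def)
    also have "\<dots> \<le> a * N"
      using a(1) N(1) by (intro mult_left_mono) auto
    finally show ?thesis using a(3) by simp
  qed
  have summable: "mfps_summable (\<Phi> $ k) (a * r)" for k
    using mfps_summable_mono[OF \<Phi>(2)] ar by (simp add: less_imp_le)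
  have "F (\<chi> l. mfps_eval (\<Phi> $ l) z) = (\<chi> l. mfps_eval (\<Phi> $ l) (scale_coords c z))" if z: "z \<in> ball 0 (a * r)" for z
  proof -
    have zk: "cmod (z $ k) \<le> a * r" for k
      using cmod_nth_le[of z k] z by simp
    have "cmod ((\<chi> l. mfps_eval (\<Phi> $ l) z) $ k) \<le> s" for k
      using cmod_mfps_eval_le[OF summable zk] norm_le order_trans by (simp only: vec_lambda_beta) blast
    from s(3)[OF this] have "F (\<chi> l. mfps_eval (\<Phi> $ l) z) $ l = mfps_eval (T $ l) (\<chi> l. mfps_eval (\<Phi> $ l) z)" for l .
    also have "\<dots> l = mfps_eval (mfps_compose (T $ l) \<Phi>) z" for l
      by (rule mfps_eval_compose[OF s(2) \<Phi>(3) summable norm_le zk, symmetric])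
    \<comment> \<open>The two series agree term by term, so the scaled point need not stay in the
      polydisc.\<close>
    also have "\<dots> l = mfps_eval (\<Phi> $ l) (scale_coords c z)" for l
      unfolding mfps_eval_def conj mpow_scale_coords mult.assoc ..
    finally show ?thesis by (simp add: vec_eq_iff)
  qed
  then show ?thesis
    unfolding eventually_nhds using ar(1) by (intro exI[of _ "ball 0 (a * r)"]) auto
qed

text \<open>Subtracting the linear part leaves a function with zero value and gradient at 0 and the
  same scaling law. Every higher derivative at 0 is fixed under multiplication by some number other
  than 1, so it vanishes, and the identity theorem applies.\<close>

lemma scaling_imp_linear:
  fixes H :: "complex ^ 'n \<Rightarrow> complex ^ 'n::finite"
  assumes H: "holomorphic_germ H" "H 0 = 0" "(H has_derivative (\<lambda>h. A *v h)) (at 0)"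
    and linear: "\<And>j z. scale_coords (d j) (A *v scale_coords (c j) z) = A *v z"
    and scale: "\<And>j. \<forall>\<^sub>F z in nhds 0. scale_coords (d j) (H (scale_coords (c j) z)) = H z"
    and nonres: "\<And>k Q. 2 \<le> mdeg Q \<Longrightarrow> \<exists>j. d j k * mpow (c j) Q \<noteq> 1"
  shows "\<forall>\<^sub>F z in nhds 0. H z = A *v z"
proof -
  define f where "f k z = H z $ k - (A *v z) $ k" for k z
  have germ: "holomorphic_germ (\<lambda>z. H z + (- A) *v z)"
    by (intro holomorphic_germ_add holomorphic_germ_linear H(1))
  have "(\<lambda>z. (H z + (- A) *v z) $ k) = f k" for k
    by (auto simp: f_def matrix_vector_mult_def sum_negf)
  with germ obtain e where e: "e > 0" "\<And>k. multi_holomorphic (f k) (ball 0 e)"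
    unfolding holomorphic_germ_iff by auto
  have f_scale: "\<forall>\<^sub>F z in nhds 0. d j k * f k (scale_coords (c j) z) = f k z" for j k
    using scale[of j]
  proof eventually_elim
    case (elim z)
    have "d j k * H (scale_coords (c j) z) $ k = H z $ k"
      using elim by (metis scale_coords_nth)
    moreover have "d j k * (A *v scale_coords (c j) z) $ k = (A *v z) $ k"
      using linear[of j z] by (metis scale_coords_nth)
    ultimately show ?case by (simp add: f_def right_diff_distrib)
  qed
  have zero: "partial_derivs ks (f k) 0 = 0" for ks k
  proof -
    consider "ks = []" | l where "ks = [l]" | "2 \<le> length ks"
      \<comment> \<open>This rule distinguishes lists of length 0, of length 1 and of length at
        least 2.\<close>
      by (cases ks rule: remdups_adj.cases) auto
    then show ?thesis
    proof cases
      case 1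
      then show ?thesis by (simp add: f_def H(2))
    next
      case (2 l)
      have "((\<lambda>z. A *v z) has_derivative (\<lambda>h. A *v h)) (at 0)"
        unfolding has_derivative_vec_iff matrix_vector_mult_def vec_lambda_beta
        by (auto intro!: derivative_eq_intros bounded_linear.has_derivative[OF bounded_linear_vec_nth])
      from has_derivative_diff[OF H(3) this] have "((\<lambda>z. H z - A *v z) has_derivative (\<lambda>h. 0)) (at 0)"
        by simp
      then have "has_gradient (f k) 0 0"
        unfolding has_derivative_vec_iff has_gradient_def f_def by simp
      then show ?thesis
        using 2 by (simp add: partial_deriv_eq)
    next
      case 3
      obtain Q where Q: "mdeg Q = length ks" "\<And>c :: 'n \<Rightarrow> complex. prod_list (map c ks) = mpow c Q"
        using prod_list_eq_mpow by blast
      obtain j where j: "d j k * mpow (c j) Q \<noteq> 1"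
        using nonres[of Q k] 3 Q(1) by auto
      have "(d j k * mpow (c j) Q) * partial_derivs ks (f k) 0 = partial_derivs ks (f k) 0"
        using eventually_nhds_x_imp_x[OF partial_derivs_scale[OF e(2) e(1) f_scale[of j k], of ks]]
        by (simp add: Q(2))
      with j show ?thesis by auto
    qed
  qed
  have "H z = A *v z" if "z \<in> ball 0 e" for z
    using multi_holomorphic_eq_0[OF e(2) zero that] by (simp add: f_def vec_eq_iff)
  then show ?thesis
    unfolding eventually_nhds using e(1) by (intro exI[of _ "ball 0 e"]) auto
qed

lemma antiholomorphic_germ_derivative:
  fixes R :: "complex ^ 'n \<Rightarrow> complex ^ 'n::finite"
  assumes "\<forall>\<^sub>F z in nhds 0. \<rho> z = B *v vcnj z + R (vcnj z)"
    and "(R has_derivative (\<lambda>_. 0)) (at 0)"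
  shows "(\<rho> has_derivative (\<lambda>h. B *v vcnj h)) (at 0)"
proof -
  have "((\<lambda>z. B *v z) has_derivative (\<lambda>h. B *v h)) (at z)" for z
    unfolding has_derivative_vec_iff matrix_vector_mult_def vec_lambda_beta
    by (auto intro!: derivative_eq_intros bounded_linear.has_derivative[OF bounded_linear_vec_nth])
  from has_derivative_compose[OF has_derivative_vcnj this]
  have "((\<lambda>z. B *v vcnj z) has_derivative (\<lambda>h. B *v vcnj h)) (at 0)" .
  moreover have "((\<lambda>z. R (vcnj z)) has_derivative (\<lambda>h. 0)) (at 0)"
    using has_derivative_compose[OF has_derivative_vcnj[of 0], of R "\<lambda>_. 0"] assms(2) by simp
  ultimately have "((\<lambda>z. B *v vcnj z + R (vcnj z)) has_derivative (\<lambda>h. B *v vcnj h + 0)) (at 0)"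
    by (rule has_derivative_add)
  then have "((\<lambda>z. B *v vcnj z + R (vcnj z)) has_derivative (\<lambda>h. B *v vcnj h)) (at 0)"
    by simp
  then show ?thesis
  proof (rule has_derivative_transform_eventually)
    show "\<forall>\<^sub>F z in at 0 within UNIV. B *v vcnj z + R (vcnj z) = \<rho> z"
      unfolding eventually_at_filter using assms(1) by eventually_elim simp
    show "B *v vcnj 0 + R (vcnj 0) = \<rho> 0"
      using eventually_nhds_x_imp_x[OF assms(1)] by simp
  qed simp
qed

text \<open>With D the product of B and conj C, the matrix D B conj D equals B (conj C) (B conj B)
  C, and both inner products collapse to the identity.\<close>

lemma diag_matrix_conj_product:
  fixes B C :: "complex ^ 'n ^ 'n::finite"
  assumes B: "B ** map_matrix cnj B = mat 1" and C: "C ** map_matrix cnj C = mat 1"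
    and D: "diag_matrix d = B ** map_matrix cnj C"
  shows "scale_coords d (B *v scale_coords (\<lambda>k. cnj (d k)) z) = B *v z"
proof -
  have conj_mult: "map_matrix cnj (X ** Y) = map_matrix cnj X ** map_matrix cnj Y" for X Y :: "complex ^ 'n ^ 'n"
    by (simp add: vec_eq_iff matrix_matrix_mult_def)
  have conj_conj: "map_matrix cnj (map_matrix cnj X) = X" for X :: "complex ^ 'n ^ 'n"
    by (simp add: vec_eq_iff)
  have conj_1: "map_matrix cnj (mat 1) = (mat 1 :: complex ^ 'n ^ 'n)"
    by (simp add: vec_eq_iff mat_def)
  have C': "map_matrix cnj C ** C = mat 1"
    using arg_cong[OF C, of "map_matrix cnj"] by (simp only: conj_mult conj_conj conj_1)
  have "diag_matrix (\<lambda>k. cnj (d k)) = map_matrix cnj (diag_matrix d)"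
    by (simp add: vec_eq_iff diag_matrix_def)
  also have "\<dots> = map_matrix cnj B ** C"
    by (simp only: D conj_mult conj_conj)
  finally have "diag_matrix d ** (B ** diag_matrix (\<lambda>k. cnj (d k))) =
      B ** (map_matrix cnj C ** ((B ** map_matrix cnj B) ** C))"
    by (simp only: D matrix_mul_assoc)
  also have "\<dots> = B"
    by (simp only: B C' matrix_mul_lid matrix_mul_rid)
  finally have "diag_matrix d *v (B *v (diag_matrix (\<lambda>k. cnj (d k)) *v z)) = B *v z"
    by (simp only: matrix_vector_mul_assoc)
  then show ?thesis
    by (simp only: diag_matrix_mult)
qed

lemma diag_matrix_conj_product_entry:
  fixes B C :: "complex ^ 'n ^ 'n::finite"
  assumes "B ** map_matrix cnj B = mat 1" "C ** map_matrix cnj C = mat 1"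
    and "diag_matrix d = B ** map_matrix cnj C"
  shows "d k * cnj (d l) * B $ k $ l = B $ k $ l"
proof -
  have axis: "(B *v axis l c) $ k = B $ k $ l * c" for c
  proof -
    have "(\<Sum>j\<in>UNIV. B $ k $ j * axis l c $ j) = (\<Sum>j\<in>UNIV. if j = l then B $ k $ l * c else 0)"
      by (intro sum.cong) (auto simp: axis_def)
    then show ?thesis by (simp add: matrix_vector_mult_def)
  qed
  have "scale_coords (\<lambda>k. cnj (d k)) (axis l 1) = axis l (cnj (d l))"
    by (auto simp: vec_eq_iff axis_def)
  with diag_matrix_conj_product[OF assms, of "axis l 1"]
  have "scale_coords d (B *v axis l (cnj (d l))) $ k = (B *v axis l 1) $ k" by simp
  then show ?thesis by (simp add: axis mult_ac)
qed

theorem corollary3p2: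
  fixes M :: "'m::finite \<Rightarrow> (complex ^ 'n::finite) set"
    and \<rho> R :: "'m \<Rightarrow> complex ^ 'n \<Rightarrow> complex ^ 'n"
    and B :: "'m \<Rightarrow> complex ^ 'n ^ 'n"
    and \<mu> :: "'m \<Rightarrow> 'm \<Rightarrow> 'n \<Rightarrow> complex"
  assumes "\<And>i. totally_real_analytic_germ (M i)"
    and "\<And>i. \<forall>\<^sub>F z in nhds 0. \<rho> i z = B i *v vcnj z + R i (vcnj z)"
    and "\<And>i. holomorphic_germ (R i)"
    and "\<And>i. R i 0 = 0"
    and "\<And>i. (R i has_derivative (\<lambda>_. 0)) (at 0)"
    and "\<And>i. invertible (B i)"
    and "\<And>i. B i ** map_matrix cnj (B i) = mat 1"
    and "\<And>i. \<forall>\<^sub>F z in nhds 0. \<rho> i (\<rho> i z) = z"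
    and "\<And>i. \<forall>\<^sub>F z in nhds 0. z \<in> M i \<longleftrightarrow> \<rho> i z = z"
    and "\<And>i j. i \<noteq> j \<Longrightarrow> {z. z = B i *v vcnj z} \<noteq> {z. z = B j *v vcnj z}"
    and "comm_group (subgroup_generated biholomorphic_germs {germ (\<rho> i \<circ> \<rho> j) | i j. True})"
    and "\<And>i j. ((\<rho> i \<circ> \<rho> j) has_derivative (\<lambda>h. diag_matrix (\<mu> i j) *v h)) (at 0)"
    and "nonresonant \<mu>"
    and "formally_linearizable (\<lambda>i j. \<rho> i \<circ> \<rho> j) (\<lambda>i j. diag_matrix (\<mu> i j))"
    and "diophantine \<mu>"
  shows "\<exists>\<Phi>. biholomorphic_germ \<Phi> \<and>
    (\<forall>i. \<forall>\<^sub>F z in nhds 0. z \<in> M i \<longleftrightarrow> B i *v vcnj (\<Phi> z) = \<Phi> z)"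
proof -
  note \<rho>_eq = assms(2) and R = assms(3-5) and BB = assms(7) and invol = assms(8) and fixed = assms(9)
  have \<rho>_der: "(\<rho> i has_derivative (\<lambda>h. B i *v vcnj h)) (at 0)" for i
    by (rule antiholomorphic_germ_derivative[OF \<rho>_eq R(3)])
  have \<rho>_0 [simp]: "\<rho> i 0 = 0" for i
    using eventually_nhds_x_imp_x[OF \<rho>_eq[of i]] R(2) by simp
  have \<rho>_lim: "filterlim (\<rho> i) (nhds 0) (nhds 0)" for i
    using has_derivative_continuous[OF \<rho>_der[of i], unfolded isCont_def tendsto_at_iff_tendsto_nhds]
    unfolding \<rho>_0 .
  have D: "diag_matrix (\<mu> i j) = B i ** map_matrix cnj (B j)" for i j
  proof -
    have "(\<rho> i has_derivative (\<lambda>h. B i *v vcnj h)) (at (\<rho> j 0))"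
      using \<rho>_der by simp
    from has_derivative_compose[OF \<rho>_der[of j] this]
    have "((\<rho> i \<circ> \<rho> j) has_derivative (\<lambda>h. (B i ** map_matrix cnj (B j)) *v h)) (at 0)"
      by (simp add: o_def vcnj_matrix_mult matrix_vector_mul_assoc)
    from has_derivative_unique[OF assms(12) this] show ?thesis
      by (metis matrix_eq)
  qed
  note linear = diag_matrix_conj_product[OF BB BB D]
  note entry = diag_matrix_conj_product_entry[OF BB BB D]
  have column: "\<exists>k. B i $ k $ l \<noteq> 0" for i l
  proof (rule ccontr)
    assume "\<not> (\<exists>k. B i $ k $ l \<noteq> 0)"
    then have "B i *v axis l 1 = 0"
      by (auto simp: vec_eq_iff matrix_vector_mult_def axis_def if_distrib cong: if_cong)
    moreover obtain C where "C ** B i = mat 1"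
      using assms(6) by (auto simp: invertible_def)
    ultimately have "axis l (1::complex) = (0 :: complex ^ 'n)"
      by (metis matrix_vector_mul_assoc matrix_vector_mul_lid matrix_vector_mult_0_right)
    then show False
      by (metis norm_axis norm_one norm_zero zero_neq_one)
  qed
  \<comment> \<open>The index \<open>l\<close> is the row of a nonzero entry in column
    \<open>k\<close> of \<open>B i\<close>. As \<open>B i\<close> does not involve \<open>j\<close>,
    one \<open>l\<close> serves all \<open>j\<close>.\<close>
  have conj_inverse: "\<exists>l. \<forall>j. \<mu> i j l * cnj (\<mu> i j k) = 1" for i k
    using column[of i k] entry by (metis mult_cancel_right1)
  have nonzero: "\<mu> i j k \<noteq> 0" for i j k
    using conj_inverse[of i k] by (metis complex_cnj_zero mult_zero_right zero_neq_one)
  interpret diophantine_family \<mu>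
  proof
    fix Q :: "'n \<Rightarrow> nat" and k assume Q: "2 \<le> mdeg Q"
    show "small_divisor \<mu> Q k \<noteq> 0"
    proof
      assume 0: "small_divisor \<mu> Q k = 0"
      \<comment> \<open>A vanishing maximum makes all pairs resonant at once. Conjugating and
        replacing \<open>k\<close> by the index \<open>l\<close> of \<open>conj_inverse\<close>
        contradicts non-resonance at \<open>(i, l, Q)\<close>.\<close>
      have res: "mpow (\<mu> i j) Q = \<mu> i j k" for i j
      proof -
        have "cmod (mpow (\<mu> i j) Q - \<mu> i j k) \<le> small_divisor \<mu> Q k"
          unfolding small_divisor_def by (rule Max_ge) (auto intro: image_eqI[of _ _ "(i, j)"])
        then show ?thesis using 0 by simp
      qed
      fix i :: 'm
      obtain l where l: "\<And>j. \<mu> i j l * cnj (\<mu> i j k) = 1"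
        using conj_inverse by blast
      have "mpow (\<lambda>l. cnj (\<mu> i j l)) Q = cnj (mpow (\<mu> i j) Q)" for j
        by (simp add: mpow_def)
      then have "mpow (\<lambda>l. cnj (\<mu> i j l)) Q = inverse (\<mu> i j l)" for j
        using res l[of j] by (simp add: inverse_unique)
      then show False
        using assms(13) Q unfolding nonresonant_def by blast
    qed
  qed (use nonzero assms(15) in auto)
  obtain T \<Phi> \<Psi> where T: "\<And>i j. has_mfps_expansion (\<rho> i \<circ> \<rho> j) (T i j)"
    and \<Phi>: "fmap_tangent_id \<Phi>" "fmap_inverse_pair \<Phi> \<Psi>"
    and formal: "\<And>i j. fmap_compose \<Psi> (fmap_compose (T i j) \<Phi>) = fmap_linear (diag_matrix (\<mu> i j))"
    using assms(14) unfolding formally_linearizable_def by blast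
  have "\<exists>r>0. \<forall>l. mfps_summable (T i j $ l) r \<and> mfps_nth (T i j $ l) 0 = 0" for i j
  proof -
    obtain r where r: "0 < r" "\<And>l. mfps_summable (T i j $ l) r"
      "\<And>z l. (\<And>k. cmod (z $ k) \<le> r) \<Longrightarrow> (\<rho> i \<circ> \<rho> j) z $ l = mfps_eval (T i j $ l) z"
      using has_mfps_expansionD[OF T[of i j]] by metis
    have "mfps_nth (T i j $ l) 0 = 0" for l
      using r(3)[of 0 l] r(1) by simp
    with r show ?thesis by blast
  qed
  then obtain r where r: "\<And>i j. 0 < r i j" "\<And>i j l. mfps_summable (T i j $ l) (r i j)"
    and T0: "\<And>i j. no_constant (T i j)"
    unfolding no_constant_def by metis
  note conj = formal_conjugacy[OF \<Phi>(2) T0 formal]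
  \<comment> \<open>One radius, and below one constant \<open>c\<close>, for all pairs, as the
    convergence estimate requires.\<close>
  define s where "s = Min (range (\<lambda>(i, j). r i j))"
  have s: "0 < s" "s \<le> r i j" for i j
    unfolding s_def using r(1) by (auto intro!: Min_le image_eqI[of _ _ "(i, j)"])
  have T_summable: "mfps_summable (T i j $ l) s" for i j l
    using mfps_summable_mono[OF r(2)] s by (simp add: less_imp_le)
  define c where "c = (\<Sum>(i, j, l) \<in> UNIV. mfps_norm (T i j $ l) s)"
  have norm_le: "mfps_norm (T i j $ l) s \<le> c" for i j l
  proof -
    have "(case (i, j, l) of (i, j, l) \<Rightarrow> mfps_norm (T i j $ l) s) \<le> c"
      unfolding c_def by (rule member_le_sum) (use s(1) in \<open>auto intro!: mfps_norm_nonneg\<close>)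
    then show ?thesis by simp
  qed
  have T_le: "cmod (mfps_nth (T i j $ l) \<alpha>) \<le> c * (1 / s) ^ mdeg \<alpha>" for i j l \<alpha>
    by (rule order_trans[OF mfps_coeff_le[OF T_summable s(1)] mult_right_mono[OF norm_le]]) (use s(1) in simp)
  have "0 \<le> c"
    unfolding c_def using s(1) by (auto intro!: sum_nonneg mfps_norm_nonneg)
  obtain a where a: "0 < a" "\<And>l. mfps_summable (\<Phi> $ l) a"
    using linearization_converges[OF \<Phi>(1) conj T_le \<open>0 \<le> c\<close>] s(1) unfolding mfps_summable_def by auto
  define P where "P z = (\<chi> l. mfps_eval (\<Phi> $ l) z)" for z
  have P: "holomorphic_germ P" "P 0 = 0" "(P has_derivative (\<lambda>h. h)) (at 0)"
    using holomorphic_germ_mfps[OF a \<Phi>(1)] unfolding P_def by auto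
  have P_conj: "\<forall>\<^sub>F z in nhds 0. \<rho> i (\<rho> j (P z)) = P (scale_coords (\<mu> i j) z)" for i j
    using mfps_conjugacy_eval[OF T a no_constant_tangent_id[OF \<Phi>(1)] conj] unfolding P_def by simp
  have "biholomorphic_germ P"
    by (rule biholomorphic_germ_tangent_id[OF P])
  then obtain g where g: "holomorphic_germ g" "g 0 = 0"
    "\<forall>\<^sub>F z in nhds 0. g (P z) = z" "\<forall>\<^sub>F z in nhds 0. P (g z) = z"
    unfolding biholomorphic_germ_def by blast
  have lim: "filterlim P (nhds 0) (nhds 0)" "filterlim g (nhds 0) (nhds 0)"
    using holomorphic_germ_tendsto P g by auto
  have g_der: "(g has_derivative (\<lambda>h. h)) (at 0)"
  proof -
    obtain A where A: "(g has_derivative (\<lambda>h. A *v h)) (at 0)"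
      using eventually_nhds_x_imp_x[OF g(1)[unfolded holomorphic_germ_def]] by blast
    have "((\<lambda>z. P (g z)) has_derivative (\<lambda>h. A *v h)) (at 0)"
      using has_derivative_compose[OF A, of P "\<lambda>h. h"] P(3) g(2) by simp
    moreover have "((\<lambda>z. P (g z)) has_derivative (\<lambda>h. h)) (at 0)"
    proof (rule has_derivative_transform_eventually[OF has_derivative_ident])
      show "\<forall>\<^sub>F z in at 0 within UNIV. z = P (g z)"
        unfolding eventually_at_filter using g(4) by eventually_elim simp
    qed (use P(2) g(2) in auto)
    ultimately have "(\<lambda>h. A *v h) = (\<lambda>h. h)"
      by (rule has_derivative_unique)
    with A show ?thesis by simp
  qed
  \<comment> \<open>The involution in the new coordinates precomposed with conjugation, which makes
    it holomorphic.\<close>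
  define H where "H i z = g (\<rho> i (P (vcnj z)))" for i z
  have H_lim: "filterlim (\<lambda>z. \<rho> i (P z)) (nhds 0) (nhds 0)" for i
    using filterlim_compose[OF \<rho>_lim lim(1)] .
  have H_holo: "holomorphic_germ (H i)" for i
  proof -
    have G: "holomorphic_germ (\<lambda>z. B i *v z + R i z)" "B i *v 0 + R i 0 = 0"
      using R by (auto intro: holomorphic_germ_add holomorphic_germ_linear)
    have cP: "holomorphic_germ (\<lambda>z. vcnj (P (vcnj z)))" "vcnj (P (vcnj 0)) = 0"
      using holomorphic_germ_conj[OF P(1)] P(2) by auto
    have "holomorphic_germ (\<lambda>z. g (B i *v vcnj (P (vcnj z)) + R i (vcnj (P (vcnj z)))))"
      using holomorphic_germ_compose[OF g(1) holomorphic_germ_compose[OF G(1) cP]] cP(2) G(2) by simp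
    moreover have "\<forall>\<^sub>F z in nhds 0. g (B i *v vcnj (P (vcnj z)) + R i (vcnj (P (vcnj z)))) = H i z"
      using eventually_compose_filterlim[OF \<rho>_eq[of i] filterlim_compose[OF lim(1) filterlim_vcnj]]
      by eventually_elim (simp add: H_def)
    ultimately show ?thesis by (rule holomorphic_germ_cong)
  qed
  have H_der: "(H i has_derivative (\<lambda>h. B i *v h)) (at 0)" for i
  proof -
    have "((\<lambda>z. P (vcnj z)) has_derivative vcnj) (at 0)"
      using has_derivative_compose[OF has_derivative_vcnj[of 0], of P "\<lambda>h. h"] P(3) by simp
    moreover have "(\<rho> i has_derivative (\<lambda>h. B i *v vcnj h)) (at (P (vcnj 0)))"
      using \<rho>_der[of i] P(2) by simp
    ultimately have "((\<lambda>z. \<rho> i (P (vcnj z))) has_derivative (\<lambda>h. B i *v vcnj (vcnj h))) (at 0)"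
      by (rule has_derivative_compose)
    moreover have "(g has_derivative (\<lambda>h. h)) (at (\<rho> i (P (vcnj 0))))"
      using g_der P(2) by simp
    ultimately have "((\<lambda>z. g (\<rho> i (P (vcnj z)))) has_derivative (\<lambda>h. B i *v vcnj (vcnj h))) (at 0)"
      by (rule has_derivative_compose)
    then show ?thesis unfolding H_def[abs_def] by simp
  qed
  \<comment> \<open>Write \<sigma>_i for the involution in the new coordinates, so that D_ij is
    \<sigma>_i \<sigma>_j. Then \<sigma>_i D_ij = \<sigma>_j and D_ij \<sigma>_j = \<sigma>_i, hence
    D_ij \<sigma>_i D_ij = \<sigma>_i.\<close>
  have H_scale: "\<forall>\<^sub>F z in nhds 0. scale_coords (\<mu> i j) (H i (scale_coords (\<lambda>k. cnj (\<mu> i j k)) z)) = H i z" for i j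
  proof -
    have "\<forall>\<^sub>F w in nhds 0. scale_coords (\<mu> i j) (g (\<rho> i (P (scale_coords (\<mu> i j) w)))) = g (\<rho> i (P w))"
      using P_conj[of i j]
        eventually_compose_filterlim[OF invol[of i] H_lim[of j]]
        eventually_compose_filterlim[OF P_conj[of i j] filterlim_compose[OF lim(2) H_lim[of j]]]
        eventually_compose_filterlim[OF g(4) H_lim[of j]]
        eventually_compose_filterlim[OF invol[of j] lim(1)]
        eventually_compose_filterlim[OF g(3) filterlim_compose[OF filterlim_scale_coords filterlim_compose[OF lim(2) H_lim[of j]], of "\<mu> i j"]]
    proof eventually_elim
      case (elim w)
      define v where "v = g (\<rho> j (P w))"
      have "g (\<rho> i (P (scale_coords (\<mu> i j) w))) = v"
        using elim(1,2) by (metis v_def)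
      moreover have "P (scale_coords (\<mu> i j) v) = \<rho> i (P w)"
        using elim(3-5) by (simp add: v_def)
      moreover have "g (P (scale_coords (\<mu> i j) v)) = scale_coords (\<mu> i j) v"
        using elim(6) by (simp add: v_def)
      ultimately show ?case by simp
    qed
    from eventually_compose_filterlim[OF this filterlim_vcnj] show ?thesis
      by eventually_elim (simp add: H_def vcnj_scale_coords)
  qed
  have H_linear: "\<forall>\<^sub>F z in nhds 0. H i z = B i *v z" for i
  proof (rule scaling_imp_linear[OF H_holo _ H_der linear H_scale])
    show "H i 0 = 0" by (simp add: H_def P(2) g(2))
    fix k and Q :: "'n \<Rightarrow> nat" assume "2 \<le> mdeg Q"
    then obtain j where "mpow (\<lambda>l. cnj (\<mu> i j l)) Q \<noteq> inverse (\<mu> i j k)"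
      using assms(13) unfolding nonresonant_def by blast
    then show "\<exists>j. \<mu> i j k * mpow (\<lambda>l. cnj (\<mu> i j l)) Q \<noteq> 1"
      using inverse_unique by metis
  qed
  \<comment> \<open>The coordinates sought are given by the inverse \<open>g\<close> of the
    linearization \<open>P\<close>.\<close>
  have "biholomorphic_germ g"
    using g P unfolding biholomorphic_germ_def by blast
  moreover have "\<forall>\<^sub>F z in nhds 0. z \<in> M i \<longleftrightarrow> B i *v vcnj (g z) = g z" for i
    using fixed[of i] g(4)
      eventually_compose_filterlim[OF H_linear[of i] filterlim_compose[OF filterlim_vcnj lim(2)]]
      eventually_compose_filterlim[OF g(4) \<rho>_lim[of i]]
  proof eventually_elim
    case (elim z)
    have "B i *v vcnj (g z) = g (\<rho> i z)"
      using elim(2,3) by (simp add: H_def)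
    \<comment> \<open>The converse needs injectivity of \<open>g\<close> at the points
      \<open>\<rho> i z\<close> and \<open>z\<close>, which \<open>P\<close> provides as an inverse
      at both.\<close>
    then show ?case using elim(1,2,4) by metis
  qed
  ultimately show ?thesis by blast
qed

end
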